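(* Let $(M, g)$ be an $n$-dimensional compact connected Riemannian manifold, $\lambda > 0$ a constant and $f : M \rightarrow \mathbb{R}$ a smooth function satisfying \[ \operatorname{Ric}_{g} + \operatorname{Hess} f = \lambda g \] (that is, $(M,g)$ is a compact shrinking Ricci soliton with potential function $f$), normalized so that \[ R + |\nabla f|^{2} = 2 \lambda f \] on $M$, where $R$ is the scalar curvature of $(M,g)$. Then \[ \operatorname{diam}(M, g) \leqslant \frac{\pi}{\sqrt{\lambda}} \sqrt{n - 1 + \frac{4 R_{\mathrm{max}}}{\pi \lambda}}, \] where $R_{\mathrm{max}}$ denotes the maximum value of $R$ on $M$.
   Context: Manifolds are smooth and without boundary. $\operatorname{Ric}_g$ is the Ricci tensor, $\nabla f$ is the gradient of $f$, and $\operatorname{Hess} f(X,Y) = g(\nabla_X \nabla f, Y)$. $\operatorname{diam}(M,g)$ is the diameter with respect to the Riemannian distance. For a connected gradient Ricci soliton, $R + |\nabla f|^2 - 2\lambda f$ is constant, so when $\lambda > 0$ the normalization can always be achieved by adding a constant to $f$. *)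

theory Defs
  imports "HOL-Analysis.Analysis"
begin

section \<open>Smooth maps between Euclidean spaces\<close>

text \<open>Meant for open \<open>S\<close>: a map is \<open>C\<^sup>k\<^sup>+\<^sup>1\<close> iff it is differentiable
  and all its directional derivatives are \<open>C\<^sup>k\<close>.\<close>

fun Ck_on :: "nat \<Rightarrow> 'b::euclidean_space set \<Rightarrow> ('b \<Rightarrow> 'c::real_normed_vector) \<Rightarrow> bool" where
  "Ck_on 0 S F \<longleftrightarrow> continuous_on S F"
| "Ck_on (Suc k) S F \<longleftrightarrow>
     (\<forall>x\<in>S. F differentiable (at x)) \<and> (\<forall>v. Ck_on k S (\<lambda>x. frechet_derivative F (at x) v))"

definition smooth_on :: "'b::euclidean_space set \<Rightarrow> ('b \<Rightarrow> 'c::real_normed_vector) \<Rightarrow> bool" where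
  "smooth_on S F \<longleftrightarrow> (\<forall>k. Ck_on k S F)"


section \<open>Smooth manifolds\<close>

text \<open>A chart is a pair of its domain and its coordinate map; the values of the coordinate
  map outside the domain are irrelevant.  The underlying set of a manifold is the
  \<^const>\<open>topspace\<close> of its topology, and its smooth structure is given by a (not necessarily
  maximal) atlas.\<close>

type_synonym ('a, 'n) chart = "'a set \<times> ('a \<Rightarrow> (real, 'n) vec)"

abbreviation chart_image :: "('a, 'n) chart \<Rightarrow> (real, 'n) vec set" where
  "chart_image c \<equiv> snd c ` fst c"

abbreviation chart_inv :: "('a, 'n) chart \<Rightarrow> (real, 'n) vec \<Rightarrow> 'a" where
  "chart_inv c \<equiv> inv_into (fst c) (snd c)"

definition is_chart :: "'a topology \<Rightarrow> ('a, 'n::finite) chart \<Rightarrow> bool" where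
  "is_chart X c \<longleftrightarrow>
     openin X (fst c) \<and> open (chart_image c) \<and>
     homeomorphic_map (subtopology X (fst c)) (top_of_set (chart_image c)) (snd c)"

definition transition :: "('a, 'n) chart \<Rightarrow> ('a, 'n) chart \<Rightarrow> (real, 'n) vec \<Rightarrow> (real, 'n) vec" where
  "transition c d = snd d \<circ> chart_inv c"

definition smooth_manifold :: "'a topology \<Rightarrow> ('a, 'n::finite) chart set \<Rightarrow> bool" where
  "smooth_manifold X A \<longleftrightarrow>
     Hausdorff_space X \<and> second_countable X \<and>
     (\<forall>c\<in>A. is_chart X c) \<and> (\<Union>c\<in>A. fst c) = topspace X \<and>
     (\<forall>c\<in>A. \<forall>d\<in>A. smooth_on (snd c ` (fst c \<inter> fst d)) (transition c d))"

definition coord_rep :: "('a, 'n) chart \<Rightarrow> ('a \<Rightarrow> real) \<Rightarrow> (real, 'n) vec \<Rightarrow> real" where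
  "coord_rep c f = f \<circ> chart_inv c"

definition smooth_function :: "('a, 'n::finite) chart set \<Rightarrow> ('a \<Rightarrow> real) \<Rightarrow> bool" where
  "smooth_function A f \<longleftrightarrow> (\<forall>c\<in>A. smooth_on (chart_image c) (coord_rep c f))"

text \<open>Some chart around \<open>p\<close>.  It is only used to evaluate quantities that do not depend on
  the choice of the chart.\<close>

definition chart_at :: "('a, 'n) chart set \<Rightarrow> 'a \<Rightarrow> ('a, 'n) chart" where
  "chart_at A p = (SOME c. c \<in> A \<and> p \<in> fst c)"


section \<open>Riemannian geometry in a coordinate domain\<close>

text \<open>Below, \<open>G\<close> is the field of matrices \<open>g\<^sub>i\<^sub>j\<close> of a Riemannian metric on an open subset
  of Euclidean space, and vector fields and functions are given in the same coordinates.\<close>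

definition metric_form :: "(real^'n \<Rightarrow> real^'n^'n) \<Rightarrow> real^'n \<Rightarrow> real^'n \<Rightarrow> real^'n \<Rightarrow> real" where
  "metric_form G x v w = (G x *v v) \<bullet> w"

definition partial :: "'n::finite \<Rightarrow> (real^'n \<Rightarrow> 'c::real_normed_vector) \<Rightarrow> real^'n \<Rightarrow> 'c" where
  "partial i F x = frechet_derivative F (at x) (axis i 1)"

text \<open>The Christoffel symbol of the Levi-Civita connection; \<open>k\<close> is the upper index.\<close>

definition christoffel :: "(real^'n \<Rightarrow> real^'n^'n) \<Rightarrow> real^'n \<Rightarrow> 'n \<Rightarrow> 'n \<Rightarrow> 'n \<Rightarrow> real" where
  "christoffel G x k i j =
     (1/2) * (\<Sum>l\<in>UNIV. matrix_inv (G x) $ k $ l *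
       (partial i (\<lambda>y. G y $ j $ l) x + partial j (\<lambda>y. G y $ i $ l) x
        - partial l (\<lambda>y. G y $ i $ j) x))"

definition covariant_derivative ::
  "(real^'n \<Rightarrow> real^'n^'n) \<Rightarrow> (real^'n \<Rightarrow> real^'n) \<Rightarrow> (real^'n \<Rightarrow> real^'n) \<Rightarrow> real^'n \<Rightarrow> real^'n" where
  "covariant_derivative G V W x =
     frechet_derivative W (at x) (V x) +
     (\<chi> k. \<Sum>i\<in>UNIV. \<Sum>j\<in>UNIV. christoffel G x k i j * V x $ i * W x $ j)"

definition lie_bracket :: "(real^'n \<Rightarrow> real^'n) \<Rightarrow> (real^'n \<Rightarrow> real^'n) \<Rightarrow> real^'n \<Rightarrow> real^'n" where
  "lie_bracket V W x = frechet_derivative W (at x) (V x) - frechet_derivative V (at x) (W x)"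

definition riemann_curvature ::
  "(real^'n \<Rightarrow> real^'n^'n) \<Rightarrow> (real^'n \<Rightarrow> real^'n) \<Rightarrow> (real^'n \<Rightarrow> real^'n) \<Rightarrow> (real^'n \<Rightarrow> real^'n) \<Rightarrow>
     real^'n \<Rightarrow> real^'n" where
  "riemann_curvature G U V W x =
     covariant_derivative G U (covariant_derivative G V W) x
     - covariant_derivative G V (covariant_derivative G U W) x
     - covariant_derivative G (lie_bracket U V) W x"

text \<open>\<open>Ric(v, w)\<close> is the trace of \<open>u \<mapsto> R(u, v)w\<close>, with sign such that round spheres have
  positive Ricci curvature.  Tangent vectors at \<open>x\<close> are extended to vector fields with
  constant coordinates.\<close>

definition ricci :: "(real^'n \<Rightarrow> real^'n^'n) \<Rightarrow> real^'n \<Rightarrow> real^'n \<Rightarrow> real^'n \<Rightarrow> real" where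
  "ricci G x v w = trace (matrix (\<lambda>u. riemann_curvature G (\<lambda>_. u) (\<lambda>_. v) (\<lambda>_. w) x))"

definition scalar_curvature_coord :: "(real^'n \<Rightarrow> real^'n^'n) \<Rightarrow> real^'n \<Rightarrow> real" where
  "scalar_curvature_coord G x =
     (\<Sum>i\<in>UNIV. \<Sum>j\<in>UNIV. matrix_inv (G x) $ i $ j * ricci G x (axis i 1) (axis j 1))"

definition gradient :: "(real^'n \<Rightarrow> real^'n^'n) \<Rightarrow> (real^'n \<Rightarrow> real) \<Rightarrow> real^'n \<Rightarrow> real^'n" where
  "gradient G F x = matrix_inv (G x) *v (\<chi> i. partial i F x)"

definition hessian ::
  "(real^'n \<Rightarrow> real^'n^'n) \<Rightarrow> (real^'n \<Rightarrow> real) \<Rightarrow> real^'n \<Rightarrow> real^'n \<Rightarrow> real^'n \<Rightarrow> real" where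
  "hessian G F x v w = metric_form G x (covariant_derivative G (\<lambda>_. v) (gradient G F) x) w"


section \<open>Riemannian manifolds\<close>

text \<open>A Riemannian metric is given by its matrix in every chart of the atlas, subject to the
  transformation law of a covariant 2-tensor.\<close>

type_synonym ('a, 'n) metric_tensor =
  "('a, 'n) chart \<Rightarrow> (real, 'n) vec \<Rightarrow> ((real, 'n) vec, 'n) vec"

definition riemannian_metric ::
  "('a, 'n::finite) chart set \<Rightarrow> ('a, 'n) metric_tensor \<Rightarrow> bool" where
  "riemannian_metric A g \<longleftrightarrow>
     (\<forall>c\<in>A. smooth_on (chart_image c) (g c)) \<and>
     (\<forall>c\<in>A. \<forall>x\<in>chart_image c.
        (\<forall>v w. metric_form (g c) x v w = metric_form (g c) x w v) \<and>
        (\<forall>v. v \<noteq> 0 \<longrightarrow> metric_form (g c) x v v > 0)) \<and>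
     (\<forall>c\<in>A. \<forall>d\<in>A. \<forall>p\<in>fst c \<inter> fst d. \<forall>v w.
        metric_form (g c) (snd c p) v w =
        metric_form (g d) (snd d p)
          (frechet_derivative (transition c d) (at (snd c p)) v)
          (frechet_derivative (transition c d) (at (snd c p)) w))"

definition riemannian_manifold ::
  "'a topology \<Rightarrow> ('a, 'n::finite) chart set \<Rightarrow> ('a, 'n) metric_tensor \<Rightarrow> bool" where
  "riemannian_manifold X A g \<longleftrightarrow> smooth_manifold X A \<and> riemannian_metric A g"

definition scalar_curvature ::
  "('a, 'n::finite) chart set \<Rightarrow> ('a, 'n) metric_tensor \<Rightarrow> 'a \<Rightarrow> real" where
  "scalar_curvature A g p =
     (let c = chart_at A p in scalar_curvature_coord (g c) (snd c p))"

definition grad_norm_sq ::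
  "('a, 'n::finite) chart set \<Rightarrow> ('a, 'n) metric_tensor \<Rightarrow> ('a \<Rightarrow> real) \<Rightarrow> 'a \<Rightarrow> real" where
  "grad_norm_sq A g f p =
     (let c = chart_at A p; x = snd c p; u = gradient (g c) (coord_rep c f) x
      in metric_form (g c) x u u)"

text \<open>The equation \<open>Ric + Hess f = l g\<close> of covariant 2-tensors.\<close>

definition gradient_soliton_equation ::
  "('a, 'n::finite) chart set \<Rightarrow> ('a, 'n) metric_tensor \<Rightarrow> ('a \<Rightarrow> real) \<Rightarrow> real \<Rightarrow> bool" where
  "gradient_soliton_equation A g f l \<longleftrightarrow>
     (\<forall>c\<in>A. \<forall>x\<in>chart_image c. \<forall>v w.
        ricci (g c) x v w + hessian (g c) (coord_rep c f) x v w = l * metric_form (g c) x v w)"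


section \<open>Riemannian distance and diameter\<close>

text \<open>The derivative is required to exist and be continuous up to the endpoints of \<open>[a, b]\<close>,
  unlike in \<^const>\<open>piecewise_C1_differentiable_on\<close>, so that curves have bounded speed.\<close>

definition C1_curve :: "'a topology \<Rightarrow> ('a, 'n::finite) chart set \<Rightarrow> real \<Rightarrow> real \<Rightarrow> (real \<Rightarrow> 'a) \<Rightarrow> bool" where
  "C1_curve X A a b \<gamma> \<longleftrightarrow>
     continuous_map (top_of_set {a..b}) X \<gamma> \<and>
     (\<forall>c\<in>A. \<exists>D.
        (\<forall>t\<in>{a..b}. \<gamma> t \<in> fst c \<longrightarrow> ((snd c \<circ> \<gamma>) has_vector_derivative D t) (at t within {a..b})) \<and>
        continuous_on {t\<in>{a..b}. \<gamma> t \<in> fst c} D)"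

definition piecewise_C1_curve :: "'a topology \<Rightarrow> ('a, 'n::finite) chart set \<Rightarrow> (real \<Rightarrow> 'a) \<Rightarrow> bool" where
  "piecewise_C1_curve X A \<gamma> \<longleftrightarrow>
     (\<exists>(N::nat) s. s 0 = 0 \<and> s N = 1 \<and> (\<forall>i<N. s i < s (Suc i) \<and> C1_curve X A (s i) (s (Suc i)) \<gamma>))"

definition curve_speed ::
  "('a, 'n::finite) chart set \<Rightarrow> ('a, 'n) metric_tensor \<Rightarrow> (real \<Rightarrow> 'a) \<Rightarrow> real \<Rightarrow> real" where
  "curve_speed A g \<gamma> t =
     (let c = chart_at A (\<gamma> t); v = vector_derivative (snd c \<circ> \<gamma>) (at t within {0..1})
      in sqrt (metric_form (g c) (snd c (\<gamma> t)) v v))"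

text \<open>At the finitely many break points the speed may be arbitrary, which does not affect the
  integral.\<close>

definition curve_length ::
  "('a, 'n::finite) chart set \<Rightarrow> ('a, 'n) metric_tensor \<Rightarrow> (real \<Rightarrow> 'a) \<Rightarrow> real" where
  "curve_length A g \<gamma> = integral {0..1} (curve_speed A g \<gamma>)"

text \<open>Distance and diameter are extended real numbers, so that infima over the empty set and
  unbounded suprema get their usual meaning.\<close>

definition riemannian_dist ::
  "'a topology \<Rightarrow> ('a, 'n::finite) chart set \<Rightarrow> ('a, 'n) metric_tensor \<Rightarrow> 'a \<Rightarrow> 'a \<Rightarrow> ereal" where
  "riemannian_dist X A g p q =
     (INF \<gamma> \<in> {\<gamma>. piecewise_C1_curve X A \<gamma> \<and> \<gamma> 0 = p \<and> \<gamma> 1 = q}. ereal (curve_length A g \<gamma>))"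

definition riemannian_diameter ::
  "'a topology \<Rightarrow> ('a, 'n::finite) chart set \<Rightarrow> ('a, 'n) metric_tensor \<Rightarrow> ereal" where
  "riemannian_diameter X A g =
     (SUP (p, q) \<in> topspace X \<times> topspace X. riemannian_dist X A g p q)"

end

theory Submission
  imports Defs
begin
text \<open>
  Let \<open>d\<close> be the distance of two points \<open>p, q\<close>, and let \<open>\<gamma>\<close> be any piecewise \<open>C\<^sup>1\<close> curve from \<open>p\<close> to \<open>q\<close>,
  of length slightly larger than \<open>d\<close>, with unit tangent \<open>T\<close>.  No minimizing geodesic is needed: vary \<open>\<gamma>\<close>
  in the directions \<open>\<plusminus> \<phi> E\<^sub>a\<close> of a parallel orthonormal frame, with \<open>\<phi> (r) = sin (\<pi> r / d)\<close> and with covariant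
  acceleration \<open>- \<phi>\<^sup>2 \<nabla>f / n\<close>.  In the average over the \<open>2 n\<close> varied curves the first order terms cancel, and
  the second order term is \<open>(n - 1) \<phi>'\<^sup>2 - \<phi>\<^sup>2 (Ric + Hess f)(T, T) - (\<phi>\<^sup>2)' T f\<close>, whether or not
  \<open>\<gamma>\<close> is a geodesic.  By the soliton equation and an integration by parts it integrates to at most
  \<open>((n - 1) \<pi>\<^sup>2 - \<lambda> d\<^sup>2 + 8 \<pi> max \<bar>f\<bar>) / (2 d)\<close>.  The varied curves are not shorter than \<open>d\<close>, and the
  errors are uniform in \<open>\<gamma>\<close>; so, letting the length of \<open>\<gamma>\<close> tend to \<open>d\<close>, this number is not negative.

  Finally \<open>R \<ge> 0\<close>, by the maximum principle for \<open>R = 2 \<lambda> f - \<bar>\<nabla>f\<bar>\<^sup>2\<close>, and hence \<open>0 \<le> f\<close>; at a maximum of \<open>f\<close>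
  the gradient vanishes, and hence \<open>f \<le> R\<^sub>m\<^sub>a\<^sub>x / (2 \<lambda>)\<close>.
\<close>

section \<open>Calculus of smooth maps\<close>

text \<open>Two obstacles shape the proof. On a minimizing geodesic, Hess f(T,T) would be integrated
  by parts with the geodesic equation; an almost minimizing curve satisfies no equation, so the
  variation itself must supply this term. The covariant acceleration does so: its derivative along
  the curve contributes -\<phi>^2 Hess f(T,T) / n for each of the n fields, and the sum completes
  the Ricci tensor to l g. The constant 8 pi max |f| stems from (\<phi>^2)'' = 2 k^2 cos (2 k r), k
  = pi / d, whose absolute value has integral 4 k over [0, d]. Secondly, the varied curves are built
  from coordinate parabolas instead of an exponential map. These depend on the chart by an error
  o(s^2), while the gain of the second variation has order s^2. So the number of chart changes must
  be bounded before s is chosen: finitely many balls cover the manifold, a curve of length below d +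
  1 is cut into J short steps, with J depending only on d and the cover, and only then are the error
  \<eta>, the scale s and finally the curve selected.\<close>

abbreviation dd :: "('b::real_normed_vector \<Rightarrow> 'c::real_normed_vector) \<Rightarrow> 'b \<Rightarrow> 'b \<Rightarrow> 'c" where
  "dd F x \<equiv> frechet_derivative F (at x)"

text \<open>What is transferred is the set of possible derivatives; as
  \<open>frechet_derivative\<close> is a choice from it, the values agree even where no derivative
  exists.\<close>

lemma frechet_derivative_cong_open:
  assumes "open S" "x \<in> S" "\<And>y. y \<in> S \<Longrightarrow> F y = H y"
  shows "dd F x = dd H x"
proof -
  have "(F has_derivative F') (at x) \<longleftrightarrow> (H has_derivative F') (at x)" for F'
    using assms has_derivative_transform_within_open[of F F' x UNIV S H]
      has_derivative_transform_within_open[of H F' x UNIV S F] by auto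
  then show ?thesis by (simp add: frechet_derivative_def)
qed

lemma differentiable_cong_open:
  assumes "open S" "x \<in> S" "\<And>y. y \<in> S \<Longrightarrow> F y = H y"
  shows "F differentiable (at x) \<longleftrightarrow> H differentiable (at x)"
  using assms has_derivative_transform_within_open[of F _ x UNIV S H]
      has_derivative_transform_within_open[of H _ x UNIV S F]
  unfolding differentiable_def by metis

lemma Ck_on_cong:
  assumes "open S" "\<And>y. y \<in> S \<Longrightarrow> F y = H y"
  shows "Ck_on k S F \<longleftrightarrow> Ck_on k S H"
  using assms(2)
proof (induction k arbitrary: F H)
  case 0
  then show ?case by (simp cong: continuous_on_cong)
next
  case (Suc k)
  have 1: "F differentiable (at x) \<longleftrightarrow> H differentiable (at x)" "dd F x = dd H x" if "x \<in> S" for x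
    using differentiable_cong_open[OF assms(1) that Suc.prems]
      frechet_derivative_cong_open[OF assms(1) that Suc.prems] by auto
  have "Ck_on k S (\<lambda>x. dd F x v) \<longleftrightarrow> Ck_on k S (\<lambda>x. dd H x v)" for v
    by (rule Suc.IH) (simp add: 1)
  then show ?case using 1 by simp
qed

lemma smooth_on_cong:
  assumes "open S" "\<And>y. y \<in> S \<Longrightarrow> F y = H y" "smooth_on S F"
  shows "smooth_on S H"
  using assms Ck_on_cong[OF assms(1,2)] by (auto simp: smooth_on_def)

lemma Ck_on_SucD: "Ck_on (Suc k) S F \<Longrightarrow> Ck_on k S F"
proof (induction k arbitrary: F)
  case 0
  then show ?case
    by (auto intro!: continuous_at_imp_continuous_on differentiable_imp_continuous_within)
next
  case (Suc k)
  then show ?case by (metis Ck_on.simps(2))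
qed

lemma Ck_on_const: "Ck_on k S (\<lambda>x. c)"
  by (induction k arbitrary: c) auto

lemma has_derivative_dd: "F differentiable (at x) \<Longrightarrow> (F has_derivative dd F x) (at x)"
  by (simp add: frechet_derivative_works)

lemma dd_eq: "(F has_derivative F') (at x) \<Longrightarrow> dd F x = F'"
  by (metis frechet_derivative_at)

lemma differentiableI: "(F has_derivative F') net \<Longrightarrow> F differentiable net"
  by (auto simp: differentiable_def)

lemma Ck_on_bounded_linear:
  assumes "open S" "bounded_linear L" "Ck_on k S F"
  shows "Ck_on k S (\<lambda>x. L (F x))"
  using assms(3)
proof (induction k arbitrary: F)
  case 0
  then show ?case using bounded_linear.continuous_on[OF assms(2)] by auto
next
  case (Suc k)
  have d: "((\<lambda>x. L (F x)) has_derivative (\<lambda>v. L (dd F x v))) (at x)" if "x \<in> S" for x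
    using Suc.prems that by (intro bounded_linear.has_derivative[OF assms(2)] has_derivative_dd) auto
  have "Ck_on k S (\<lambda>x. dd (\<lambda>x. L (F x)) x v) \<longleftrightarrow> Ck_on k S (\<lambda>x. L (dd F x v))" for v
    by (rule Ck_on_cong[OF assms(1)]) (simp add: dd_eq[OF d])
  then show ?case unfolding Ck_on.simps(2) using Suc d by (auto intro: differentiableI)
qed

lemma Ck_on_add:
  assumes "open S" "Ck_on k S F" "Ck_on k S H"
  shows "Ck_on k S (\<lambda>x. F x + H x)"
  using assms(2,3)
proof (induction k arbitrary: F H)
  case 0
  then show ?case by (auto intro: continuous_intros)
next
  case (Suc k)
  have d: "((\<lambda>x. F x + H x) has_derivative (\<lambda>v. dd F x v + dd H x v)) (at x)" if "x \<in> S" for x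
    using Suc.prems that by (intro has_derivative_add has_derivative_dd) auto
  have "Ck_on k S (\<lambda>x. dd (\<lambda>x. F x + H x) x v) \<longleftrightarrow> Ck_on k S (\<lambda>x. dd F x v + dd H x v)" for v
    by (rule Ck_on_cong[OF assms(1)]) (simp add: dd_eq[OF d])
  then show ?case unfolding Ck_on.simps(2) using Suc d by (auto intro: differentiableI)
qed

text \<open>By the Leibniz rule the derivative is a sum of two products of the same kind, which
  closes the induction; the undifferentiated factor of each is lowered by one order with
  \<open>Ck_on_SucD\<close>.\<close>

lemma Ck_on_bilinear:
  assumes "open S" "bounded_bilinear p" "Ck_on k S F" "Ck_on k S H"
  shows "Ck_on k S (\<lambda>x. p (F x) (H x))"
  using assms(3,4)
proof (induction k arbitrary: F H)
  case 0
  then show ?case using bounded_bilinear.continuous_on[OF assms(2)] by auto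
next
  case (Suc k)
  have d: "((\<lambda>x. p (F x) (H x)) has_derivative (\<lambda>v. p (F x) (dd H x v) + p (dd F x v) (H x))) (at x)"
    if "x \<in> S" for x
    using Suc.prems that by (intro bounded_bilinear.FDERIV[OF assms(2)] has_derivative_dd) auto
  have "Ck_on k S (\<lambda>x. dd (\<lambda>x. p (F x) (H x)) x v) \<longleftrightarrow>
      Ck_on k S (\<lambda>x. p (F x) (dd H x v) + p (dd F x v) (H x))" for v
    by (rule Ck_on_cong[OF assms(1)]) (simp add: dd_eq[OF d])
  moreover have "Ck_on k S (\<lambda>x. p (F x) (dd H x v) + p (dd F x v) (H x))" for v
    using Suc.prems Ck_on_SucD[OF Suc.prems(1)] Ck_on_SucD[OF Suc.prems(2)] by (intro Ck_on_add assms(1) Suc.IH) auto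
  ultimately show ?case unfolding Ck_on.simps(2) using d by (blast intro: differentiableI)
qed

lemma Ck_on_sum:
  assumes "open S" "\<And>i. i \<in> I \<Longrightarrow> Ck_on k S (F i)"
  shows "Ck_on k S (\<lambda>x. \<Sum>i\<in>I. F i x)"
  using assms(2)
  by (induction I rule: infinite_finite_induct) (auto simp: Ck_on_const intro: Ck_on_add[OF assms(1)])

lemma smooth_on_bounded_linear:
  "open S \<Longrightarrow> bounded_linear L \<Longrightarrow> smooth_on S F \<Longrightarrow> smooth_on S (\<lambda>x. L (F x))"
  by (simp add: smooth_on_def Ck_on_bounded_linear)

lemma smooth_on_add:
  "open S \<Longrightarrow> smooth_on S F \<Longrightarrow> smooth_on S H \<Longrightarrow> smooth_on S (\<lambda>x. F x + H x)"
  by (simp add: smooth_on_def Ck_on_add)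

lemma smooth_on_bilinear:
  "open S \<Longrightarrow> bounded_bilinear p \<Longrightarrow> smooth_on S F \<Longrightarrow> smooth_on S H \<Longrightarrow> smooth_on S (\<lambda>x. p (F x) (H x))"
  by (simp add: smooth_on_def Ck_on_bilinear)

lemma smooth_on_sum:
  "open S \<Longrightarrow> (\<And>i. i \<in> I \<Longrightarrow> smooth_on S (F i)) \<Longrightarrow> smooth_on S (\<lambda>x. \<Sum>i\<in>I. F i x)"
  by (simp add: smooth_on_def Ck_on_sum)

lemma smooth_on_minus: "open S \<Longrightarrow> smooth_on S F \<Longrightarrow> smooth_on S (\<lambda>x. - F x)"
  using smooth_on_bounded_linear[OF _ bounded_linear_minus[OF bounded_linear_ident]] .

lemma smooth_on_diff:
  "open S \<Longrightarrow> smooth_on S F \<Longrightarrow> smooth_on S H \<Longrightarrow> smooth_on S (\<lambda>x. F x - H x)"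
  using smooth_on_add[of S F "\<lambda>x. - H x"] by (simp add: smooth_on_minus)

lemma smooth_on_has_derivative: "smooth_on S F \<Longrightarrow> x \<in> S \<Longrightarrow> (F has_derivative dd F x) (at x)"
  unfolding smooth_on_def using Ck_on.simps(2) has_derivative_dd by metis

lemma smooth_on_dd: "smooth_on S F \<Longrightarrow> smooth_on S (\<lambda>x. dd F x v)"
  unfolding smooth_on_def using Ck_on.simps(2) by metis

lemma smooth_on_continuous: "smooth_on S F \<Longrightarrow> continuous_on S F"
  unfolding smooth_on_def using Ck_on.simps(1) by metis

section \<open>Smoothness of matrix inversion\<close>

lemma bounded_bilinear_matrix_vector:
  "bounded_bilinear ((*v) :: real^'n::finite^'m::finite \<Rightarrow> real^'n \<Rightarrow> real^'m)"
proof (rule bounded_bilinear.intro)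
  show "\<exists>K. \<forall>a b. norm ((a::real^'n^'m) *v b) \<le> norm a * norm b * K"
  proof (intro exI allI)
    fix a :: "real^'n^'m" and b :: "real^'n"
    have "norm (a *v b) \<le> (\<Sum>i\<in>UNIV. \<bar>(a *v b) $ i\<bar>)" by (rule norm_le_l1_cart)
    also have "\<dots> \<le> (\<Sum>i\<in>(UNIV::'m set). norm a * norm b)"
    proof (rule sum_mono)
      fix i
      have "\<bar>(a *v b) $ i\<bar> = \<bar>(a $ i) \<bullet> b\<bar>" by (simp add: matrix_vector_mul_component)
      also have "\<dots> \<le> norm (a $ i) * norm b" by (rule Cauchy_Schwarz_ineq2)
      also have "\<dots> \<le> norm a * norm b" by (intro mult_right_mono Finite_Cartesian_Product.norm_nth_le) auto
      finally show "\<bar>(a *v b) $ i\<bar> \<le> norm a * norm b" .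
    qed
    finally show "norm (a *v b) \<le> norm a * norm b * real CARD('m)" by (simp add: mult.commute)
  qed
qed (auto simp: matrix_vector_mult_add_rdistrib matrix_vector_right_distrib scaleR_matrix_vector_assoc
      matrix_vector_mult_scaleR)

lemma bounded_bilinear_matrix_matrix:
  "bounded_bilinear ((**) :: real^'n::finite^'m::finite \<Rightarrow> real^'k::finite^'n \<Rightarrow> real^'k^'m)"
proof -
  have "bilinear ((**) :: real^'n::finite^'m::finite \<Rightarrow> real^'k::finite^'n \<Rightarrow> real^'k^'m)"
    unfolding bilinear_def linear_iff
    by (auto simp: matrix_matrix_mult_def vec_eq_iff sum.distrib distrib_left distrib_right
       sum_distrib_left mult.left_commute mult.assoc)
  then show ?thesis using bilinear_conv_bounded_bilinear by blast
qed

lemma matrix_inv_mult: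
  assumes "invertible (M :: real^'n::finite^'n)"
  shows "M ** matrix_inv M = mat 1" "matrix_inv M ** M = mat 1"
  using someI_ex[OF assms[unfolded invertible_def]] by (simp_all add: matrix_inv_def)

text \<open>Cramer's rule exhibits each entry of the inverse as a quotient of polynomials in the
  entries of the matrix. Continuity comes first because the proof of differentiability uses
  it.\<close>

lemma matrix_inv_continuous:
  assumes "open S" "continuous_on S G" "\<And>x. x \<in> S \<Longrightarrow> invertible (G x :: real^'n::finite^'n)"
  shows "continuous_on S (\<lambda>x. matrix_inv (G x))"
proof -
  have eq: "matrix_inv (G x) = (\<chi> i j. det (\<chi> a b. if b = i then (if a = j then 1 else 0) else G x $ a $ b) / det (G x))"
    if "x \<in> S" for x
  proof -
    have dz: "det (G x) \<noteq> 0" using assms(3)[OF that] invertible_det_nz by blast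
    have "G x *v (matrix_inv (G x) *v axis j 1) = axis j 1" for j
      using matrix_inv_mult[OF assms(3)[OF that]] by (simp add: matrix_vector_mul_assoc)
    then have "matrix_inv (G x) *v axis j 1 =
      (\<chi> k. det (\<chi> a b. if b = k then axis j 1 $ a else G x $ a $ b) / det (G x))" for j
      using cramer[OF dz, of "matrix_inv (G x) *v axis j 1" "axis j 1"] by simp
    then have "(matrix_inv (G x) *v axis j 1) $ i =
       det (\<chi> a b. if b = i then (if a = j then 1 else 0) else G x $ a $ b) / det (G x)" for i j
      unfolding axis_def by (simp cong: if_cong)
    then show ?thesis by (simp add: vec_eq_iff matrix_vector_mul_component inner_axis)
  qed
  have "continuous_on S (\<lambda>x. \<chi> i j. det (\<chi> a b. if b = i then (if a = j then 1 else 0) else G x $ a $ b) / det (G x))"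
    unfolding det_def
    apply (intro continuous_on_vec_lambda continuous_on_divide continuous_on_sum continuous_on_mult
        continuous_on_const continuous_on_prod)
      subgoal for i j p k by (cases "p k = i"; simp add: continuous_on_component assms)
     apply (intro continuous_on_component assms)
    using assms(3) invertible_det_nz unfolding det_def by blast
  then show ?thesis using eq by (simp cong: continuous_on_cong)
qed

text \<open>Rests on G(y)^-1 - G(x)^-1 = - G(y)^-1 (G(y) - G(x)) G(x)^-1, where continuity of the
  inverse lets the first factor tend to its value at x.\<close>

lemma matrix_inv_has_derivative:
  assumes "open S" "x \<in> S" "\<And>x. x \<in> S \<Longrightarrow> invertible (G x :: real^'n::finite^'n)"
    "continuous_on S G" "(G has_derivative G') (at x)"
  shows "((\<lambda>x. matrix_inv (G x)) has_derivative
           (\<lambda>v. - (matrix_inv (G x) ** G' v ** matrix_inv (G x)))) (at x)"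
proof -
  interpret mm: bounded_bilinear "(**) :: real^'n::finite^'n::finite \<Rightarrow> real^'n::finite^'n \<Rightarrow> real^'n^'n"
    by (rule bounded_bilinear_matrix_matrix)
  define I where "I y = matrix_inv (G y)" for y
  have I: "G y ** I y = mat 1" "I y ** G y = mat 1" if "y \<in> S" for y
    using matrix_inv_mult[OF assms(3)[OF that]] by (auto simp: I_def)
  have bl: "bounded_linear G'" using assms(5) by (rule has_derivative_bounded_linear)
  have cI: "isCont I x" using matrix_inv_continuous[OF assms(1,4,3)] assms(1,2)
    by (auto simp: I_def[abs_def] continuous_on_eq_continuous_at)
  have lim: "((\<lambda>y. ((G y - G x) - G' (y - x)) /\<^sub>R norm (y - x)) \<longlongrightarrow> 0) (at x)"
    using assms(5) by (simp add: has_derivative_at_within)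
  \<comment> \<open>Splits the remainder into the linearization error of G and a product of
    \<open>I y - I x\<close>, which tends to zero, with a term that is bounded after division by
    \<open>norm (y - x)\<close>.\<close>
  have key: "I y - I x + I x ** G' (y - x) ** I x =
      - (I y ** ((G y - G x) - G' (y - x)) ** I x) - (I y - I x) ** G' (y-x) ** I x" if "y \<in> S" for y
  proof -
    have "I y ** (G y - G x) ** I x = I x - I y"
      using I[OF that] I[OF assms(2)] by (simp add: mm.diff_right mm.diff_left matrix_mul_assoc)
         (metis matrix_mul_assoc matrix_mul_rid)
    then show ?thesis by (simp add: mm.diff_right mm.diff_left)
  qed
  obtain B where B: "norm (G' v) \<le> norm v * B" "B > 0" for v
    using bounded_linear.pos_bounded[OF bl] by auto
  define \<rho> where "\<rho> y = ((G y - G x) - G' (y - x)) /\<^sub>R norm (y - x)" for y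
  define \<tau> where "\<tau> y = G' (y - x) /\<^sub>R norm (y - x)" for y
  have I1: "(I \<longlongrightarrow> I x) (at x)" using cI by (simp add: isCont_def)
  have t1: "((\<lambda>y. I y ** \<rho> y ** I x) \<longlongrightarrow> 0) (at x)"
    using mm.tendsto[OF mm.tendsto[OF I1 lim] tendsto_const[of "I x"]]
    by (simp add: \<rho>_def[abs_def] mm.zero_left mm.zero_right)
  have t2: "((\<lambda>y. (I y - I x) ** \<tau> y ** I x) \<longlongrightarrow> 0) (at x)"
  proof -
    have "((\<lambda>y. (I y - I x)) \<longlongrightarrow> 0) (at x)" using I1 by (simp add: LIM_zero)
    moreover have "\<forall>\<^sub>F y in at x. norm (\<tau> y) \<le> B"
      unfolding eventually_at_filter
    proof (intro always_eventually allI impI)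
      fix y assume "y \<noteq> x"
      then show "norm (\<tau> y) \<le> B" using B(1)[of "y - x"] by (simp add: \<tau>_def divide_simps mult.commute)
    qed
    ultimately have "((\<lambda>y. (I y - I x) ** \<tau> y) \<longlongrightarrow> 0) (at x)"
      using mm.Zfun_prod_Bfun[of "\<lambda>y. I y - I x" "at x" \<tau>]
      by (simp add: tendsto_Zfun_iff BfunI)
    from mm.tendsto[OF this tendsto_const[of "I x"]] show ?thesis by (simp add: mm.zero_left)
  qed
  have t3: "((\<lambda>y. - (I y ** \<rho> y ** I x) - (I y - I x) ** \<tau> y ** I x) \<longlongrightarrow> 0) (at x)"
    using tendsto_diff[OF tendsto_minus[OF t1] t2] by simp
  have eq: "- (I y ** \<rho> y ** I x) - (I y - I x) ** \<tau> y ** I x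
      = (I y - I x + I x ** G' (y - x) ** I x) /\<^sub>R norm (y - x)" if "y \<in> S" for y
  proof -
    have "- (I y ** (d /\<^sub>R r) ** I x) - (I y - I x) ** (e /\<^sub>R r) ** I x
      = (- (I y ** d ** I x) - (I y - I x) ** e ** I x) /\<^sub>R r" for d e r
      by (simp add: mm.scaleR_right mm.scaleR_left scaleR_diff_right)
    then show ?thesis unfolding key[OF that] \<rho>_def \<tau>_def .
  qed
  have "((\<lambda>y. (I y - I x + I x ** G' (y - x) ** I x) /\<^sub>R norm (y - x)) \<longlongrightarrow> 0) (at x)"
    by (rule Lim_transform_within_open[OF t3 assms(1,2)]) (rule eq)
  moreover have "bounded_linear (\<lambda>v. - (I x ** G' v ** I x))"
    by (intro bounded_linear_minus bounded_linear_compose[OF mm.bounded_linear_left] bounded_linear_compose[OF mm.bounded_linear_right] bl)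
  ultimately show ?thesis unfolding has_derivative_at_within I_def by simp
qed

text \<open>Bootstrapping: the derivative is polynomial in the inverse and in the derivative of G,
  so each order of smoothness of the inverse yields the next.\<close>

lemma smooth_on_matrix_inv:
  assumes "open S" "\<And>x. x \<in> S \<Longrightarrow> invertible (G x :: real^'n::finite^'n)" "smooth_on S G"
  shows "smooth_on S (\<lambda>x. matrix_inv (G x))"
proof -
  note d = matrix_inv_has_derivative[OF assms(1) _ assms(2) smooth_on_continuous[OF assms(3)] smooth_on_has_derivative[OF assms(3)]]
  have "Ck_on k S (\<lambda>x. matrix_inv (G x))" for k
  proof (induction k)
    case 0
    then show ?case using matrix_inv_continuous[OF assms(1) smooth_on_continuous[OF assms(3)] assms(2)] by simp
  next
    case (Suc k)
    have "Ck_on k S (\<lambda>x. dd (\<lambda>x. matrix_inv (G x)) x v) \<longleftrightarrow>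
      Ck_on k S (\<lambda>x. - (matrix_inv (G x) ** dd G x v ** matrix_inv (G x)))" for v
      by (rule Ck_on_cong[OF assms(1)]) (simp add: dd_eq[OF d])
    moreover have "Ck_on k S (\<lambda>x. - (matrix_inv (G x) ** dd G x v ** matrix_inv (G x)))" for v
      using smooth_on_dd[OF assms(3), of v] Suc
      by (intro Ck_on_bounded_linear[OF assms(1) bounded_linear_minus[OF bounded_linear_ident]]
         Ck_on_bilinear[OF assms(1) bounded_bilinear_matrix_matrix]) (auto simp: smooth_on_def)
    ultimately show ?case unfolding Ck_on.simps(2) using d by (blast intro: differentiableI)
  qed
  then show ?thesis by (simp add: smooth_on_def)
qed

lemma dd_linear:
  assumes "smooth_on S F" "x \<in> S" shows "linear (dd F x)" "bounded_linear (dd F x)"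
  using smooth_on_has_derivative[OF assms] has_derivative_linear has_derivative_bounded_linear by auto

text \<open>\<open>smooth_on\<close> speaks of derivatives in fixed directions only; expansion in
  the basis reduces moving directions to these.\<close>

lemma dd_expand:
  assumes "smooth_on S F" "x \<in> S"
  shows "dd F x v = (\<Sum>b\<in>Basis. (v \<bullet> b) *\<^sub>R dd F x b)"
proof -
  have "dd F x v = dd F x (\<Sum>b\<in>Basis. (v \<bullet> b) *\<^sub>R b)" by (simp add: euclidean_representation)
  also have "\<dots> = (\<Sum>b\<in>Basis. (v \<bullet> b) *\<^sub>R dd F x b)"
    using dd_linear(1)[OF assms] by (simp add: linear_sum linear_scale)
  finally show ?thesis .
qed

lemma dd_dd_expand:
  assumes "open S" "smooth_on S F" "x \<in> S"
  shows "dd (\<lambda>y. dd F y v) x w = (\<Sum>b\<in>Basis. (v \<bullet> b) *\<^sub>R dd (\<lambda>y. dd F y b) x w)"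
proof -
  have "dd (\<lambda>y. dd F y v) x = dd (\<lambda>y. \<Sum>b\<in>Basis. (v \<bullet> b) *\<^sub>R dd F y b) x"
    by (rule frechet_derivative_cong_open[OF assms(1,3)]) (rule dd_expand[OF assms(2)])
  also have "\<dots> = (\<lambda>w. \<Sum>b\<in>Basis. (v \<bullet> b) *\<^sub>R dd (\<lambda>y. dd F y b) x w)"
    by (intro dd_eq has_derivative_sum has_derivative_scaleR_right smooth_on_has_derivative[OF smooth_on_dd[OF assms(2)]] assms)
  finally show ?thesis by simp
qed

lemma continuous_on_dd [continuous_intros]:
  assumes "smooth_on S F" "continuous_on T a" "continuous_on T v" "\<And>t. t \<in> T \<Longrightarrow> a t \<in> S"
  shows "continuous_on T (\<lambda>t. dd F (a t) (v t))"
proof -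
  have "continuous_on T (\<lambda>t. \<Sum>b\<in>Basis. (v t \<bullet> b) *\<^sub>R dd F (a t) b)"
    using assms by (intro continuous_intros continuous_on_compose2[OF smooth_on_continuous[OF smooth_on_dd[OF assms(1)]] assms(2)]) auto
  then show ?thesis using dd_expand[OF assms(1)] assms(4) by (simp cong: continuous_on_cong)
qed

lemma continuous_on_dd_dd [continuous_intros]:
  assumes "open S" "smooth_on S F" "continuous_on T a" "continuous_on T v" "continuous_on T w" "\<And>t. t \<in> T \<Longrightarrow> a t \<in> S"
  shows "continuous_on T (\<lambda>t. dd (\<lambda>y. dd F y (v t)) (a t) (w t))"
proof -
  have "continuous_on T (\<lambda>t. \<Sum>b\<in>Basis. (v t \<bullet> b) *\<^sub>R dd (\<lambda>y. dd F y b) (a t) (w t))"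
    using assms by (intro continuous_intros smooth_on_dd) auto
  then show ?thesis using dd_dd_expand[OF assms(1,2)] assms(6) by (simp cong: continuous_on_cong)
qed

text \<open>The numerator is symmetric in v and w, so the limit yields the symmetry of second
  derivatives; with w = -v it yields the second order condition at a minimum.\<close>

lemma second_difference_tendsto:
  fixes F :: "'b::euclidean_space \<Rightarrow> real"
  assumes "open S" "smooth_on S F" "x \<in> S"
  shows "((\<lambda>t::real. (F (x + t *\<^sub>R v + t *\<^sub>R w) - F (x + t *\<^sub>R v) - F (x + t *\<^sub>R w) + F x) / t\<^sup>2)
     \<longlongrightarrow> dd (\<lambda>y. dd F y v) x w) (at_right 0)"
proof (rule tendstoI)
  fix e :: real assume "e > 0"
  have "isCont (\<lambda>y. dd (\<lambda>y. dd F y v) y w) x"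
    using smooth_on_continuous[OF smooth_on_dd[OF smooth_on_dd[OF assms(2)]]] assms(1,3)
    by (auto simp: continuous_on_eq_continuous_at)
  then obtain d1 where d1: "d1 > 0" "\<And>y. dist y x < d1 \<Longrightarrow> dist (dd (\<lambda>y. dd F y v) y w) (dd (\<lambda>y. dd F y v) x w) < e"
    using \<open>e>0\<close> unfolding continuous_at_eps_delta by metis
  obtain d2 where d2: "d2 > 0" "ball x d2 \<subseteq> S" using assms(1,3) open_contains_ball by blast
  \<comment> \<open>So small that for t < d the parallelogram spanned by t v and t w at x stays in S
    and where the second derivative is e-close to its value at x.\<close>
  define d where "d = min d1 d2 / (norm v + norm w + 1)"
  have "d > 0" using d1 d2 by (simp add: d_def divide_pos_pos add_nonneg_pos)
  have near: "dist (x + r *\<^sub>R v + q *\<^sub>R w) x < min d1 d2" if "0 \<le> r" "0 \<le> q" "r < d" "q < d" for r q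
  proof -
    have "dist (x + r *\<^sub>R v + q *\<^sub>R w) x \<le> r * norm v + q * norm w"
      using norm_triangle_ineq[of "r *\<^sub>R v" "q *\<^sub>R w"] that by (simp add: dist_norm)
    also have "\<dots> \<le> d * norm v + d * norm w" using that by (intro add_mono mult_right_mono) auto
    also have "\<dots> < d * (norm v + norm w + 1)" using \<open>d>0\<close> by (simp add: algebra_simps)
    also have "\<dots> = min d1 d2" unfolding d_def using norm_ge_zero[of v] norm_ge_zero[of w] by (simp add: add_nonneg_eq_0_iff)
    finally show ?thesis .
  qed
  have nS: "x + r *\<^sub>R v + q *\<^sub>R w \<in> S" if "0 \<le> r" "0 \<le> q" "r < d" "q < d" for r q
    using near[OF that] d2 by (auto simp: dist_commute)
  have main: "dist ((F (x + t *\<^sub>R v + t *\<^sub>R w) - F (x + t *\<^sub>R v) - F (x + t *\<^sub>R w) + F x) / t\<^sup>2) (dd (\<lambda>y. dd F y v) x w) < e"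
    if t: "0 < t" "t < d" for t
  proof -
    define g where "g r = F (x + r *\<^sub>R v + t *\<^sub>R w) - F (x + r *\<^sub>R v)" for r
    define g' where "g' r = dd F (x + r *\<^sub>R v + t *\<^sub>R w) v - dd F (x + r *\<^sub>R v) v" for r
    have dg: "(g has_real_derivative g' r) (at r)" if "0 \<le> r" "r \<le> t" for r
    proof -
      have "((\<lambda>r. F (x + r *\<^sub>R v + q *\<^sub>R w)) has_derivative (\<lambda>h. dd F (x + r *\<^sub>R v + q *\<^sub>R w) (h *\<^sub>R v))) (at r)"
        if "0 \<le> q" "q \<le> t" for q
        using nS[of r q] that \<open>0\<le>r\<close> \<open>r\<le>t\<close> t
        by (intro has_derivative_compose[OF _ smooth_on_has_derivative[OF assms(2)]]) (auto intro!: derivative_eq_intros)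
      from this[of t] this[of 0] have "(g has_derivative (\<lambda>h. dd F (x + r *\<^sub>R v + t *\<^sub>R w) (h *\<^sub>R v) - dd F (x + r *\<^sub>R v) (h *\<^sub>R v))) (at r)"
        unfolding g_def using t by (intro has_derivative_diff) auto
      moreover have "linear (dd F (x + r *\<^sub>R v + t *\<^sub>R w))" "linear (dd F (x + r *\<^sub>R v))"
        using nS[of r t] nS[of r 0] that t by (auto intro!: dd_linear[OF assms(2)])
      ultimately show ?thesis unfolding has_field_derivative_def g'_def
        by (auto simp: linear_scale algebra_simps elim!: has_derivative_eq_rhs)
    qed
    \<comment> \<open>The mean value theorem in the direction v, and below once more in the
      direction w, turns the quotient into a second derivative at a nearby point.\<close>
    obtain r where r: "0 < r" "r < t" "g t - g 0 = t * g' r"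
      using MVT2[of 0 t g g'] dg t by auto
    define h where "h q = dd F (x + r *\<^sub>R v + q *\<^sub>R w) v" for q
    define h' where "h' q = dd (\<lambda>y. dd F y v) (x + r *\<^sub>R v + q *\<^sub>R w) w" for q
    have dh: "(h has_real_derivative h' q) (at q)" if "0 \<le> q" "q \<le> t" for q
    proof -
      have "(h has_derivative (\<lambda>k. dd (\<lambda>y. dd F y v) (x + r *\<^sub>R v + q *\<^sub>R w) (k *\<^sub>R w))) (at q)"
        unfolding h_def using nS[of r q] that r t
        by (intro has_derivative_compose[OF _ smooth_on_has_derivative[OF smooth_on_dd[OF assms(2)]]]) (auto intro!: derivative_eq_intros)
      moreover have "linear (dd (\<lambda>y. dd F y v) (x + r *\<^sub>R v + q *\<^sub>R w))"
        using nS[of r q] that r t by (auto intro!: dd_linear[OF smooth_on_dd[OF assms(2)]])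
      ultimately show ?thesis unfolding has_field_derivative_def h'_def
        by (auto simp: linear_scale mult.commute elim!: has_derivative_eq_rhs)
    qed
    obtain q where q: "0 < q" "q < t" "h t - h 0 = t * h' q"
      using MVT2[of 0 t h h'] dh t by auto
    have "F (x + t *\<^sub>R v + t *\<^sub>R w) - F (x + t *\<^sub>R v) - F (x + t *\<^sub>R w) + F x = g t - g 0" by (simp add: g_def)
    also have "\<dots> = t * (t * h' q)" using r q by (simp add: g'_def h_def)
    finally have "(F (x + t *\<^sub>R v + t *\<^sub>R w) - F (x + t *\<^sub>R v) - F (x + t *\<^sub>R w) + F x) / t\<^sup>2 = h' q"
      using t by (simp add: power2_eq_square)
    moreover have "dist (h' q) (dd (\<lambda>y. dd F y v) x w) < e"
      unfolding h'_def using near[of r q] q r t by (intro d1) auto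
    ultimately show ?thesis by simp
  qed
  show "\<forall>\<^sub>F t in at_right 0. dist ((F (x + t *\<^sub>R v + t *\<^sub>R w) - F (x + t *\<^sub>R v) - F (x + t *\<^sub>R w) + F x) / t\<^sup>2) (dd (\<lambda>y. dd F y v) x w) < e"
    using \<open>d > 0\<close> main by (auto simp: eventually_at_right_field intro!: exI[of _ d])
qed

lemma dd_dd_sym_real:
  fixes F :: "'b::euclidean_space \<Rightarrow> real"
  assumes "open S" "smooth_on S F" "x \<in> S"
  shows "dd (\<lambda>y. dd F y v) x w = dd (\<lambda>y. dd F y w) x v"
  using tendsto_unique[OF _ second_difference_tendsto[OF assms, of v w]]
    second_difference_tendsto[OF assms, of w v] by (simp add: algebra_simps)

lemma dd_dd_sym:
  fixes F :: "'b::euclidean_space \<Rightarrow> 'c::euclidean_space"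
  assumes "open S" "smooth_on S F" "x \<in> S"
  shows "dd (\<lambda>y. dd F y v) x w = dd (\<lambda>y. dd F y w) x v"
proof (rule euclidean_eqI)
  fix b :: 'c assume "b \<in> Basis"
  have 1: "dd (\<lambda>y. F y \<bullet> b) y v = dd F y v \<bullet> b" if "y \<in> S" for y v
    by (rule fun_cong[OF dd_eq]) (intro has_derivative_inner_left smooth_on_has_derivative[OF assms(2) that])
  have 2: "dd (\<lambda>y. dd (\<lambda>y. F y \<bullet> b) y v) x w = dd (\<lambda>y. dd F y v) x w \<bullet> b" for v w
  proof -
    have "dd (\<lambda>y. dd (\<lambda>y. F y \<bullet> b) y v) x = dd (\<lambda>y. dd F y v \<bullet> b) x"
      by (rule frechet_derivative_cong_open[OF assms(1,3)]) (rule 1)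
    also have "\<dots> = (\<lambda>w. dd (\<lambda>y. dd F y v) x w \<bullet> b)"
      by (rule dd_eq) (intro has_derivative_inner_left smooth_on_has_derivative[OF smooth_on_dd[OF assms(2)] assms(3)])
    finally show ?thesis by simp
  qed
  have "smooth_on S (\<lambda>y. F y \<bullet> b)"
    by (rule smooth_on_bounded_linear[OF assms(1) bounded_linear_inner_left assms(2)])
  from dd_dd_sym_real[OF assms(1) this assms(3), of v w]
  show "dd (\<lambda>y. dd F y v) x w \<bullet> b = dd (\<lambda>y. dd F y w) x v \<bullet> b" by (simp add: 2)
qed

section \<open>Riemannian calculus in a coordinate domain\<close>

lemma has_derivative_dd_compose:
  assumes "open S" "smooth_on S F" "(x has_derivative x') (at t within T)" "(V has_derivative V') (at t within T)" "x t \<in> S" "t \<in> T"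
  shows "((\<lambda>t. dd F (x t) (V t)) has_derivative
     (\<lambda>h. dd (\<lambda>y. dd F y (V t)) (x t) (x' h) + dd F (x t) (V' h))) (at t within T)"
proof -
  have "((\<lambda>t. \<Sum>b\<in>Basis. (V t \<bullet> b) *\<^sub>R dd F (x t) b) has_derivative
     (\<lambda>h. \<Sum>b\<in>Basis. (V t \<bullet> b) *\<^sub>R dd (\<lambda>y. dd F y b) (x t) (x' h) + (V' h \<bullet> b) *\<^sub>R dd F (x t) b)) (at t within T)"
    by (intro has_derivative_sum has_derivative_scaleR has_derivative_inner_left assms
       has_derivative_compose[OF assms(3) smooth_on_has_derivative[OF smooth_on_dd[OF assms(2)] assms(5)]])
  then have d: "((\<lambda>t. \<Sum>b\<in>Basis. (V t \<bullet> b) *\<^sub>R dd F (x t) b) has_derivative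
     (\<lambda>h. dd (\<lambda>y. dd F y (V t)) (x t) (x' h) + dd F (x t) (V' h))) (at t within T)"
    unfolding dd_dd_expand[OF assms(1,2,5), of "V t"] dd_expand[OF assms(2,5), of "V' _"] by (simp add: sum.distrib)
  have "(x \<longlongrightarrow> x t) (at t within T)"
    using assms(3) has_derivative_continuous continuous_within by blast
  from topological_tendstoD[OF this assms(1,5)]
  have "eventually (\<lambda>s. (\<Sum>b\<in>Basis. (V s \<bullet> b) *\<^sub>R dd F (x s) b) = dd F (x s) (V s)) (at t within T)"
    by (rule eventually_mono) (simp add: dd_expand[OF assms(2), symmetric])
  moreover have "(\<Sum>b\<in>Basis. (V t \<bullet> b) *\<^sub>R dd F (x t) b) = dd F (x t) (V t)"
    by (rule dd_expand[OF assms(2,5), symmetric])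
  ultimately show ?thesis using assms(6) by (intro has_derivative_transform_eventually[OF d])
qed

definition Gam :: "(real^'n \<Rightarrow> real^'n^'n) \<Rightarrow> real^'n \<Rightarrow> real^'n \<Rightarrow> real^'n \<Rightarrow> real^'n" where
  "Gam G x u v = (\<chi> k. \<Sum>i\<in>UNIV. \<Sum>j\<in>UNIV. christoffel G x k i j * u $ i * v $ j)"

lemma bounded_bilinear_Gam: "bounded_bilinear (Gam G x)"
proof -
  have "bilinear (Gam G x)"
    unfolding bilinear_def linear_iff
    by (auto simp: Gam_def vec_eq_iff sum.distrib distrib_left distrib_right sum_distrib_left mult.left_commute mult.assoc)
  then show ?thesis using bilinear_conv_bounded_bilinear by blast
qed

lemmas Gam_simps =
  bounded_bilinear.add_left[OF bounded_bilinear_Gam] bounded_bilinear.add_right[OF bounded_bilinear_Gam]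
  bounded_bilinear.diff_left[OF bounded_bilinear_Gam] bounded_bilinear.diff_right[OF bounded_bilinear_Gam]
  bounded_bilinear.minus_left[OF bounded_bilinear_Gam] bounded_bilinear.minus_right[OF bounded_bilinear_Gam]
  bounded_bilinear.scaleR_left[OF bounded_bilinear_Gam] bounded_bilinear.scaleR_right[OF bounded_bilinear_Gam]
  bounded_bilinear.zero_left[OF bounded_bilinear_Gam] bounded_bilinear.zero_right[OF bounded_bilinear_Gam]

definition DGam :: "(real^'n \<Rightarrow> real^'n^'n) \<Rightarrow> real^'n \<Rightarrow> real^'n \<Rightarrow> real^'n \<Rightarrow> real^'n \<Rightarrow> real^'n" where
  "DGam G x a u v = dd (\<lambda>y. Gam G y u v) x a"

text \<open>\<open>riemann_curvature\<close> evaluated on fields with constant coordinates, whose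
  Lie brackets vanish.\<close>

definition Rm :: "(real^'n \<Rightarrow> real^'n^'n) \<Rightarrow> real^'n \<Rightarrow> real^'n \<Rightarrow> real^'n \<Rightarrow> real^'n \<Rightarrow> real^'n" where
  "Rm G x u v w = DGam G x u v w - DGam G x v u w + Gam G x u (Gam G x v w) - Gam G x v (Gam G x u w)"

definition nabla :: "(real^'n \<Rightarrow> real^'n^'n) \<Rightarrow> (real^'n \<Rightarrow> real^'n) \<Rightarrow> real^'n \<Rightarrow> real^'n \<Rightarrow> real^'n" where
  "nabla G X x v = dd X x v + Gam G x v (X x)"

definition orthonormal_frame :: "(real^'n \<Rightarrow> real^'n^'n) \<Rightarrow> real^'n \<Rightarrow> ('n \<Rightarrow> real^'n) \<Rightarrow> bool" where
  "orthonormal_frame G x E \<longleftrightarrow> (\<forall>a b. metric_form G x (E a) (E b) = (if a = b then 1 else 0))"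

lemma bounded_bilinear_metric_form: "bounded_bilinear (metric_form G x)"
proof -
  have "bilinear (metric_form G x)"
    unfolding bilinear_def linear_iff
    by (auto simp: metric_form_def matrix_vector_right_distrib inner_add_left inner_add_right matrix_vector_mult_scaleR)
  then show ?thesis using bilinear_conv_bounded_bilinear by blast
qed

lemmas metric_form_simps =
  bounded_bilinear.add_left[OF bounded_bilinear_metric_form] bounded_bilinear.add_right[OF bounded_bilinear_metric_form]
  bounded_bilinear.diff_left[OF bounded_bilinear_metric_form] bounded_bilinear.diff_right[OF bounded_bilinear_metric_form]
  bounded_bilinear.minus_left[OF bounded_bilinear_metric_form] bounded_bilinear.minus_right[OF bounded_bilinear_metric_form]
  bounded_bilinear.scaleR_left[OF bounded_bilinear_metric_form] bounded_bilinear.scaleR_right[OF bounded_bilinear_metric_form]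
  bounded_bilinear.zero_left[OF bounded_bilinear_metric_form] bounded_bilinear.zero_right[OF bounded_bilinear_metric_form]
lemmas metric_form_sum =
  bounded_bilinear.sum_left[OF bounded_bilinear_metric_form] bounded_bilinear.sum_right[OF bounded_bilinear_metric_form]

locale riem_chart =
  fixes U :: "(real^'n::finite) set" and G :: "real^'n \<Rightarrow> real^'n^'n"
  assumes open_U: "open U" and smooth_G: "smooth_on U G"
    and metric_sym: "x \<in> U \<Longrightarrow> metric_form G x v w = metric_form G x w v"
    and metric_pos: "x \<in> U \<Longrightarrow> v \<noteq> 0 \<Longrightarrow> metric_form G x v v > 0"
begin

abbreviation m where "m \<equiv> metric_form G"

lemma invertible_G: "x \<in> U \<Longrightarrow> invertible (G x)"
  using metric_pos[of x] unfolding invertible_left_inverse matrix_left_invertible_ker metric_form_def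
  by (metis inner_zero_left less_irrefl)

lemma G_inv: "x \<in> U \<Longrightarrow> G x *v (matrix_inv (G x) *v v) = v"
  using matrix_inv_mult[OF invertible_G] by (simp add: matrix_vector_mul_assoc)

lemma smooth_inv: "smooth_on U (\<lambda>x. matrix_inv (G x))"
  using smooth_on_matrix_inv[OF open_U invertible_G smooth_G] .

lemma metric_nondeg: assumes "x \<in> U" "\<And>w. m x u w = m x v w" shows "u = v"
  using metric_pos[OF assms(1), of "u - v"] assms(2)[of "u - v"]
  by (auto simp: metric_form_simps)

lemma der_form: "x \<in> U \<Longrightarrow> ((\<lambda>y. (G y *v u) \<bullet> v) has_derivative (\<lambda>w. (dd G x w *v u) \<bullet> v)) (at x)"
  by (intro has_derivative_inner_left bounded_linear.has_derivative[OF bounded_bilinear.bounded_linear_left[OF bounded_bilinear_matrix_vector]]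
     smooth_on_has_derivative[OF smooth_G])

lemma DG_sym: assumes "x \<in> U" shows "(dd G x w *v u) \<bullet> v = (dd G x w *v v) \<bullet> u"
proof -
  have "(\<lambda>w. (dd G x w *v u) \<bullet> v) = dd (\<lambda>y. (G y *v u) \<bullet> v) x" using der_form[OF assms] dd_eq by metis
  also have "\<dots> = dd (\<lambda>y. (G y *v v) \<bullet> u) x"
    by (rule frechet_derivative_cong_open[OF open_U assms]) (use metric_sym in \<open>simp add: metric_form_def\<close>)
  also have "\<dots> = (\<lambda>w. (dd G x w *v v) \<bullet> u)" using der_form[OF assms] dd_eq by metis
  finally show ?thesis by meson
qed

text \<open>The Christoffel symbols with lowered index, that is, the covector of Koszul's
  formula.\<close>

definition kos where
  "kos x u v = (1/2) *\<^sub>R (dd G x u *v v + dd G x v *v u - (\<chi> l. (dd G x (axis l 1) *v u) \<bullet> v))"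

lemma partial_G: assumes "x \<in> U" shows "partial i (\<lambda>y. G y $ j $ l) x = dd G x (axis i 1) $ j $ l"
proof -
  have "((\<lambda>y. G y $ j $ l) has_derivative (\<lambda>v. dd G x v $ j $ l)) (at x)"
    by (intro bounded_linear.has_derivative[OF bounded_linear_vec_nth] smooth_on_has_derivative[OF smooth_G assms])
  then show ?thesis unfolding partial_def using dd_eq by metis
qed

lemma dd_axis_expand:
  assumes "x \<in> U" shows "dd G x w = (\<Sum>i\<in>UNIV. w $ i *\<^sub>R dd G x (axis i 1))"
proof -
  have "w = (\<Sum>i\<in>UNIV. w $ i *\<^sub>R axis i 1)" by (simp add: vec_eq_iff axis_def if_distrib cong: if_cong)
  then have "dd G x w = dd G x (\<Sum>i\<in>UNIV. w $ i *\<^sub>R axis i 1)" by simp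
  also have "\<dots> = (\<Sum>i\<in>UNIV. w $ i *\<^sub>R dd G x (axis i 1))"
    using dd_linear(1)[OF smooth_G assms] by (simp add: linear_sum linear_scale)
  finally show ?thesis .
qed

lemma DG_entry_sym: assumes "x \<in> U" shows "dd G x w $ i $ j = dd G x w $ j $ i"
  using DG_sym[OF assms, of w "axis j 1" "axis i 1"]
  by (simp add: inner_axis matrix_vector_mul_component)

text \<open>Leaves the indices behind: smoothness of the connection and Koszul's formula are read
  off from this form.\<close>

lemma Gam_kos: assumes "x \<in> U" shows "Gam G x u v = matrix_inv (G x) *v kos x u v"
proof -
  define A where "A = (\<lambda>i. dd G x (axis i 1))"
  have As: "A i $ j $ k = A i $ k $ j" for i j k using DG_entry_sym[OF assms] by (simp add: A_def)
  have 1: "(dd G x a *v b) $ l = (\<Sum>i\<in>UNIV. \<Sum>j\<in>UNIV. A i $ j $ l * a $ i * b $ j)" for a b l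
  proof -
    have "(dd G x a *v b) $ l = (\<Sum>j\<in>UNIV. (\<Sum>i\<in>UNIV. a $ i * A i $ l $ j) * b $ j)"
      by (subst dd_axis_expand[OF assms]) (simp add: matrix_vector_mult_def A_def)
    also have "\<dots> = (\<Sum>j\<in>UNIV. \<Sum>i\<in>UNIV. A i $ j $ l * a $ i * b $ j)"
      by (simp add: sum_distrib_right sum_distrib_left As[of _ l] ac_simps)
    finally show ?thesis by (subst sum.swap) simp
  qed
  have 3: "(dd G x (axis l 1) *v u) \<bullet> v = (\<Sum>i\<in>UNIV. \<Sum>j\<in>UNIV. A l $ i $ j * u $ i * v $ j)" for l
  proof -
    have "(dd G x (axis l 1) *v u) \<bullet> v = (\<Sum>j\<in>UNIV. \<Sum>i\<in>UNIV. A l $ j $ i * u $ i * v $ j)"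
      by (simp add: matrix_vector_mult_def inner_vec_def A_def sum_distrib_right sum_distrib_left ac_simps)
    then show ?thesis by (subst sum.swap) (simp add: As[of l])
  qed
  have k: "kos x u v $ l = (1/2) * (\<Sum>i\<in>UNIV. \<Sum>j\<in>UNIV. (A i $ j $ l + A j $ i $ l - A l $ i $ j) * u $ i * v $ j)" for l
  proof -
    have "(\<Sum>i\<in>UNIV. \<Sum>j\<in>UNIV. A i $ j $ l * v $ i * u $ j) = (\<Sum>i\<in>UNIV. \<Sum>j\<in>UNIV. A j $ i $ l * u $ i * v $ j)"
      by (subst sum.swap) (simp add: ac_simps)
    then show ?thesis by (simp add: kos_def 1 3 algebra_simps sum.distrib sum_subtractf sum_distrib_left)
  qed
  have "Gam G x u v $ k = (matrix_inv (G x) *v kos x u v) $ k" for k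
  proof -
    have "(matrix_inv (G x) *v kos x u v) $ k =
      (\<Sum>l\<in>UNIV. \<Sum>i\<in>UNIV. \<Sum>j\<in>UNIV. (1/2) * (matrix_inv (G x) $ k $ l * (A i $ j $ l + A j $ i $ l - A l $ i $ j)) * u $ i * v $ j)"
      by (simp add: matrix_vector_mult_def k sum_distrib_left ac_simps)
    also have "\<dots> = (\<Sum>i\<in>UNIV. \<Sum>l\<in>UNIV. \<Sum>j\<in>UNIV. (1/2) * (matrix_inv (G x) $ k $ l * (A i $ j $ l + A j $ i $ l - A l $ i $ j)) * u $ i * v $ j)"
      by (rule sum.swap)
    also have "\<dots> = (\<Sum>i\<in>UNIV. \<Sum>j\<in>UNIV. \<Sum>l\<in>UNIV. (1/2) * (matrix_inv (G x) $ k $ l * (A i $ j $ l + A j $ i $ l - A l $ i $ j)) * u $ i * v $ j)"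
      by (intro sum.cong refl sum.swap)
    finally show ?thesis by (simp add: Gam_def christoffel_def partial_G[OF assms] A_def sum_distrib_left sum_distrib_right)
  qed
  then show ?thesis by (simp add: vec_eq_iff)
qed

lemma smooth_Gam: "smooth_on U (\<lambda>x. Gam G x u v)"
proof -
  note bl = bounded_bilinear.bounded_linear_left[OF bounded_bilinear_matrix_vector]
  have eq: "kos x u v = (1/2) *\<^sub>R (dd G x u *v v + dd G x v *v u - (\<Sum>l\<in>UNIV. ((dd G x (axis l 1) *v u) \<bullet> v) *\<^sub>R axis l 1))" for x
    by (simp add: kos_def vec_eq_iff axis_def if_distrib cong: if_cong)
  have s1: "smooth_on U (\<lambda>x. dd G x a *v b)" for a b
    using smooth_on_bounded_linear[OF open_U bl smooth_on_dd[OF smooth_G]] .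
  have s2: "smooth_on U (\<lambda>x. (((dd G x (axis l 1) *v u) \<bullet> v) *\<^sub>R axis l 1) :: real^'n)" for l
    using smooth_on_bounded_linear[OF open_U bounded_linear_scaleR_left smooth_on_bounded_linear[OF open_U bounded_linear_inner_left s1]] .
  have "smooth_on U (\<lambda>x. kos x u v)"
    unfolding eq
    by (intro smooth_on_bounded_linear[OF open_U bounded_linear_scaleR_right] smooth_on_diff[OF open_U]
       smooth_on_add[OF open_U] smooth_on_sum[OF open_U] s1 s2)
  from smooth_on_bilinear[OF open_U bounded_bilinear_matrix_vector smooth_inv this]
  show ?thesis by (rule smooth_on_cong[OF open_U, rotated]) (simp add: Gam_kos)
qed

lemma koszul: assumes "x \<in> U"
  shows "m x (Gam G x u v) w = (1/2) * ((dd G x u *v v) \<bullet> w + (dd G x v *v u) \<bullet> w - (dd G x w *v u) \<bullet> v)"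
proof -
  have "(\<chi> l. (dd G x (axis l 1) *v u) \<bullet> v) \<bullet> w = (dd G x w *v u) \<bullet> v"
  proof -
    have "(dd G x w *v u) \<bullet> v = ((\<Sum>i\<in>UNIV. w $ i *\<^sub>R dd G x (axis i 1)) *v u) \<bullet> v"
      by (subst dd_axis_expand[OF assms]) simp
    also have "\<dots> = (\<Sum>i\<in>UNIV. w $ i * ((dd G x (axis i 1) *v u) \<bullet> v))"
      by (simp add: bounded_bilinear.sum_left[OF bounded_bilinear_matrix_vector] inner_sum_left
          bounded_bilinear.scaleR_left[OF bounded_bilinear_matrix_vector])
    finally show ?thesis by (simp add: inner_vec_def mult.commute)
  qed
  then show ?thesis
    by (simp add: Gam_kos[OF assms] metric_form_def G_inv[OF assms] kos_def inner_diff_left inner_add_left)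
qed

lemma Gam_sym: assumes "x \<in> U" shows "Gam G x u v = Gam G x v u"
  by (rule metric_nondeg[OF assms]) (simp add: koszul[OF assms] DG_sym[OF assms, of _ u v])

text \<open>Koszul's formula is used twice; the terms that are antisymmetric in u and v cancel in
  the sum.\<close>

lemma compat: assumes "x \<in> U"
  shows "(dd G x w *v u) \<bullet> v = m x (Gam G x w u) v + m x u (Gam G x w v)"
  using DG_sym[OF assms] unfolding metric_sym[OF assms, of u] koszul[OF assms] by (simp add: field_simps)

lemma metric_eval: "m x u v = (G x *v u) \<bullet> v" by (simp add: metric_form_def)

text \<open>Metric compatibility along an arbitrary map x: the identity as x differentiates products
  of vector fields, and a real parameter gives the rule along curves.\<close>

lemma has_derivative_metric:
  assumes "(x has_derivative x') (at t within T)" "(V has_derivative V') (at t within T)"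
    "(W has_derivative W') (at t within T)" "x t \<in> U"
  shows "((\<lambda>t. m (x t) (V t) (W t)) has_derivative
     (\<lambda>h. m (x t) (V' h + Gam G (x t) (x' h) (V t)) (W t) + m (x t) (V t) (W' h + Gam G (x t) (x' h) (W t)))) (at t within T)"
proof -
  have "((\<lambda>t. (G (x t) *v V t) \<bullet> W t) has_derivative
     (\<lambda>h. (G (x t) *v V t) \<bullet> W' h + (G (x t) *v V' h + dd G (x t) (x' h) *v V t) \<bullet> W t)) (at t within T)"
    by (intro has_derivative_inner bounded_bilinear.FDERIV[OF bounded_bilinear_matrix_vector]
      has_derivative_compose[OF assms(1) smooth_on_has_derivative[OF smooth_G assms(4)]] assms)
  then show ?thesis
    unfolding metric_eval by (rule has_derivative_eq_rhs)
     (auto simp: inner_add_left inner_add_right matrix_vector_right_distrib compat[OF assms(4)] metric_eval)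
qed

lemma Gam_expand: "Gam G x u v = (\<Sum>i\<in>UNIV. \<Sum>j\<in>UNIV. (u $ i * v $ j) *\<^sub>R Gam G x (axis i 1) (axis j 1))"
proof -
  have e: "w = (\<Sum>i\<in>UNIV. w $ i *\<^sub>R axis i 1)" for w :: "real^'n" by (simp add: vec_eq_iff axis_def if_distrib cong: if_cong)
  show ?thesis by (subst e[of u], subst e[of v])
     (simp add: bounded_bilinear.sum_left[OF bounded_bilinear_Gam] bounded_bilinear.sum_right[OF bounded_bilinear_Gam]
        Gam_simps scaleR_sum_right, subst sum.swap, simp add: mult.commute)
qed

lemma Gam_has_derivative:
  "x \<in> U \<Longrightarrow> ((\<lambda>y. Gam G y u v) has_derivative (\<lambda>a. DGam G x a u v)) (at x)"
  unfolding DGam_def by (rule smooth_on_has_derivative[OF smooth_Gam])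

lemma DGam_expand: assumes "x \<in> U"
  shows "DGam G x a u v = (\<Sum>i\<in>UNIV. \<Sum>j\<in>UNIV. (u $ i * v $ j) *\<^sub>R DGam G x a (axis i 1) (axis j 1))"
proof -
  have "((\<lambda>x. \<Sum>i\<in>UNIV. \<Sum>j\<in>UNIV. (u $ i * v $ j) *\<^sub>R Gam G x (axis i 1) (axis j 1)) has_derivative
     (\<lambda>a. \<Sum>i\<in>UNIV. \<Sum>j\<in>UNIV. (u $ i * v $ j) *\<^sub>R DGam G x a (axis i 1) (axis j 1))) (at x)"
    by (intro has_derivative_sum has_derivative_scaleR_right Gam_has_derivative assms)
  then have "((\<lambda>x. Gam G x u v) has_derivative
     (\<lambda>a. \<Sum>i\<in>UNIV. \<Sum>j\<in>UNIV. (u $ i * v $ j) *\<^sub>R DGam G x a (axis i 1) (axis j 1))) (at x)"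
    by (subst Gam_expand)
  then show ?thesis unfolding DGam_def by (simp add: dd_eq)
qed

lemma bounded_bilinear_DGam: assumes "x \<in> U" shows "bounded_bilinear (DGam G x a)"
proof -
  have "bilinear (DGam G x a)"
    unfolding bilinear_def linear_iff
    by (subst (1 2 3 4 5 6 7 8 9 10) DGam_expand[OF assms])
       (auto simp: sum.distrib distrib_left distrib_right scaleR_add_left scaleR_sum_right mult.left_commute mult.assoc)
  then show ?thesis using bilinear_conv_bounded_bilinear by blast
qed

lemma has_derivative_Gam:
  assumes "(x has_derivative x') (at t within T)" "(V has_derivative V') (at t within T)"
    "(W has_derivative W') (at t within T)" "x t \<in> U"
  shows "((\<lambda>t. Gam G (x t) (V t) (W t)) has_derivative
     (\<lambda>h. DGam G (x t) (x' h) (V t) (W t) + Gam G (x t) (V' h) (W t) + Gam G (x t) (V t) (W' h))) (at t within T)"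
proof -
  have "((\<lambda>t. \<Sum>i\<in>UNIV. \<Sum>j\<in>UNIV. (V t $ i * W t $ j) *\<^sub>R Gam G (x t) (axis i 1) (axis j 1)) has_derivative
     (\<lambda>h. \<Sum>i\<in>UNIV. \<Sum>j\<in>UNIV. (V t $ i * W t $ j) *\<^sub>R DGam G (x t) (x' h) (axis i 1) (axis j 1)
         + (V t $ i * W' h $ j + V' h $ i * W t $ j) *\<^sub>R Gam G (x t) (axis i 1) (axis j 1))) (at t within T)"
    by (intro has_derivative_sum has_derivative_scaleR has_derivative_mult bounded_linear.has_derivative[OF bounded_linear_vec_nth] assms
       has_derivative_compose[OF assms(1) Gam_has_derivative[OF assms(4)]])
  then have "((\<lambda>t. Gam G (x t) (V t) (W t)) has_derivative
     (\<lambda>h. \<Sum>i\<in>UNIV. \<Sum>j\<in>UNIV. (V t $ i * W t $ j) *\<^sub>R DGam G (x t) (x' h) (axis i 1) (axis j 1)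
         + (V t $ i * W' h $ j + V' h $ i * W t $ j) *\<^sub>R Gam G (x t) (axis i 1) (axis j 1))) (at t within T)"
    by (subst Gam_expand)
  then show ?thesis
  proof (rule has_derivative_eq_rhs)
    show "(\<lambda>h. \<Sum>i\<in>UNIV. \<Sum>j\<in>UNIV. (V t $ i * W t $ j) *\<^sub>R DGam G (x t) (x' h) (axis i 1) (axis j 1)
         + (V t $ i * W' h $ j + V' h $ i * W t $ j) *\<^sub>R Gam G (x t) (axis i 1) (axis j 1)) =
      (\<lambda>h. DGam G (x t) (x' h) (V t) (W t) + Gam G (x t) (V' h) (W t) + Gam G (x t) (V t) (W' h))"
      by (rule ext, subst DGam_expand[OF assms(4), of _ "V t"], subst Gam_expand[of _ "V' _"], subst Gam_expand[of _ "V t" "W' _"])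
         (simp add: sum.distrib scaleR_add_left algebra_simps)
  qed
qed

lemma continuous_on_Gam:
  assumes "continuous_on T a" "continuous_on T v" "continuous_on T w" "\<And>t. t \<in> T \<Longrightarrow> a t \<in> U"
  shows "continuous_on T (\<lambda>t. Gam G (a t) (v t) (w t))"
  by (subst Gam_expand)
    (intro continuous_intros assms continuous_on_compose2[OF smooth_on_continuous[OF smooth_Gam] assms(1)], use assms(4) in auto)

lemma continuous_on_DGam:
  assumes "continuous_on T a" "continuous_on T b" "continuous_on T v" "continuous_on T w" "\<And>t. t \<in> T \<Longrightarrow> a t \<in> U"
  shows "continuous_on T (\<lambda>t. DGam G (a t) (b t) (v t) (w t))"
proof -
  have "continuous_on T (\<lambda>t. \<Sum>i\<in>UNIV. \<Sum>j\<in>UNIV. (v t $ i * w t $ j) *\<^sub>R DGam G (a t) (b t) (axis i 1) (axis j 1))"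
    unfolding DGam_def by (intro continuous_intros assms continuous_on_dd[OF smooth_Gam])
  then show ?thesis using assms(5) DGam_expand by (simp cong: continuous_on_cong)
qed

lemma continuous_on_metric:
  assumes "continuous_on T a" "continuous_on T v" "continuous_on T w" "\<And>t. t \<in> T \<Longrightarrow> a t \<in> U"
  shows "continuous_on T (\<lambda>t. m (a t) (v t) (w t))"
  unfolding metric_form_def
  by (intro continuous_intros bounded_bilinear.continuous_on[OF bounded_bilinear_matrix_vector] assms
    continuous_on_compose2[OF smooth_on_continuous[OF smooth_G] assms(1)]) (use assms(4) in auto)

lemma riemann_curvature_Rm:
  assumes "x \<in> U" shows "riemann_curvature G (\<lambda>_. u) (\<lambda>_. v) (\<lambda>_. w) x = Rm G x u v w"
proof -
  have c: "covariant_derivative G (\<lambda>_. v) (\<lambda>_. w) = (\<lambda>y. Gam G y v w)" for v w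
    by (simp add: fun_eq_iff covariant_derivative_def Gam_def)
  have c2: "covariant_derivative G (\<lambda>_. u) (\<lambda>y. Gam G y v w) x = DGam G x u v w + Gam G x u (Gam G x v w)" for u v w
    by (simp add: covariant_derivative_def Gam_def[of G x u] DGam_def)
  have l: "lie_bracket (\<lambda>_. u) (\<lambda>_. v) = (\<lambda>_. 0)" by (simp add: lie_bracket_def fun_eq_iff)
  show ?thesis unfolding riemann_curvature_def c c2 l by (simp add: Rm_def Gam_simps)
qed

lemma linear_DGam: "x \<in> U \<Longrightarrow> linear (\<lambda>a. DGam G x a u v)"
  using Gam_has_derivative has_derivative_linear by blast

lemma DGam_simps:
  assumes "x \<in> U"
  shows "DGam G x (a + b) u v = DGam G x a u v + DGam G x b u v"
    "DGam G x a (u + w) v = DGam G x a u v + DGam G x a w v"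
    "DGam G x a u (v + w) = DGam G x a u v + DGam G x a u w"
    "DGam G x (c *\<^sub>R a) u v = c *\<^sub>R DGam G x a u v"
    "DGam G x a (c *\<^sub>R u) v = c *\<^sub>R DGam G x a u v"
    "DGam G x a u (c *\<^sub>R v) = c *\<^sub>R DGam G x a u v"
  by (simp_all add: linear_add[OF linear_DGam[OF assms]] linear_scale[OF linear_DGam[OF assms]] bounded_bilinear.add_left[OF bounded_bilinear_DGam[OF assms]]
     bounded_bilinear.add_right[OF bounded_bilinear_DGam[OF assms]]
     bounded_bilinear.scaleR_left[OF bounded_bilinear_DGam[OF assms]]
     bounded_bilinear.scaleR_right[OF bounded_bilinear_DGam[OF assms]])

lemma linear_Rm:
  assumes "x \<in> U" shows "linear (\<lambda>u. Rm G x u v w)" "linear (\<lambda>w. Rm G x u v w)"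
  by (auto intro!: linearI simp: Rm_def Gam_simps DGam_simps[OF assms] algebra_simps)

text \<open>Curvature is the commutator of second covariant derivatives, while the second
  derivatives of the function \<open>m y w z\<close> with constant w, z commute; the mixed products
  drop out of the difference.\<close>

lemma Rm_skew:
  assumes "x \<in> U" shows "m x (Rm G x u v w) z = - m x w (Rm G x u v z)"
proof -
  define h where "h = (\<lambda>v y. m y (Gam G y v w) z + m y w (Gam G y v z))"
  have smm: "smooth_on U (\<lambda>y. m y w z)"
    unfolding metric_form_def
    by (intro smooth_on_bounded_linear[OF open_U bounded_linear_inner_left]
      smooth_on_bounded_linear[OF open_U bounded_bilinear.bounded_linear_left[OF bounded_bilinear_matrix_vector]] smooth_G)
  have d1: "dd (\<lambda>y. m y w z) y v = h v y" if "y \<in> U" for y v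
    unfolding h_def using dd_eq[OF has_derivative_metric[of "\<lambda>y. y" "\<lambda>y. y" y UNIV "\<lambda>_. w" "\<lambda>_. 0" "\<lambda>_. z" "\<lambda>_. 0"]] that
    by simp
  have d2: "dd (\<lambda>y. dd (\<lambda>y. m y w z) y v) x u =
      m x (DGam G x u v w + Gam G x u (Gam G x v w)) z + m x (Gam G x v w) (Gam G x u z)
    + m x (Gam G x u w) (Gam G x v z) + m x w (DGam G x u v z + Gam G x u (Gam G x v z))" for u v
  proof -
    have "dd (\<lambda>y. dd (\<lambda>y. m y w z) y v) x = dd (h v) x"
      by (rule frechet_derivative_cong_open[OF open_U assms]) (rule d1)
    moreover have "(h v has_derivative (\<lambda>u. m x (DGam G x u v w + Gam G x u (Gam G x v w)) z + m x (Gam G x v w) (0 + Gam G x u z)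
    + (m x (0 + Gam G x u w) (Gam G x v z) + m x w (DGam G x u v z + Gam G x u (Gam G x v z))))) (at x)"
      unfolding h_def
      by (intro has_derivative_add has_derivative_metric has_derivative_ident has_derivative_const Gam_has_derivative assms)
    ultimately show ?thesis by (simp add: dd_eq)
  qed
  have "dd (\<lambda>y. dd (\<lambda>y. m y w z) y v) x u = dd (\<lambda>y. dd (\<lambda>y. m y w z) y u) x v"
    by (rule dd_dd_sym[OF open_U smm assms])
  then show ?thesis unfolding d2 Rm_def metric_form_simps by simp
qed

text \<open>With the frame as the columns of P, orthonormality says that Q = P^T G is a left inverse
  of P, hence also a right inverse. The expansion is P Q v = v, and the trace of L is that of Q L
  P.\<close>

lemma frame_expand:
  assumes "x \<in> U" "orthonormal_frame G x E"
  shows "v = (\<Sum>a\<in>UNIV. m x v (E a) *\<^sub>R E a)"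
    and "linear L \<Longrightarrow> trace (matrix L) = (\<Sum>a\<in>UNIV. m x (L (E a)) (E a))"
proof -
  define P where "P = (\<chi> i j. E j $ i)"
  define Q where "Q = transpose P ** G x"
  have Pm: "P *v axis a 1 = E a" for a
    by (simp add: vec_eq_iff P_def matrix_vector_mul_component inner_axis)
  have Qm: "(Q *v w) $ a = m x w (E a)" for w a
  proof -
    have "(Q *v w) $ a = (transpose P *v (G x *v w)) $ a" by (simp add: Q_def matrix_vector_mul_assoc)
    also have "\<dots> = (G x *v w) \<bullet> E a"
      by (simp add: transpose_def P_def matrix_vector_mult_def[of "\<chi> i. _ i"] inner_vec_def mult.commute)
    finally show ?thesis by (simp add: metric_form_def)
  qed
  have "Q ** P = mat 1"
  proof (rule matrix_eq[THEN iffD2], rule allI)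
    fix w
    have "P *v w = (\<Sum>b\<in>UNIV. w $ b *\<^sub>R E b)"
      by (simp add: vec_eq_iff P_def matrix_vector_mult_def mult.commute)
    then have "(Q *v (P *v w)) $ a = w $ a" for a
      using assms(2) by (simp add: Qm metric_form_sum metric_form_simps orthonormal_frame_def mult_delta_right)
    then show "(Q ** P) *v w = mat 1 *v w" by (simp add: vec_eq_iff matrix_vector_mul_assoc[symmetric])
  qed
  then have PQ: "P ** Q = mat 1" using matrix_left_right_inverse by blast
  show "v = (\<Sum>a\<in>UNIV. m x v (E a) *\<^sub>R E a)"
  proof -
    have "v = P *v (Q *v v)" by (simp add: matrix_vector_mul_assoc PQ)
    also have "\<dots> = (\<Sum>a\<in>UNIV. (Q *v v) $ a *\<^sub>R E a)"
      by (simp add: vec_eq_iff P_def matrix_vector_mult_def[of "\<chi> i. _ i"] mult.commute)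
    finally show ?thesis by (simp add: Qm)
  qed
  assume L: "linear L"
  have "trace (matrix L) = trace ((matrix L ** P) ** Q)" by (simp add: matrix_mul_assoc[symmetric] PQ)
  also have "\<dots> = trace (Q ** (matrix L ** P))" by (rule trace_mul_sym)
  also have "\<dots> = (\<Sum>a\<in>UNIV. m x (L (E a)) (E a))"
    unfolding trace_def
  proof (rule sum.cong[OF refl])
    fix a
    have "(Q ** (matrix L ** P)) $ a $ a = ((Q ** (matrix L ** P)) *v axis a 1) $ a"
      by (simp add: matrix_vector_mul_component inner_axis)
    also have "\<dots> = (Q *v (matrix L *v E a)) $ a" by (simp add: matrix_vector_mul_assoc[symmetric] Pm)
    also have "\<dots> = m x (L (E a)) (E a)" using L by (simp add: Qm matrix_works)
    finally show "(Q ** (matrix L ** P)) $ a $ a = m x (L (E a)) (E a)" .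
  qed
  finally show "trace (matrix L) = (\<Sum>a\<in>UNIV. m x (L (E a)) (E a))" .
qed

lemma frame_norm:
  assumes "x \<in> U" "orthonormal_frame G x E"
  shows "(\<Sum>a\<in>UNIV. (m x v (E a))\<^sup>2) = m x v v"
proof -
  have "m x v v = m x v (\<Sum>a\<in>UNIV. m x v (E a) *\<^sub>R E a)" using frame_expand(1)[OF assms, of v] by simp
  then show ?thesis by (simp add: metric_form_sum metric_form_simps power2_eq_square)
qed

text \<open>The next vector is found by counting dimensions: the map formed by the inner products
  with the vectors of I never reaches the axis c outside I, so it is not onto and has a
  kernel.\<close>

lemma exists_frame:
  assumes "x \<in> U" shows "\<exists>E. orthonormal_frame G x E"
proof -
  have "\<exists>E. \<forall>a\<in>I. \<forall>b\<in>I. m x (E a) (E b) = (if a = b then 1 else 0)" if "finite I" for I :: "'n set"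
    using that
  proof (induction I)
    case (insert c I)
    then obtain E where E: "\<forall>a\<in>I. \<forall>b\<in>I. m x (E a) (E b) = (if a = b then 1 else 0)" by blast
    define L where "L v = (\<Sum>a\<in>I. m x v (E a) *\<^sub>R axis a (1::real))" for v
    have lin: "linear L" by (auto intro!: linearI simp: L_def metric_form_simps scaleR_add_left sum.distrib scaleR_sum_right)
    have "\<not> surj L"
    proof
      assume "surj L"
      then obtain v where "L v = axis c 1" by (metis surjD)
      then have "L v $ c = 1" by simp
      moreover have "L v $ c = 0" using insert by (auto simp: L_def axis_def intro!: sum.neutral)
      ultimately show False by simp
    qed
    then have "\<not> inj L" using linear_injective_imp_surjective[OF lin] by blast
    then obtain v where v: "L v = 0" "v \<noteq> 0" using lin linear_injective_0 by blast
    have o: "m x v (E a) = 0" if "a \<in> I" for a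
    proof -
      have "L v $ a = m x v (E a)" using that insert by (simp add: L_def axis_def if_distrib cong: if_cong)
      then show ?thesis using v by simp
    qed
    define e where "e = (1 / sqrt (m x v v)) *\<^sub>R v"
    have "m x e e = 1" "\<forall>a\<in>I. m x e (E a) = 0" using metric_pos[OF assms v(2)] o by (auto simp: e_def metric_form_simps)
    moreover have "\<forall>a\<in>I. m x (E a) e = 0" using calculation metric_sym[OF assms] by metis
    ultimately show ?case using E insert by (intro exI[of _ "E(c := e)"]) auto
  qed auto
  from this[of UNIV] show ?thesis by (auto simp: orthonormal_frame_def)
qed

lemma ricci_frame:
  assumes "x \<in> U" "orthonormal_frame G x E"
  shows "ricci G x v w = (\<Sum>a\<in>UNIV. m x (Rm G x (E a) v w) (E a))"
  unfolding ricci_def riemann_curvature_Rm[OF assms(1)]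
  by (rule frame_expand(2)[OF assms linear_Rm(1)[OF assms(1)]])

end

section \<open>Gradient and Hessian of a function in a chart\<close>

locale riem_chart_function = riem_chart U G for U :: "(real^'n::finite) set" and G +
  fixes F :: "real^'n \<Rightarrow> real"
  assumes smooth_F: "smooth_on U F"
begin

abbreviation X where "X \<equiv> gradient G F"

lemma metric_gradient: assumes "x \<in> U" shows "m x (X x) w = dd F x w"
proof -
  have e: "w = (\<Sum>i\<in>UNIV. w $ i *\<^sub>R axis i 1)" by (simp add: vec_eq_iff axis_def if_distrib cong: if_cong)
  have "dd F x w = (\<Sum>i\<in>UNIV. w $ i * dd F x (axis i 1))"
    by (subst e) (simp add: linear_sum[OF dd_linear(1)[OF smooth_F assms]] linear_scale[OF dd_linear(1)[OF smooth_F assms]])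
  then show ?thesis by (simp add: gradient_def metric_form_def G_inv[OF assms] partial_def inner_vec_def mult.commute)
qed

lemma smooth_X: "smooth_on U X"
proof -
  have eq: "X = (\<lambda>x. matrix_inv (G x) *v (\<Sum>i\<in>UNIV. dd F x (axis i 1) *\<^sub>R axis i 1))"
  proof (rule ext)
    fix x
    have "(axis j (1::real) :: real^'n) $ i = (if j = i then 1 else 0)" for i j by (simp add: axis_def)
    then have "(\<chi> i. partial i F x) = (\<Sum>i\<in>UNIV. dd F x (axis i 1) *\<^sub>R axis i 1)"
      by (simp add: vec_eq_iff partial_def mult_delta_right)
    then show "X x = matrix_inv (G x) *v (\<Sum>i\<in>UNIV. dd F x (axis i 1) *\<^sub>R axis i 1)" by (simp add: gradient_def)
  qed
  show ?thesis unfolding eq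
    by (intro smooth_on_bilinear[OF open_U bounded_bilinear_matrix_vector] smooth_inv smooth_on_sum[OF open_U]
       smooth_on_bounded_linear[OF open_U bounded_linear_scaleR_left] smooth_on_dd smooth_F)
qed

abbreviation H where "H \<equiv> nabla G X"

lemma linear_H: "x \<in> U \<Longrightarrow> linear (H x)"
  using dd_linear(1)[OF smooth_X, of x]
  by (auto intro!: linearI simp: nabla_def Gam_simps linear_add linear_scale algebra_simps)

lemma hessian_H: "hessian G F x v w = m x (H x v) w"
  by (simp add: hessian_def covariant_derivative_def nabla_def Gam_def)

lemma H_eq: assumes "x \<in> U"
  shows "m x (H x v) w = dd (\<lambda>y. dd F y w) x v - dd F x (Gam G x v w)"
proof -
  have "dd (\<lambda>y. dd F y w) x = dd (\<lambda>y. m y (X y) w) x"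
    by (rule frechet_derivative_cong_open[OF open_U assms]) (simp add: metric_gradient)
  also have "\<dots> = (\<lambda>v. m x (dd X x v + Gam G x v (X x)) w + m x (X x) (0 + Gam G x v w))"
    by (intro dd_eq has_derivative_metric has_derivative_ident has_derivative_const smooth_on_has_derivative[OF smooth_X] assms)
  finally show ?thesis by (simp add: nabla_def metric_gradient[OF assms])
qed

lemma H_sym: assumes "x \<in> U" shows "m x (H x v) w = m x v (H x w)"
  unfolding metric_sym[OF assms, of v] H_eq[OF assms]
  using dd_dd_sym[OF open_U smooth_F assms, of v w] Gam_sym[OF assms, of v w] by simp

end

section \<open>The scalar curvature of a shrinking soliton at its minimum\<close>

lemma local_min_second_order:
  fixes Q :: "'b::euclidean_space \<Rightarrow> real"
  assumes "open S" "smooth_on S Q" "x \<in> S" "\<And>y. y \<in> S \<Longrightarrow> Q x \<le> Q y"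
  shows "dd Q x v = 0" "dd (\<lambda>y. dd Q y v) x v \<ge> 0"
proof -
  show "dd Q x v = 0"
    using differential_zero_maxmin[OF assms(3,1) smooth_on_has_derivative[OF assms(2,3)]] assms(4) by metis
  obtain d where d: "d > 0" "ball x d \<subseteq> S" using assms(1,3) open_contains_ball by blast
  \<comment> \<open>The directions v and -v make the second difference 2 Q(x) - Q(x + t v) - Q(x - t
    v), which is not positive at a minimum.\<close>
  have "dd (\<lambda>y. dd Q y v) x (- v) \<le> 0"
  proof (rule tendsto_upperbound[OF second_difference_tendsto[OF assms(1-3), of v "-v"]])
    have "(Q (x + t *\<^sub>R v + t *\<^sub>R - v) - Q (x + t *\<^sub>R v) - Q (x + t *\<^sub>R - v) + Q x) / t\<^sup>2 \<le> 0"
      if t: "0 < t" "t < d / (norm v + 1)" for t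
    proof -
      have "t * norm v < d" using t
        by (smt (verit, ccfv_SIG) mult_less_cancel_left_pos norm_ge_zero pos_less_divide_eq)
      then have "x + t *\<^sub>R v \<in> S" "x + t *\<^sub>R - v \<in> S" using d t by (auto simp: dist_norm subset_iff)
      then show ?thesis using assms(4) by (intro divide_nonpos_nonneg) (smt (verit) add.right_neutral add_diff_cancel_right' scaleR_minus_right diff_add_cancel add_uminus_conv_diff zero_le_power2)+
    qed
    then show "\<forall>\<^sub>F t in at_right 0. (Q (x + t *\<^sub>R v + t *\<^sub>R - v) - Q (x + t *\<^sub>R v) - Q (x + t *\<^sub>R - v) + Q x) / t\<^sup>2 \<le> 0"
      unfolding eventually_at_right_field using d
      by (intro exI[of _ "d / (norm v + 1)"]) (auto intro!: divide_pos_pos add_nonneg_pos)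
  qed simp
  then show "dd (\<lambda>y. dd Q y v) x v \<ge> 0"
    using linear_neg[OF dd_linear(1)[OF smooth_on_dd[OF assms(2)] assms(3)]] by simp
qed

locale soliton_chart = riem_chart_function U G F for U :: "(real^'n::finite) set" and G F +
  fixes l :: real
  assumes soliton: "x \<in> U \<Longrightarrow> ricci G x v w + hessian G F x v w = l * metric_form G x v w"
begin

text \<open>The trace of the soliton equation. It will also give independence of the chart, since H
  transforms by conjugation.\<close>

lemma scalar_curvature_trace:
  assumes "x \<in> U"
  shows "scalar_curvature_coord G x = l * real CARD('n) - trace (matrix (H x))"
proof -
  let ?I = "matrix_inv (G x)"
  have r: "ricci G x v w = l * m x v w - m x (H x v) w" for v w
    using soliton[OF assms, of v w] by (simp add: hessian_H)
  \<comment> \<open>Contraction with the inverse metric undoes the lowering of the index, for any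
    family L of vectors.\<close>
  have 1: "(\<Sum>i\<in>UNIV. \<Sum>j\<in>UNIV. ?I $ i $ j * m x (L i) (axis j 1)) = (\<Sum>i\<in>UNIV. L i $ i)" for L
  proof (rule sum.cong[OF refl])
    fix i
    have "(\<Sum>j\<in>UNIV. ?I $ i $ j * m x (L i) (axis j 1)) = (?I *v (G x *v L i)) $ i"
      by (simp add: matrix_vector_mult_def[of ?I] metric_form_def inner_axis)
    also have "\<dots> = L i $ i"
      using matrix_inv_mult(2)[OF invertible_G[OF assms]] by (simp add: matrix_vector_mul_assoc)
    finally show "(\<Sum>j\<in>UNIV. ?I $ i $ j * m x (L i) (axis j 1)) = L i $ i" .
  qed
  have "scalar_curvature_coord G x = l * (\<Sum>i\<in>UNIV. \<Sum>j\<in>UNIV. ?I $ i $ j * m x (axis i 1) (axis j 1))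
      - (\<Sum>i\<in>UNIV. \<Sum>j\<in>UNIV. ?I $ i $ j * m x (H x (axis i 1)) (axis j 1))"
    by (simp add: scalar_curvature_coord_def r algebra_simps sum_subtractf sum_distrib_left)
  also have "\<dots> = l * real CARD('n) - trace (matrix (H x))"
    unfolding 1[of "\<lambda>i. axis i 1"] 1[of "\<lambda>i. H x (axis i 1)"] by (simp add: trace_def matrix_def)
  finally show ?thesis .
qed

text \<open>By the normalization this is the scalar curvature in the chart, in a form whose
  smoothness is evident.\<close>

definition Q where "Q x = 2 * l * F x - m x (X x) (X x)"

definition DH where
  "DH x w v = dd (\<lambda>y. dd X y v) x w + DGam G x w v (X x) + Gam G x v (dd X x w)"

text \<open>The covariant derivative of the Hessian endomorphism, (nabla_w H) v.\<close>

definition N where "N x w v = DH x w v + Gam G x w (H x v) - H x (Gam G x w v)"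

lemma H_has_derivative: assumes "x \<in> U" shows "((\<lambda>y. H y v) has_derivative (\<lambda>w. DH x w v)) (at x)"
proof -
  have "((\<lambda>y. dd X y v + Gam G y v (X y)) has_derivative
      (\<lambda>w. dd (\<lambda>y. dd X y v) x w + (DGam G x w v (X x) + Gam G x 0 (X x) + Gam G x v (dd X x w)))) (at x)"
    by (intro has_derivative_add has_derivative_Gam has_derivative_ident has_derivative_const assms
       smooth_on_has_derivative[OF smooth_X] smooth_on_has_derivative[OF smooth_on_dd[OF smooth_X]])
  then show ?thesis by (simp add: nabla_def DH_def Gam_simps add.assoc)
qed

lemma linear_DH: assumes "x \<in> U" shows "linear (DH x w)"
proof -
  have "bounded_linear (\<lambda>v. dd (\<lambda>y. dd X y v) x w)"
    using dd_dd_sym[OF open_U smooth_X assms, of _ w] dd_linear(2)[OF smooth_on_dd[OF smooth_X] assms, of w] by simp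
  then have lin: "linear (\<lambda>v. dd (\<lambda>y. dd X y v) x w)" by (rule bounded_linear.linear)
  note lin' = dd_linear(1)[OF smooth_X assms]
  show ?thesis
    by (auto intro!: linearI simp: DH_def[abs_def] Gam_simps DGam_simps[OF assms] linear_add[OF lin] linear_scale[OF lin]
       linear_add[OF lin'] linear_scale[OF lin'] algebra_simps)
qed

lemma linear_N: assumes "x \<in> U" shows "linear (N x w)"
  by (auto intro!: linearI simp: N_def Gam_simps linear_add[OF linear_H[OF assms]] linear_scale[OF linear_H[OF assms]]
     linear_add[OF linear_DH[OF assms]] linear_scale[OF linear_DH[OF assms]] algebra_simps)

text \<open>Ricci's commutation identity: the second derivatives of X, the terms with its first
  derivatives and the term with H are symmetric in v and w; what remains is curvature.\<close>

lemma N_antisym: assumes "x \<in> U" shows "N x w v - N x v w = Rm G x w v (X x)"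
  using dd_dd_sym[OF open_U smooth_X assms, of v w] Gam_sym[OF assms, of v w]
  by (simp add: N_def DH_def Rm_def nabla_def Gam_simps)

lemma N_sym: assumes "x \<in> U" shows "m x (N x w v) z = m x v (N x w z)"
proof -
  have "dd (\<lambda>y. m y (H y v) z) x = dd (\<lambda>y. m y v (H y z)) x"
    by (rule frechet_derivative_cong_open[OF open_U assms]) (rule H_sym)
  moreover have "dd (\<lambda>y. m y (H y v) z) x = (\<lambda>w. m x (DH x w v + Gam G x w (H x v)) z + m x (H x v) (0 + Gam G x w z))"
    by (intro dd_eq has_derivative_metric has_derivative_ident has_derivative_const H_has_derivative assms)
  moreover have "dd (\<lambda>y. m y v (H y z)) x = (\<lambda>w. m x (0 + Gam G x w v) (H x z) + m x v (DH x w z + Gam G x w (H x z)))"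
    by (intro dd_eq has_derivative_metric has_derivative_ident has_derivative_const H_has_derivative assms)
  ultimately have "m x (DH x w v + Gam G x w (H x v)) z + m x (H x v) (Gam G x w z)
     = m x (Gam G x w v) (H x z) + m x v (DH x w z + Gam G x w (H x z))" by (simp add: fun_eq_iff)
  then show ?thesis using H_sym[OF assms, of v "Gam G x w z"] H_sym[OF assms, of "Gam G x w v" z]
    by (simp add: N_def metric_form_simps)
qed

text \<open>N and DH differ by a commutator, which has trace zero.\<close>

lemma trace_N: assumes "x \<in> U" shows "trace (matrix (N x w)) = trace (matrix (DH x w))"
proof -
  have lG: "linear (Gam G x w)" by (auto intro!: linearI simp: Gam_simps)
  have "matrix (N x w) = matrix (DH x w) + matrix (Gam G x w \<circ> H x) - matrix (H x \<circ> Gam G x w)"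
    by (simp add: matrix_def vec_eq_iff N_def)
  also have "\<dots> = matrix (DH x w) + matrix (Gam G x w) ** matrix (H x) - matrix (H x) ** matrix (Gam G x w)"
    using matrix_compose[OF linear_H[OF assms] lG] matrix_compose[OF lG linear_H[OF assms]] by simp
  finally show ?thesis using trace_mul_sym[of "matrix (Gam G x w)" "matrix (H x)"] by (simp add: trace_add trace_sub)
qed

lemma dd_Q: assumes "x \<in> U" shows "dd Q x v = 2 * l * dd F x v - 2 * m x (H x v) (X x)"
proof -
  have "dd (\<lambda>x. 2 * l * F x - m x (X x) (X x)) x = (\<lambda>w. 2 * l * dd F x w -
     (m x (dd X x w + Gam G x w (X x)) (X x) + m x (X x) (dd X x w + Gam G x w (X x))))"
    by (intro dd_eq has_derivative_diff has_derivative_mult_right has_derivative_metric has_derivative_ident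
       smooth_on_has_derivative[OF smooth_X] smooth_on_has_derivative[OF smooth_F] assms)
  then show ?thesis using metric_sym[OF assms, of "X x"] by (simp add: Q_def[abs_def] nabla_def)
qed

lemma dd_dd_Q: assumes "x \<in> U"
  shows "dd (\<lambda>y. dd Q y v) x w = 2 * l * dd (\<lambda>y. dd F y v) x w
     - 2 * (m x (DH x w v + Gam G x w (H x v)) (X x) + m x (H x v) (H x w))"
proof -
  have "dd (\<lambda>y. dd Q y v) x = dd (\<lambda>y. 2 * l * dd F y v - 2 * m y (H y v) (X y)) x"
    by (rule frechet_derivative_cong_open[OF open_U assms]) (rule dd_Q)
  also have "\<dots> = (\<lambda>w. 2 * l * dd (\<lambda>y. dd F y v) x w
     - 2 * (m x (DH x w v + Gam G x w (H x v)) (X x) + m x (H x v) (dd X x w + Gam G x w (X x))))"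
    by (intro dd_eq has_derivative_diff has_derivative_mult_right has_derivative_metric has_derivative_ident
       smooth_on_has_derivative[OF smooth_X] smooth_on_has_derivative[OF smooth_on_dd[OF smooth_F]] H_has_derivative assms)
  finally show ?thesis by (simp add: nabla_def)
qed

lemma smooth_Q: "smooth_on U Q"
  unfolding Q_def[abs_def] metric_form_def
  by (intro smooth_on_diff[OF open_U] smooth_on_bounded_linear[OF open_U bounded_linear_mult_right] smooth_F
    smooth_on_bilinear[OF open_U bounded_bilinear_inner] smooth_on_bilinear[OF open_U bounded_bilinear_matrix_vector] smooth_G smooth_X)

text \<open>Bochner's formula: at a minimum of \<open>R = 2 l F - |X|\<^sup>2\<close> the vector \<open>X\<close> is an eigenvector of the
  Hessian for the eigenvalue \<open>l\<close>, hence lies in the kernel of the Ricci tensor, and the Laplacian of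
  \<open>R\<close> is \<open>2 (l tr H - |H|\<^sup>2)\<close>.\<close>

lemma scalar_curvature_min_nonneg:
  assumes "x \<in> U" "l > 0"
    and scal: "\<And>y. y \<in> U \<Longrightarrow> scalar_curvature_coord G y = Q y"
    and min: "\<And>y. y \<in> U \<Longrightarrow> Q x \<le> Q y"
  shows "Q x \<ge> 0"
proof -
  note lm = local_min_second_order[OF open_U smooth_Q assms(1) min]
  have tr: "trace (matrix (H y)) = l * real CARD('n) - Q y" if "y \<in> U" for y
    using scalar_curvature_trace[OF that] scal[OF that] by simp
  obtain E where E: "orthonormal_frame G x E" using exists_frame[OF assms(1)] by blast
  note trE = frame_expand(2)[OF assms(1) E]
  have HX: "m x (H x v) (X x) = l * dd F x v" for v using lm(1)[of v] by (simp add: dd_Q[OF assms(1)])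
  have RicX: "ricci G x (X x) (X x) = 0"
  proof -
    have "ricci G x (X x) (X x) = l * m x (X x) (X x) - m x (H x (X x)) (X x)"
      using soliton[OF assms(1), of "X x" "X x"] by (simp add: hessian_H)
    then show ?thesis by (simp add: HX metric_gradient[OF assms(1)])
  qed
  \<comment> \<open>The trace of H is l n - R by the soliton equation, and dR vanishes at the
    minimum.\<close>
  have trDH: "trace (matrix (DH x w)) = 0" for w
  proof -
    have "((\<lambda>y. \<Sum>i\<in>UNIV. H y (axis i 1) $ i) has_derivative (\<lambda>w. \<Sum>i\<in>UNIV. DH x w (axis i 1) $ i)) (at x)"
      by (intro has_derivative_sum bounded_linear.has_derivative[OF bounded_linear_vec_nth] H_has_derivative assms)
    then have "dd (\<lambda>y. trace (matrix (H y))) x w = trace (matrix (DH x w))"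
      by (simp add: trace_def matrix_def dd_eq)
    moreover have "dd (\<lambda>y. trace (matrix (H y))) x = dd (\<lambda>y. l * real CARD('n) - Q y) x"
      by (rule frechet_derivative_cong_open[OF open_U assms(1)]) (rule tr)
    moreover have "dd (\<lambda>y. l * real CARD('n) - Q y) x = (\<lambda>w. 0 - dd Q x w)"
      by (intro dd_eq has_derivative_diff has_derivative_const smooth_on_has_derivative[OF smooth_Q] assms)
    ultimately show ?thesis using lm(1)[of w] by simp
  qed
  \<comment> \<open>The divergence of the Hessian is the differential of its trace plus Ric(X, .);
    in the direction X both vanish here.\<close>
  have NX: "(\<Sum>a\<in>UNIV. m x (N x (E a) (E a)) (X x)) = 0"
  proof -
    have "m x (N x (E a) (E a)) (X x) = m x (N x (X x) (E a)) (E a) + m x (Rm G x (E a) (X x) (X x)) (E a)" for a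
    proof -
      have "m x (N x (E a) (E a)) (X x) = m x (N x (E a) (X x)) (E a)"
        using N_sym[OF assms(1)] metric_sym[OF assms(1)] by metis
      moreover have "N x (E a) (X x) = N x (X x) (E a) + Rm G x (E a) (X x) (X x)"
        using N_antisym[OF assms(1), of "E a" "X x"] by (simp add: algebra_simps)
      ultimately show ?thesis by (simp add: metric_form_simps)
    qed
    then have "(\<Sum>a\<in>UNIV. m x (N x (E a) (E a)) (X x)) = trace (matrix (N x (X x))) + ricci G x (X x) (X x)"
      by (simp add: sum.distrib trE[OF linear_N[OF assms(1)]] ricci_frame[OF assms(1) E])
    then show ?thesis by (simp add: trace_N[OF assms(1)] trDH RicX)
  qed
  \<comment> \<open>Since dQ = 0 at x, a \<open>Gam\<close> term may be inserted that makes the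
    second coordinate derivative covariant.\<close>
  have *: "0 \<le> 2 * l * m x (H x v) v - 2 * m x (N x v v) (X x) - 2 * m x (H x v) (H x v)" for v
  proof -
    have "dd Q x (Gam G x v v) = 0" using lm(1) .
    then have "l * dd F x (Gam G x v v) = m x (H x (Gam G x v v)) (X x)" by (simp add: dd_Q[OF assms(1)])
    moreover have "dd (\<lambda>y. dd F y v) x v = m x (H x v) v + dd F x (Gam G x v v)"
      using H_eq[OF assms(1), of v v] by simp
    ultimately show ?thesis using lm(2)[of v]
      by (simp add: dd_dd_Q[OF assms(1)] N_def metric_form_simps algebra_simps)
  qed
  define t where "t = trace (matrix (H x))"
  have t: "t = (\<Sum>a\<in>UNIV. m x (H x (E a)) (E a))" using trE[OF linear_H[OF assms(1)]] by (simp add: t_def)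
  have "0 \<le> (\<Sum>a\<in>UNIV. 2 * l * m x (H x (E a)) (E a) - 2 * m x (N x (E a) (E a)) (X x) - 2 * m x (H x (E a)) (H x (E a)))"
    by (intro sum_nonneg *)
  also have "\<dots> = 2 * l * t - 2 * (\<Sum>a\<in>UNIV. m x (H x (E a)) (H x (E a)))"
    using NX by (simp add: t sum_subtractf sum_distrib_left[symmetric])
  finally have 1: "(\<Sum>a\<in>UNIV. m x (H x (E a)) (H x (E a))) \<le> l * t" by simp
  \<comment> \<open>Cauchy-Schwarz over the frame: the squared trace of H is at most n
    |H|^2.\<close>
  have "t\<^sup>2 \<le> (\<Sum>a\<in>UNIV. (m x (H x (E a)) (E a))\<^sup>2) * (\<Sum>a\<in>(UNIV::'n set). 1\<^sup>2)"
    using Cauchy_Schwarz_ineq_sum[of "\<lambda>a. m x (H x (E a)) (E a)" "\<lambda>_. 1" "UNIV::'n set"] by (simp add: t)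
  also have "\<dots> \<le> (\<Sum>a\<in>UNIV. m x (H x (E a)) (H x (E a))) * (\<Sum>a\<in>(UNIV::'n set). 1\<^sup>2)"
  proof (intro mult_right_mono sum_mono)
    fix a
    have "(m x (H x (E a)) (E a))\<^sup>2 \<le> (\<Sum>b\<in>UNIV. (m x (H x (E a)) (E b))\<^sup>2)"
      by (rule member_le_sum) auto
    then show "(m x (H x (E a)) (E a))\<^sup>2 \<le> m x (H x (E a)) (H x (E a))" using frame_norm[OF assms(1) E] by simp
  qed (auto intro: sum_nonneg)
  finally have "t\<^sup>2 \<le> (l * t) * real CARD('n)" using 1 by (simp add: mult_right_mono order_trans)
  \<comment> \<open>A negative R = l n - t would mean t > l n > 0 and make this product
    negative.\<close>
  then have "t * (l * real CARD('n) - t) \<ge> 0" by (simp add: power2_eq_square algebra_simps)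
  moreover have "t = l * real CARD('n) - Q x" using tr[OF assms(1)] by (simp add: t_def)
  moreover have "l * real CARD('n) > 0" using assms(2) by simp
  ultimately show ?thesis by (smt (verit) zero_le_mult_iff)
qed

end

section \<open>The second variation of arc length\<close>

text \<open>Exact algebra in place of a Taylor expansion: for the average S of the two roots, S^2 =
  (p + r + 2 sqrt (p r)) / 4; the product p r is at most the square of a - 2 z, so S^2 <= a - z, and
  S <= (1 + S^2) / 2.\<close>

lemma sqrt_average_le:
  fixes a b s :: real
  assumes "a > 0" "0 \<le> a + 2 * s * b" "0 \<le> a - 2 * s * b"
  shows "(sqrt (a + 2 * s * b) + sqrt (a - 2 * s * b)) / 2 \<le> 1 + (a - 1 - s\<^sup>2 * b\<^sup>2 / a) / 2"
proof -
  define p r S where "p = a + 2 * s * b" and "r = a - 2 * s * b" and "S = (sqrt p + sqrt r) / 2"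
  define z where "z = s\<^sup>2 * b\<^sup>2 / a"
  have az: "a * z = s\<^sup>2 * b\<^sup>2" using assms(1) by (simp add: z_def)
  have "p * r = a * a - 4 * (s\<^sup>2 * b\<^sup>2)" by (simp add: p_def r_def power2_eq_square algebra_simps)
  then have pr: "p * r = a * a - 4 * (a * z)" by (simp only: az)
  have "p * r \<ge> 0" using assms by (simp add: p_def r_def)
  then have "a * (4 * z) \<le> a * a" using pr by (simp add: algebra_simps)
  then have "4 * z \<le> a" using assms(1) by simp
  moreover have "z \<ge> 0" using assms(1) by (simp add: z_def)
  moreover have "p * r \<le> (a - 2 * z)\<^sup>2" unfolding pr using zero_le_square[of z] by (simp add: power2_eq_square algebra_simps)
  ultimately have "sqrt (p * r) \<le> a - 2 * z" by (intro real_le_lsqrt) auto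
  moreover have "S\<^sup>2 = (p + r + 2 * sqrt (p * r)) / 4"
    using assms(2,3) by (simp add: S_def power_divide power2_sum p_def[symmetric] r_def[symmetric] real_sqrt_mult)
  ultimately have "S\<^sup>2 \<le> a - z" by (simp add: p_def r_def)
  moreover have "S \<le> (1 + S\<^sup>2) / 2" using zero_le_power2[of "S - 1"] by (simp add: power2_diff)
  ultimately have "S \<le> 1 + (a - 1 - z) / 2" by argo
  then show ?thesis by (simp add: S_def p_def r_def z_def)
qed

text \<open>In sqrt (1 + x) = 1 + x/2 - x^2/8 + ... averaging over s and -s removes the term linear
  in b, but its square leaves -b^2, from which n - 1 instead of n will result. Only upper bounds of
  p and r enter, so errors can be absorbed in q.\<close>

lemma sqrt_average_uniform:
  fixes C \<eta> :: real
  assumes "C > 0" "\<eta> > 0"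
  shows "\<exists>s0>0. \<forall>s b q p r. 0 < s \<and> s \<le> s0 \<and> \<bar>b\<bar> \<le> C \<and> \<bar>q\<bar> \<le> C \<and> 0 \<le> p \<and> 0 \<le> r \<and>
     p \<le> 1 + 2 * s * b + s\<^sup>2 * q \<and> r \<le> 1 - 2 * s * b + s\<^sup>2 * q \<longrightarrow>
     (sqrt p + sqrt r) / 2 \<le> 1 + s\<^sup>2 / 2 * (q - b\<^sup>2 + \<eta>)"
proof -
  \<comment> \<open>The first bound gives a >= 1/2 below, the second b^2 - b^2 / a <=
    \<eta>.\<close>
  define s0 where "s0 = sqrt (min (1 / (2 * C)) (\<eta> / (2 * C ^ 3)))"
  have s0: "s0 > 0" using assms by (simp add: s0_def)
  have "(sqrt p + sqrt r) / 2 \<le> 1 + s\<^sup>2 / 2 * (q - b\<^sup>2 + \<eta>)"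
    if h: "0 < s" "s \<le> s0" "\<bar>b\<bar> \<le> C" "\<bar>q\<bar> \<le> C" "0 \<le> p" "0 \<le> r"
      "p \<le> 1 + 2 * s * b + s\<^sup>2 * q" "r \<le> 1 - 2 * s * b + s\<^sup>2 * q" for s b q p r
  proof -
    define a where "a = 1 + s\<^sup>2 * q"
    have "s\<^sup>2 \<le> s0\<^sup>2" using h by (intro power_mono) auto
    then have s2: "s\<^sup>2 \<le> 1 / (2 * C)" "s\<^sup>2 \<le> \<eta> / (2 * C ^ 3)" using assms by (auto simp: s0_def)
    have "\<bar>s\<^sup>2 * q\<bar> \<le> s\<^sup>2 * C" using h(4) by (simp add: abs_mult mult_left_mono)
    moreover have "s\<^sup>2 * C \<le> 1/2" using s2(1) assms by (simp add: field_simps)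
    ultimately have a: "a \<ge> 1/2" and sq: "s\<^sup>2 * q \<le> s\<^sup>2 * C" by (auto simp: a_def)
    have b2: "b\<^sup>2 \<le> C\<^sup>2" using h(3) abs_le_square_iff[of b C] assms by simp
    have "b\<^sup>2 - \<eta> \<le> b\<^sup>2 / a"
    proof -
      have "b\<^sup>2 * (a - 1) \<le> b\<^sup>2 * (s\<^sup>2 * C)" using sq by (intro mult_left_mono) (auto simp: a_def)
      also have "\<dots> \<le> C\<^sup>2 * (s\<^sup>2 * C)" using b2 assms by (intro mult_right_mono) auto
      also have "\<dots> \<le> \<eta> / 2" using s2(2) assms by (simp add: field_simps power2_eq_square power3_eq_cube)
      also have "\<dots> \<le> \<eta> * a" using a assms by simp
      finally show ?thesis using a by (simp add: field_simps)
    qed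
    then have "s\<^sup>2 * (b\<^sup>2 - \<eta>) \<le> s\<^sup>2 * b\<^sup>2 / a" using mult_left_mono[of "b\<^sup>2 - \<eta>" "b\<^sup>2 / a" "s\<^sup>2"] by simp
    moreover have "(sqrt p + sqrt r) / 2 \<le> (sqrt (a + 2 * s * b) + sqrt (a - 2 * s * b)) / 2"
      using h by (intro divide_right_mono add_mono real_sqrt_le_mono) (auto simp: a_def)
    moreover have "\<dots> \<le> 1 + (a - 1 - s\<^sup>2 * b\<^sup>2 / a) / 2"
      using a h by (intro sqrt_average_le) (auto simp: a_def)
    moreover have "1 + s\<^sup>2 / 2 * (q - b\<^sup>2 + \<eta>) = 1 + ((a - 1) - s\<^sup>2 * (b\<^sup>2 - \<eta>)) / 2"
      by (simp add: a_def field_simps)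
    ultimately show ?thesis by argo
  qed
  then show ?thesis using s0 by blast
qed

lemma taylor2_le:
  fixes f f' f'' :: "real \<Rightarrow> real"
  assumes "\<And>t. \<bar>t\<bar> \<le> r \<Longrightarrow> (f has_real_derivative f' t) (at t)"
    "\<And>t. \<bar>t\<bar> \<le> r \<Longrightarrow> (f' has_real_derivative f'' t) (at t)"
    "\<And>t. \<bar>t\<bar> \<le> r \<Longrightarrow> f'' t \<le> M" "\<bar>s\<bar> \<le> r"
  shows "f s \<le> f 0 + s * f' 0 + s\<^sup>2 / 2 * M"
proof -
  define d where "d k = (if k = 0 then f else if k = Suc 0 then f' else f'')" for k :: nat
  have "\<exists>t. \<bar>t\<bar> \<le> \<bar>s\<bar> \<and> f s = (\<Sum>k<2. d k 0 / fact k * s ^ k) + d 2 t / fact 2 * s ^ 2"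
    by (rule Maclaurin_bi_le) (use assms in \<open>auto simp: d_def less_2_cases_iff\<close>)
  then obtain t where t: "\<bar>t\<bar> \<le> \<bar>s\<bar>" "f s = f 0 + s * f' 0 + f'' t / 2 * s ^ 2"
    by (auto simp: d_def numeral_2_eq_2)
  have "f'' t / 2 * s\<^sup>2 \<le> M / 2 * s\<^sup>2" using assms(3)[of t] t assms(4) by (intro mult_right_mono) auto
  then show ?thesis using t by (simp add: mult.commute)
qed

lemma uniform_continuity_at_0:
  fixes a :: "real \<times> 'p::metric_space \<Rightarrow> 'q::real_normed_vector"
  assumes "compact P" "s1 > 0" "continuous_on ({-s1..s1} \<times> P) a" "\<eta> > 0"
  shows "\<exists>s0>0. s0 \<le> s1 \<and> (\<forall>\<sigma> p. \<bar>\<sigma>\<bar> \<le> s0 \<longrightarrow> p \<in> P \<longrightarrow> norm (a (\<sigma>, p) - a (0, p)) \<le> \<eta>)"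
proof -
  have "compact ({-s1..s1} \<times> P)" by (intro compact_Times assms) auto
  then have "uniformly_continuous_on ({-s1..s1} \<times> P) a" using assms compact_uniformly_continuous by blast
  then obtain d where d: "d > 0"
    "\<And>x x'. x \<in> {-s1..s1} \<times> P \<Longrightarrow> x' \<in> {-s1..s1} \<times> P \<Longrightarrow> dist x' x < d \<Longrightarrow> dist (a x') (a x) < \<eta>"
    using assms(4) unfolding uniformly_continuous_on_def by metis
  have "norm (a (\<sigma>, p) - a (0, p)) \<le> \<eta>" if "\<bar>\<sigma>\<bar> \<le> min s1 (d/2)" "p \<in> P" for \<sigma> p
  proof -
    have "dist (a (\<sigma>, p)) (a (0, p)) < \<eta>"
      using that assms(2) d(1) by (intro d(2)) (auto simp: dist_Pair_Pair dist_norm)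
    then show ?thesis by (simp add: dist_norm)
  qed
  then show ?thesis using d assms(2) by (intro exI[of _ "min s1 (d/2)"]) auto
qed

text \<open>The compact set of initial values has a uniform margin inside U, and uniform continuity
  turns it into a common s0.\<close>

lemma uniform_stay_open:
  fixes \<phi> :: "real \<times> 'p::metric_space \<Rightarrow> 'q::real_normed_vector"
  assumes "compact P" "continuous_on ({-1..1} \<times> P) \<phi>" "open U" "\<And>p. p \<in> P \<Longrightarrow> \<phi> (0, p) \<in> U"
  shows "\<exists>s0>0. s0 \<le> 1 \<and> (\<forall>\<sigma> p. \<bar>\<sigma>\<bar> \<le> s0 \<longrightarrow> p \<in> P \<longrightarrow> \<phi> (\<sigma>, p) \<in> U)"
proof -
  have cont0: "continuous_on P (\<lambda>p. \<phi> (0, p))"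
    by (rule continuous_on_compose2[OF assms(2)]) (auto intro!: continuous_intros)
  have "compact ((\<lambda>p. \<phi> (0, p)) ` P)" by (rule compact_continuous_image[OF cont0 assms(1)])
  then obtain e where e: "e > 0" "(\<Union>x\<in>(\<lambda>p. \<phi> (0, p)) ` P. ball x e) \<subseteq> U"
    using compact_subset_open_imp_ball_epsilon_subset[OF _ assms(3), of "(\<lambda>p. \<phi> (0, p)) ` P"] assms(4) by blast
  obtain s0 where s0: "s0 > 0" "s0 \<le> 1" "\<And>\<sigma> p. \<bar>\<sigma>\<bar> \<le> s0 \<Longrightarrow> p \<in> P \<Longrightarrow> norm (\<phi> (\<sigma>, p) - \<phi> (0, p)) \<le> e/2"
    using uniform_continuity_at_0[OF assms(1) _ assms(2), of "e/2"] e by auto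
  have "\<phi> (\<sigma>, p) \<in> U" if "\<bar>\<sigma>\<bar> \<le> s0" "p \<in> P" for \<sigma> p
  proof -
    have "\<phi> (\<sigma>, p) \<in> ball (\<phi> (0, p)) e" using s0(3)[OF that] e by (auto simp: dist_norm norm_minus_commute)
    then show ?thesis using e that by blast
  qed
  then show ?thesis using s0 by blast
qed

text \<open>Componentwise multiplication makes \<open>real^'n\<close> a ring, in which
  simplification can collect \<open>v + v\<close> to \<open>2 * v\<close>; this restores a scalar
  multiple.\<close>

lemma vec_two_mult: "2 * v = 2 *\<^sub>R (v :: real^'n)"
  by (simp add: vec_eq_iff)

context riem_chart begin

text \<open>Extreme values on K times the unit sphere, extended by homogeneity in v.\<close>

lemma metric_bounds:
  assumes "compact K" "K \<subseteq> U"
  obtains c C where "c > 0" "C > 0" "\<And>x v. x \<in> K \<Longrightarrow> c * (norm v)\<^sup>2 \<le> m x v v"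
    "\<And>x v. x \<in> K \<Longrightarrow> m x v v \<le> C * (norm v)\<^sup>2"
proof (cases "K = {}")
  case False
  let ?S = "K \<times> sphere (0::real^'n) 1"
  have cont: "continuous_on ?S (\<lambda>p. m (fst p) (snd p) (snd p))"
    using assms by (intro continuous_on_metric continuous_intros) auto
  have comp: "compact ?S" by (intro compact_Times assms) auto
  obtain e :: "real^'n" where "norm e = 1" using vector_choose_size[of 1] by auto
  then have ne: "?S \<noteq> {}" using False by auto
  obtain p where p: "p \<in> ?S" "\<And>q. q \<in> ?S \<Longrightarrow> m (fst p) (snd p) (snd p) \<le> m (fst q) (snd q) (snd q)"
    using continuous_attains_inf[OF comp ne cont] by blast
  obtain p' where p': "p' \<in> ?S" "\<And>q. q \<in> ?S \<Longrightarrow> m (fst q) (snd q) (snd q) \<le> m (fst p') (snd p') (snd p')"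
    using continuous_attains_sup[OF comp ne cont] by blast
  let ?c = "m (fst p) (snd p) (snd p)" and ?C = "m (fst p') (snd p') (snd p')"
  have "snd p \<noteq> 0" "snd p' \<noteq> 0" using p(1) p'(1) by auto
  then have pos: "?c > 0" "?C > 0" using p(1) p'(1) assms(2) metric_pos by auto
  have "?c * (norm v)\<^sup>2 \<le> m x v v \<and> m x v v \<le> ?C * (norm v)\<^sup>2" if "x \<in> K" for x v
  proof (cases "v = 0")
    case False
    have "(x, v /\<^sub>R norm v) \<in> ?S" using that False by simp
    from p(2)[OF this] p'(2)[OF this] show ?thesis
      using False by (simp add: metric_form_simps power2_eq_square field_simps)
  qed (simp add: metric_form_simps)
  then show ?thesis using that pos by blast
qed (use that[of 1 1] in auto)

end

section \<open>Varied curves and the expansion of their squared speed\<close>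

context riem_chart_function begin

text \<open>The \<open>Gam\<close> term cancels the Christoffel part of the covariant acceleration
  of a coordinate parabola, and the gradient term prescribes what remains. The factor 1/n makes n
  fields contribute one Hessian in total.\<close>

definition Y where "Y x e = Gam G x e e + (1 / real CARD('n)) *\<^sub>R X x"

text \<open>The curves \<open>\<sigma> \<mapsto> \<xi> x e \<alpha> \<sigma>\<close> agree to second order with the curves through \<open>x\<close> of initial velocity
  \<open>\<alpha> e\<close> and covariant acceleration \<open>-\<alpha>\<^sup>2 X / n\<close>; \<open>\<zeta>\<close> is the derivative of \<open>\<xi>\<close> along a curve with
  velocity \<open>T\<close> and parallel field \<open>e\<close>.\<close>

definition \<xi> where "\<xi> x e \<alpha> \<sigma> = x + (\<sigma> * \<alpha>) *\<^sub>R e - (\<sigma>\<^sup>2 * \<alpha>\<^sup>2 / 2) *\<^sub>R Y x e"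

definition \<zeta> where
  "\<zeta> x T e \<alpha> \<beta> \<sigma> = T + \<sigma> *\<^sub>R (\<beta> *\<^sub>R e - \<alpha> *\<^sub>R Gam G x T e) - (\<sigma>\<^sup>2 * \<alpha> * \<beta>) *\<^sub>R Y x e
    - (\<sigma>\<^sup>2 * \<alpha>\<^sup>2 / 2) *\<^sub>R (DGam G x T e e - 2 *\<^sub>R Gam G x e (Gam G x T e) + (1 / real CARD('n)) *\<^sub>R dd X x T)"

lemma \<xi>_has_derivative:
  assumes "(x has_vector_derivative T) (at t within S)" "(E has_vector_derivative - Gam G (x t) T (E t)) (at t within S)"
    "(\<alpha> has_vector_derivative \<beta>) (at t within S)" "x t \<in> U"
  shows "((\<lambda>t. \<xi> (x t) (E t) (\<alpha> t) \<sigma>) has_vector_derivative \<zeta> (x t) T (E t) (\<alpha> t) \<beta> \<sigma>) (at t within S)"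
proof -
  note d = assms(1-3)[unfolded has_vector_derivative_def]
  define Y' where "Y' h = DGam G (x t) (h *\<^sub>R T) (E t) (E t) + Gam G (x t) (h *\<^sub>R - Gam G (x t) T (E t)) (E t)
           + Gam G (x t) (E t) (h *\<^sub>R - Gam G (x t) T (E t)) + (1 / real CARD('n)) *\<^sub>R dd X (x t) (h *\<^sub>R T)" for h
  have dY: "((\<lambda>t. Y (x t) (E t)) has_derivative Y') (at t within S)"
    unfolding Y_def Y'_def
    by (intro has_derivative_add has_derivative_Gam has_derivative_scaleR_right d assms(4)
        has_derivative_compose[OF d(1) smooth_on_has_derivative[OF smooth_X assms(4)]])
  have d\<alpha>: "((\<lambda>t. \<sigma>\<^sup>2 * (\<alpha> t)\<^sup>2 / 2) has_derivative (\<lambda>h. \<sigma>\<^sup>2 * (\<alpha> t * (h *\<^sub>R \<beta>)))) (at t within S)"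
  proof -
    have "((\<lambda>t. (\<sigma>\<^sup>2 / 2) * (\<alpha> t * \<alpha> t)) has_derivative
       (\<lambda>h. (\<sigma>\<^sup>2 / 2) * (\<alpha> t * (h *\<^sub>R \<beta>) + (h *\<^sub>R \<beta>) * \<alpha> t))) (at t within S)"
      by (intro has_derivative_mult_right has_derivative_mult d)
    moreover have "(\<lambda>t. (\<sigma>\<^sup>2 / 2) * (\<alpha> t * \<alpha> t)) = (\<lambda>t. \<sigma>\<^sup>2 * (\<alpha> t)\<^sup>2 / 2)"
      "(\<lambda>h. (\<sigma>\<^sup>2 / 2) * (\<alpha> t * (h *\<^sub>R \<beta>) + (h *\<^sub>R \<beta>) * \<alpha> t)) = (\<lambda>h. \<sigma>\<^sup>2 * (\<alpha> t * (h *\<^sub>R \<beta>)))"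
      by (simp_all add: fun_eq_iff power2_eq_square algebra_simps)
    ultimately show ?thesis by simp
  qed
  have "((\<lambda>t. \<xi> (x t) (E t) (\<alpha> t) \<sigma>) has_derivative
     (\<lambda>h. h *\<^sub>R T + ((\<sigma> * \<alpha> t) *\<^sub>R (h *\<^sub>R - Gam G (x t) T (E t)) + (\<sigma> * (h *\<^sub>R \<beta>)) *\<^sub>R E t)
       - ((\<sigma>\<^sup>2 * (\<alpha> t)\<^sup>2 / 2) *\<^sub>R Y' h + (\<sigma>\<^sup>2 * (\<alpha> t * (h *\<^sub>R \<beta>))) *\<^sub>R Y (x t) (E t)))) (at t within S)"
    unfolding \<xi>_def
    by (intro has_derivative_diff has_derivative_add has_derivative_scaleR has_derivative_mult_right d\<alpha> d dY)
  then show ?thesis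
    unfolding has_vector_derivative_def
    by (rule has_derivative_eq_rhs)
      (auto simp: fun_eq_iff \<zeta>_def Y'_def Gam_simps vec_two_mult DGam_simps[OF assms(4)] linear_scale[OF dd_linear(1)[OF smooth_X assms(4)]]
        Gam_sym[OF assms(4), of "Gam G (x t) T (E t)" "E t"] algebra_simps)
qed

text \<open>Homogeneity in the velocity: estimates for |T| <= 1 carry over to the original parameter
  of a curve, with the derivative of the new parameter as the factor.\<close>

lemma \<zeta>_scale:
  assumes "x \<in> U" shows "\<zeta> x (c *\<^sub>R T) e \<alpha> (c * \<beta>) \<sigma> = c *\<^sub>R \<zeta> x T e \<alpha> \<beta> \<sigma>"
  by (simp add: \<zeta>_def Gam_simps DGam_simps[OF assms] linear_scale[OF dd_linear(1)[OF smooth_X assms]] algebra_simps)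

text \<open>The second variation of energy; \<open>\<langle>R(e,T)e,T\<rangle>\<close> is minus a sectional curvature.\<close>

definition sv where
  "sv x T e \<alpha> \<beta> = \<beta>\<^sup>2 + \<alpha>\<^sup>2 * m x (Rm G x e T e) T
     - (1 / real CARD('n)) * (2 * \<alpha> * \<beta> * m x (X x) T + \<alpha>\<^sup>2 * m x (H x T) T)"

text \<open>Taylor's formula of order two in \<sigma>. The remainder is uniform because the second
  derivative is continuous on the compact set of all data (x, T, e, \<alpha>, \<beta>).\<close>

lemma second_variation:
  assumes "compact K" "K \<subseteq> U" "\<eta> > 0" "C \<ge> 0" "B \<ge> 0"
  shows "\<exists>s0>0. \<forall>\<sigma> x T e \<alpha> \<beta>. \<bar>\<sigma>\<bar> \<le> s0 \<longrightarrow> x \<in> K \<longrightarrow> norm T \<le> C \<longrightarrow> norm e \<le> C \<longrightarrow> m x e e = 1 \<longrightarrow>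
     \<bar>\<alpha>\<bar> \<le> 1 \<longrightarrow> \<bar>\<beta>\<bar> \<le> B \<longrightarrow>
     \<xi> x e \<alpha> \<sigma> \<in> U \<and>
     m (\<xi> x e \<alpha> \<sigma>) (\<zeta> x T e \<alpha> \<beta> \<sigma>) (\<zeta> x T e \<alpha> \<beta> \<sigma>) \<le> m x T T + 2 * \<sigma> * (\<beta> * m x e T) + \<sigma>\<^sup>2 * (sv x T e \<alpha> \<beta> + \<eta>)"
proof -
  define P where "P = K \<times> cball (0::real^'n) C \<times> cball (0::real^'n) C \<times> {-1..1::real} \<times> {-B..B}"
  have "compact P" unfolding P_def by (intro compact_Times assms) auto
  define x where "x = (\<lambda>p::(real^'n) \<times> (real^'n) \<times> (real^'n) \<times> real \<times> real. fst p)"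
  define T where "T = (\<lambda>p::(real^'n) \<times> (real^'n) \<times> (real^'n) \<times> real \<times> real. fst (snd p))"
  define e where "e = (\<lambda>p::(real^'n) \<times> (real^'n) \<times> (real^'n) \<times> real \<times> real. fst (snd (snd p)))"
  define \<alpha> where "\<alpha> = (\<lambda>p::(real^'n) \<times> (real^'n) \<times> (real^'n) \<times> real \<times> real. fst (snd (snd (snd p))))"
  define \<beta> where "\<beta> = (\<lambda>p::(real^'n) \<times> (real^'n) \<times> (real^'n) \<times> real \<times> real. snd (snd (snd (snd p))))"
  define \<phi> where "\<phi> = (\<lambda>q. \<xi> (x (snd q)) (e (snd q)) (\<alpha> (snd q)) (fst q))"
  have cont [continuous_intros]: "continuous_on S (\<lambda>q. x (w q))" "continuous_on S (\<lambda>q. T (w q))" "continuous_on S (\<lambda>q. e (w q))"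
    "continuous_on S (\<lambda>q. \<alpha> (w q))" "continuous_on S (\<lambda>q. \<beta> (w q))" if "continuous_on S w" for S :: "(real \<times> _) set" and w
    unfolding x_def T_def e_def \<alpha>_def \<beta>_def using that by (auto intro!: continuous_intros)
  have xK: "x p \<in> U" if "p \<in> P" for p using that assms(2) by (auto simp: P_def x_def)
  have contX: "continuous_on S (\<lambda>q. X (x (snd q)))" if "S \<subseteq> UNIV \<times> P" for S :: "(real \<times> _) set"
    by (rule continuous_on_compose2[OF smooth_on_continuous[OF smooth_X]]) (use that xK in \<open>auto intro!: continuous_intros\<close>)
  have contY: "continuous_on S (\<lambda>q. Y (x (snd q)) (e (snd q)))" if "S \<subseteq> UNIV \<times> P" for S :: "(real \<times> _) set"
    unfolding Y_def by (intro continuous_intros continuous_on_Gam contX that) (use that xK in auto)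
  have cont\<phi>: "continuous_on S \<phi>" if "S \<subseteq> UNIV \<times> P" for S
    unfolding \<phi>_def \<xi>_def by (intro continuous_intros contY that) simp_all
  obtain s1 where s1: "s1 > 0" "s1 \<le> 1" "\<And>\<sigma> p. \<bar>\<sigma>\<bar> \<le> s1 \<Longrightarrow> p \<in> P \<Longrightarrow> \<phi> (\<sigma>, p) \<in> U"
    using uniform_stay_open[OF \<open>compact P\<close> cont\<phi> open_U] xK by (force simp: \<phi>_def \<xi>_def)
  define V1 where "V1 = (\<lambda>p. \<beta> p *\<^sub>R e p - \<alpha> p *\<^sub>R Gam G (x p) (T p) (e p))"
  define Z where "Z = (\<lambda>p. - ((\<alpha> p)\<^sup>2 / 2) *\<^sub>R Y (x p) (e p))"
  define Z1 where "Z1 = (\<lambda>p. - (\<alpha> p * \<beta> p) *\<^sub>R Y (x p) (e p)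
    - ((\<alpha> p)\<^sup>2 / 2) *\<^sub>R (DGam G (x p) (T p) (e p) (e p) - 2 *\<^sub>R Gam G (x p) (e p) (Gam G (x p) (T p) (e p)) + (1 / real CARD('n)) *\<^sub>R dd X (x p) (T p)))"
  define y where "y = (\<lambda>q. \<zeta> (x (snd q)) (T (snd q)) (e (snd q)) (\<alpha> (snd q)) (\<beta> (snd q)) (fst q))"
  have \<phi>_eq: "\<phi> (\<sigma>, p) = x p + \<sigma> *\<^sub>R (\<alpha> p *\<^sub>R e p) + \<sigma>\<^sup>2 *\<^sub>R Z p" for \<sigma> p
    by (simp add: \<phi>_def \<xi>_def Z_def)
  have y_eq: "y (\<sigma>, p) = T p + \<sigma> *\<^sub>R V1 p + \<sigma>\<^sup>2 *\<^sub>R Z1 p" for \<sigma> p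
    by (simp add: y_def \<zeta>_def V1_def Z1_def algebra_simps)
  define \<phi>' where "\<phi>' = (\<lambda>q. \<alpha> (snd q) *\<^sub>R e (snd q) + (2 * fst q) *\<^sub>R Z (snd q))"
  define y' where "y' = (\<lambda>q. V1 (snd q) + (2 * fst q) *\<^sub>R Z1 (snd q))"
  \<comment> \<open>Derivatives in \<sigma>: \<open>w\<close> is the covariant derivative of the
    velocity \<open>y\<close>, and \<open>w'\<close> the coordinate derivative of \<open>w\<close>;
    metric compatibility then makes \<open>A1\<close> and \<open>A2\<close> the derivatives of
    \<open>A\<close>.\<close>
  define w where "w = (\<lambda>q. y' q + Gam G (\<phi> q) (\<phi>' q) (y q))"
  define w' where "w' = (\<lambda>q. 2 *\<^sub>R Z1 (snd q) + (DGam G (\<phi> q) (\<phi>' q) (\<phi>' q) (y q) + Gam G (\<phi> q) (2 *\<^sub>R Z (snd q)) (y q) + Gam G (\<phi> q) (\<phi>' q) (y' q)))"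
  define A where "A = (\<lambda>q. m (\<phi> q) (y q) (y q))"
  define A1 where "A1 = (\<lambda>q. 2 * m (\<phi> q) (w q) (y q))"
  define A2 where "A2 = (\<lambda>q. 2 * (m (\<phi> q) (w' q + Gam G (\<phi> q) (\<phi>' q) (w q)) (y q) + m (\<phi> q) (w q) (w q)))"
  have d\<phi>: "((\<lambda>\<sigma>. \<phi> (\<sigma>, p)) has_derivative (\<lambda>h. h *\<^sub>R \<phi>' (\<sigma>, p))) (at \<sigma>)" for \<sigma> p
    unfolding \<phi>_eq \<phi>'_def by (rule derivative_eq_intros refl)+ (simp add: algebra_simps)
  have d\<phi>': "((\<lambda>\<sigma>. \<phi>' (\<sigma>, p)) has_derivative (\<lambda>h. h *\<^sub>R (2 *\<^sub>R Z p))) (at \<sigma>)" for \<sigma> p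
    unfolding \<phi>'_def fst_conv snd_conv by (rule derivative_eq_intros refl)+ (simp add: algebra_simps)
  have dy: "((\<lambda>\<sigma>. y (\<sigma>, p)) has_derivative (\<lambda>h. h *\<^sub>R y' (\<sigma>, p))) (at \<sigma>)" for \<sigma> p
    unfolding y_eq y'_def by (rule derivative_eq_intros refl)+ (simp add: algebra_simps)
  have dy': "((\<lambda>\<sigma>. y' (\<sigma>, p)) has_derivative (\<lambda>h. h *\<^sub>R (2 *\<^sub>R Z1 p))) (at \<sigma>)" for \<sigma> p
    unfolding y'_def fst_conv snd_conv by (rule derivative_eq_intros refl)+ (simp add: algebra_simps)
  have dw: "((\<lambda>\<sigma>. w (\<sigma>, p)) has_derivative (\<lambda>h. h *\<^sub>R w' (\<sigma>, p))) (at \<sigma>)" if "\<phi> (\<sigma>, p) \<in> U" for \<sigma> p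
  proof -
    have "((\<lambda>\<sigma>. w (\<sigma>, p)) has_derivative (\<lambda>h. h *\<^sub>R (2 *\<^sub>R Z1 p) +
       (DGam G (\<phi> (\<sigma>,p)) (h *\<^sub>R \<phi>' (\<sigma>,p)) (\<phi>' (\<sigma>,p)) (y (\<sigma>,p)) + Gam G (\<phi> (\<sigma>,p)) (h *\<^sub>R (2 *\<^sub>R Z p)) (y (\<sigma>,p))
       + Gam G (\<phi> (\<sigma>,p)) (\<phi>' (\<sigma>,p)) (h *\<^sub>R y' (\<sigma>,p))))) (at \<sigma>)"
      unfolding w_def by (intro has_derivative_add dy' has_derivative_Gam d\<phi> d\<phi>' dy that)
    then show ?thesis
      by (rule has_derivative_eq_rhs) (auto simp: fun_eq_iff w'_def Gam_simps DGam_simps[OF that] algebra_simps)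
  qed
  have dA: "((\<lambda>\<sigma>. A (\<sigma>, p)) has_real_derivative A1 (\<sigma>, p)) (at \<sigma>)" if "\<phi> (\<sigma>, p) \<in> U" for \<sigma> p
  proof -
    have "((\<lambda>\<sigma>. A (\<sigma>, p)) has_derivative (\<lambda>h.
        m (\<phi> (\<sigma>,p)) (h *\<^sub>R y' (\<sigma>,p) + Gam G (\<phi> (\<sigma>,p)) (h *\<^sub>R \<phi>' (\<sigma>,p)) (y (\<sigma>,p))) (y (\<sigma>,p))
      + m (\<phi> (\<sigma>,p)) (y (\<sigma>,p)) (h *\<^sub>R y' (\<sigma>,p) + Gam G (\<phi> (\<sigma>,p)) (h *\<^sub>R \<phi>' (\<sigma>,p)) (y (\<sigma>,p))))) (at \<sigma>)"
      unfolding A_def by (intro has_derivative_metric d\<phi> dy that)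
    then show ?thesis unfolding has_field_derivative_def
      by (rule has_derivative_eq_rhs)
        (auto simp: fun_eq_iff A1_def w_def Gam_simps metric_form_simps metric_sym[OF that, of "y (\<sigma>,p)"] algebra_simps)
  qed
  have dA1: "((\<lambda>\<sigma>. A1 (\<sigma>, p)) has_real_derivative A2 (\<sigma>, p)) (at \<sigma>)" if "\<phi> (\<sigma>, p) \<in> U" for \<sigma> p
  proof -
    have "((\<lambda>\<sigma>. A1 (\<sigma>, p)) has_derivative (\<lambda>h. 2 *
       (m (\<phi> (\<sigma>,p)) (h *\<^sub>R w' (\<sigma>,p) + Gam G (\<phi> (\<sigma>,p)) (h *\<^sub>R \<phi>' (\<sigma>,p)) (w (\<sigma>,p))) (y (\<sigma>,p))
      + m (\<phi> (\<sigma>,p)) (w (\<sigma>,p)) (h *\<^sub>R y' (\<sigma>,p) + Gam G (\<phi> (\<sigma>,p)) (h *\<^sub>R \<phi>' (\<sigma>,p)) (y (\<sigma>,p)))))) (at \<sigma>)"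
      unfolding A1_def by (intro has_derivative_mult_right has_derivative_metric d\<phi> dy dw that)
    then show ?thesis unfolding has_field_derivative_def
      by (rule has_derivative_eq_rhs)
        (auto simp: fun_eq_iff A2_def w_def Gam_simps metric_form_simps algebra_simps)
  qed
  let ?S = "{-s1..s1} \<times> P"
  have S\<phi>: "\<phi> q \<in> U" if "q \<in> ?S" for q using s1(3)[of "fst q" "snd q"] that by auto
  have Sx: "x (snd q) \<in> U" if "q \<in> ?S" for q using xK that by auto
  have sub: "?S \<subseteq> UNIV \<times> P" by auto
  have cZ: "continuous_on ?S (\<lambda>q. Z (snd q))" unfolding Z_def by (intro continuous_intros contY sub) simp_all
  have cG: "continuous_on ?S (\<lambda>q. Gam G (x (snd q)) (T (snd q)) (e (snd q)))" by (intro continuous_on_Gam continuous_intros Sx)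
  have cZ1: "continuous_on ?S (\<lambda>q. Z1 (snd q))" unfolding Z1_def
    by (intro continuous_intros contY sub continuous_on_DGam continuous_on_Gam continuous_on_dd[OF smooth_X] Sx) simp_all
  have cV1: "continuous_on ?S (\<lambda>q. V1 (snd q))" unfolding V1_def by (intro continuous_intros cG)
  have y_eq': "y = (\<lambda>q. T (snd q) + fst q *\<^sub>R V1 (snd q) + (fst q)\<^sup>2 *\<^sub>R Z1 (snd q))"
    using y_eq by (auto simp: fun_eq_iff)
  have cy: "continuous_on ?S y" unfolding y_eq' by (intro continuous_intros cZ1 cV1)
  have cy': "continuous_on ?S y'" unfolding y'_def by (intro continuous_intros cZ1 cV1)
  have c\<phi>': "continuous_on ?S \<phi>'" unfolding \<phi>'_def by (intro continuous_intros cZ)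
  have cw: "continuous_on ?S w" unfolding w_def by (intro continuous_on_add cy' continuous_on_Gam cont\<phi> sub c\<phi>' cy S\<phi>)
  have cw': "continuous_on ?S w'" unfolding w'_def
    by (intro continuous_on_add continuous_on_scaleR continuous_on_const cZ cZ1 continuous_on_DGam continuous_on_Gam cont\<phi> sub c\<phi>' cy cy' S\<phi>)
  have cA2: "continuous_on ?S A2" unfolding A2_def
    by (intro continuous_on_mult continuous_on_const continuous_on_add continuous_on_metric cont\<phi> sub cw cw' cy c\<phi>' continuous_on_Gam S\<phi>)
  \<comment> \<open>An error of 2 \<eta> in the second derivative is halved by the Taylor
    coefficient.\<close>
  obtain s0 where s0: "s0 > 0" "s0 \<le> s1" "\<And>\<sigma> p. \<bar>\<sigma>\<bar> \<le> s0 \<Longrightarrow> p \<in> P \<Longrightarrow> norm (A2 (\<sigma>, p) - A2 (0, p)) \<le> 2 * \<eta>"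
    using uniform_continuity_at_0[OF \<open>compact P\<close> s1(1) cA2, of "2 * \<eta>"] assms(3) by auto
  have "\<xi> xx ee aa \<sigma> \<in> U \<and> m (\<xi> xx ee aa \<sigma>) (\<zeta> xx TT ee aa bb \<sigma>) (\<zeta> xx TT ee aa bb \<sigma>)
       \<le> m xx TT TT + 2 * \<sigma> * (bb * m xx ee TT) + \<sigma>\<^sup>2 * (sv xx TT ee aa bb + \<eta>)"
    if h: "\<bar>\<sigma>\<bar> \<le> s0" "xx \<in> K" "norm TT \<le> C" "norm ee \<le> C" "m xx ee ee = 1" "\<bar>aa\<bar> \<le> 1" "\<bar>bb\<bar> \<le> B" for \<sigma> xx TT ee aa bb
  proof -
    define p where "p = (xx, TT, ee, aa, bb)"
    have pP: "p \<in> P" using h by (auto simp: p_def P_def)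
    have pv: "x p = xx" "T p = TT" "e p = ee" "\<alpha> p = aa" "\<beta> p = bb"
      by (simp_all add: p_def x_def T_def e_def \<alpha>_def \<beta>_def)
    have xU: "xx \<in> U" using h assms by auto
    have inU: "\<phi> (t, p) \<in> U" if "\<bar>t\<bar> \<le> s0" for t using s1(3) s0(2) that pP by auto
    have \<phi>0: "\<phi> (0, p) = xx" "\<phi>' (0, p) = aa *\<^sub>R ee" "y (0, p) = TT" "y' (0, p) = bb *\<^sub>R ee - aa *\<^sub>R Gam G xx TT ee"
      by (simp_all add: \<phi>_eq y_eq \<phi>'_def y'_def pv V1_def)
    \<comment> \<open>As e is parallel, the varied velocity changes to first order by \<beta> e
      only; the \<open>Gam\<close> terms cancel by symmetry.\<close>
    have w0: "w (0, p) = bb *\<^sub>R ee" by (simp add: w_def \<phi>0 Gam_simps Gam_sym[OF xU, of ee TT])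
    have DGs: "DGam G xx ee ee TT = DGam G xx ee TT ee"
    proof -
      have "dd (\<lambda>y. Gam G y ee TT) xx = dd (\<lambda>y. Gam G y TT ee) xx"
        by (rule frechet_derivative_cong_open[OF open_U xU]) (rule Gam_sym)
      then show ?thesis by (simp add: DGam_def)
    qed
    \<comment> \<open>Exchanging the two covariant derivatives produces the curvature; the rest is
      the covariant derivative along T of the prescribed acceleration - \<alpha>^2 X / n.\<close>
    have w'0: "w' (0, p) + Gam G xx (aa *\<^sub>R ee) (w (0, p)) =
       aa\<^sup>2 *\<^sub>R Rm G xx ee TT ee - (1 / real CARD('n)) *\<^sub>R ((2 * aa * bb) *\<^sub>R X xx + aa\<^sup>2 *\<^sub>R H xx TT)"
      by (simp add: w'_def \<phi>0 w0 Z1_def Z_def pv Y_def Rm_def nabla_def Gam_simps DGam_simps[OF xU] DGs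
         Gam_sym[OF xU, of _ TT] algebra_simps power2_eq_square)
        (simp add: vec_two_mult ac_simps)
    have A20: "A2 (0, p) = 2 * sv xx TT ee aa bb"
      unfolding A2_def \<phi>0 w0 w'0[unfolded w0] by (simp add: sv_def metric_form_simps h(5) power2_eq_square algebra_simps)
    have "A (\<sigma>, p) \<le> A (0, p) + \<sigma> * A1 (0, p) + \<sigma>\<^sup>2 / 2 * (A2 (0, p) + 2 * \<eta>)"
    proof (rule taylor2_le[where r = s0])
      fix t assume "\<bar>t\<bar> \<le> s0"
      then show "A2 (t, p) \<le> A2 (0, p) + 2 * \<eta>" using s0(3)[OF _ pP, of t] by auto
    qed (use h(1) inU dA dA1 in auto)
    moreover have "A (0, p) = m xx TT TT" "A1 (0, p) = 2 * (bb * m xx ee TT)"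
      by (simp_all add: A_def A1_def \<phi>0 w0 metric_form_simps)
    moreover have "A (\<sigma>, p) = m (\<xi> xx ee aa \<sigma>) (\<zeta> xx TT ee aa bb \<sigma>) (\<zeta> xx TT ee aa bb \<sigma>)" "\<phi> (\<sigma>, p) = \<xi> xx ee aa \<sigma>"
      by (simp_all add: A_def \<phi>_def y_def pv)
    ultimately show ?thesis using inU[OF h(1)] A20 by (simp add: algebra_simps)
  qed
  then show ?thesis using s0 by blast
qed

end

section \<open>Averaging over an orthonormal frame\<close>

context soliton_chart begin

text \<open>The curvature terms add up to - Ric(T,T) by skew-symmetry and the n acceleration terms
  supply - Hess F(T,T); the soliton equation evaluates both together.\<close>

lemma sum_sv:
  assumes "x \<in> U" "orthonormal_frame G x E"
  shows "(\<Sum>a\<in>UNIV. sv x T (E a) \<alpha> \<beta>) = real CARD('n) * \<beta>\<^sup>2 - l * \<alpha>\<^sup>2 * m x T T - 2 * \<alpha> * \<beta> * dd F x T"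
proof -
  have "(\<Sum>a\<in>UNIV. m x (Rm G x (E a) T (E a)) T) = - ricci G x T T"
    unfolding Rm_skew[OF assms(1), of _ T _ T] ricci_frame[OF assms]
    using metric_sym[OF assms(1)] by (simp add: sum_negf)
  moreover have "(\<Sum>a\<in>UNIV. sv x T (E a) \<alpha> \<beta>) = real CARD('n) * \<beta>\<^sup>2 + \<alpha>\<^sup>2 * (\<Sum>a\<in>UNIV. m x (Rm G x (E a) T (E a)) T)
     - (2 * \<alpha> * \<beta> * m x (X x) T + \<alpha>\<^sup>2 * m x (H x T) T)"
    by (simp add: sv_def sum.distrib sum_subtractf sum_distrib_left)
  moreover have "\<alpha>\<^sup>2 * (ricci G x T T + m x (H x T) T) = \<alpha>\<^sup>2 * (l * m x T T)"
    using soliton[OF assms(1), of T T] by (simp add: hessian_H)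
  ultimately show ?thesis by (simp add: metric_gradient[OF assms(1)] algebra_simps)
qed

definition mean_speed where
  "mean_speed x T E \<alpha> \<beta> s =
     (\<Sum>a\<in>UNIV. sqrt (m (\<xi> x (E a) \<alpha> s) (\<zeta> x T (E a) \<alpha> \<beta> s) (\<zeta> x T (E a) \<alpha> \<beta> s))
       + sqrt (m (\<xi> x (E a) \<alpha> (- s)) (\<zeta> x T (E a) \<alpha> \<beta> (- s)) (\<zeta> x T (E a) \<alpha> \<beta> (- s)))) / (2 * real CARD('n))"

text \<open>The frame has \<open>n\<close> members, but the square root removes the tangential contribution
  \<open>\<beta>\<^sup>2 |T|\<^sup>2\<close>, so that for unit speed \<open>n - 1\<close> remains.\<close>

definition mean_speed_bound where
  "mean_speed_bound B \<eta> s x \<longleftrightarrow> (\<forall>T E \<alpha> \<beta>. m x T T \<le> 1 \<longrightarrow> orthonormal_frame G x E \<longrightarrow> \<bar>\<alpha>\<bar> \<le> 1 \<longrightarrow> \<bar>\<beta>\<bar> \<le> B \<longrightarrow>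
     (\<forall>a. \<xi> x (E a) \<alpha> s \<in> U \<and> \<xi> x (E a) \<alpha> (- s) \<in> U) \<and>
     mean_speed x T E \<alpha> \<beta> s
     \<le> 1 + s\<^sup>2 / (2 * real CARD('n)) * (real CARD('n) * \<beta>\<^sup>2 - (\<beta>\<^sup>2 + l * \<alpha>\<^sup>2) * m x T T - 2 * \<alpha> * \<beta> * dd F x T + \<eta>))"

text \<open>Second variation and square root expansion are both uniform over K and over bounded
  data, so one s0 serves all points, frames and velocities.\<close>

lemma mean_speed_bound_uniform:
  assumes "compact K" "K \<subseteq> U" "\<eta> > 0" "B \<ge> 0"
  shows "\<exists>s0>0. \<forall>s x. 0 < s \<longrightarrow> s \<le> s0 \<longrightarrow> x \<in> K \<longrightarrow> mean_speed_bound B \<eta> s x"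
proof -
  let ?n = "real CARD('n)"
  \<comment> \<open>Two errors, one of the second variation and one of the square root, for each of
    the n frame vectors.\<close>
  define \<eta>' where "\<eta>' = \<eta> / (2 * ?n)"
  have \<eta>': "\<eta>' > 0" using assms(3) by (simp add: \<eta>'_def)
  obtain c where c: "c > 0" "\<And>x v. x \<in> K \<Longrightarrow> c * (norm v)\<^sup>2 \<le> m x v v"
    using metric_bounds[OF assms(1,2)] by metis
  define C where "C = 1 / sqrt c"
  have nC: "norm v \<le> C" if "x \<in> K" "m x v v \<le> 1" for x v
  proof -
    have "c * (norm v)\<^sup>2 \<le> 1" using c(2)[OF that(1), of v] that(2) by simp
    then have "(norm v)\<^sup>2 \<le> 1 / c" using c(1) by (simp add: field_simps)
    then show ?thesis unfolding C_def using real_le_rsqrt real_sqrt_divide by fastforce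
  qed
  have "C \<ge> 0" using c by (simp add: C_def)
  define P where "P = K \<times> cball (0::real^'n) C \<times> cball (0::real^'n) C \<times> {-1..1::real} \<times> {-B..B}"
  have "compact P" unfolding P_def by (intro compact_Times assms) auto
  have "continuous_on P (\<lambda>(x, T, e, \<alpha>, \<beta>). sv x T e \<alpha> \<beta>)"
    unfolding sv_def case_prod_unfold Rm_def nabla_def
    by (intro continuous_intros continuous_on_metric continuous_on_Gam continuous_on_DGam continuous_on_dd[OF smooth_X]
       continuous_on_compose2[OF smooth_on_continuous[OF smooth_X]]) (use assms(2) in \<open>auto simp: P_def\<close>)
  then have "bounded ((\<lambda>(x, T, e, \<alpha>, \<beta>). sv x T e \<alpha> \<beta>) ` P)"
    using \<open>compact P\<close> compact_continuous_image compact_imp_bounded by blast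
  then obtain D where D: "\<And>p. p \<in> P \<Longrightarrow> norm ((\<lambda>(x, T, e, \<alpha>, \<beta>). sv x T e \<alpha> \<beta>) p) \<le> D"
    unfolding bounded_iff by blast
  \<comment> \<open>Bounds both coefficients passed to the square root estimate: the first order one
    by B, the second order one by |D| + \<eta>'.\<close>
  define C' where "C' = \<bar>D\<bar> + \<eta>' + B + 1"
  have C': "C' > 0" using \<eta>' assms(4) by (simp add: C'_def)
  obtain s1 where s1: "s1 > 0" and s1': "\<And>\<sigma> x T e \<alpha> \<beta>. \<bar>\<sigma>\<bar> \<le> s1 \<Longrightarrow> x \<in> K \<Longrightarrow> norm T \<le> C \<Longrightarrow> norm e \<le> C \<Longrightarrow> m x e e = 1 \<Longrightarrow>
     \<bar>\<alpha>\<bar> \<le> 1 \<Longrightarrow> \<bar>\<beta>\<bar> \<le> B \<Longrightarrow> \<xi> x e \<alpha> \<sigma> \<in> U \<and>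
     m (\<xi> x e \<alpha> \<sigma>) (\<zeta> x T e \<alpha> \<beta> \<sigma>) (\<zeta> x T e \<alpha> \<beta> \<sigma>) \<le> m x T T + 2 * \<sigma> * (\<beta> * m x e T) + \<sigma>\<^sup>2 * (sv x T e \<alpha> \<beta> + \<eta>')"
    using second_variation[OF assms(1,2) \<eta>' \<open>C \<ge> 0\<close> assms(4)] by blast
  obtain s2 where s2: "s2 > 0" and s2': "\<And>s b q p r. 0 < s \<Longrightarrow> s \<le> s2 \<Longrightarrow> \<bar>b\<bar> \<le> C' \<Longrightarrow> \<bar>q\<bar> \<le> C' \<Longrightarrow> 0 \<le> p \<Longrightarrow> 0 \<le> r \<Longrightarrow>
     p \<le> 1 + 2 * s * b + s\<^sup>2 * q \<Longrightarrow> r \<le> 1 - 2 * s * b + s\<^sup>2 * q \<Longrightarrow>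
     (sqrt p + sqrt r) / 2 \<le> 1 + s\<^sup>2 / 2 * (q - b\<^sup>2 + \<eta>')"
    using sqrt_average_uniform[OF C' \<eta>'] by blast
  show ?thesis
    unfolding mean_speed_bound_def
  proof (intro exI[of _ "min s1 s2"] conjI allI impI)
    fix s :: real and x T :: "real^'n" and E and \<alpha> \<beta> :: real
    assume h: "0 < s" "s \<le> min s1 s2" "x \<in> K" "m x T T \<le> 1" "orthonormal_frame G x E" "\<bar>\<alpha>\<bar> \<le> 1" "\<bar>\<beta>\<bar> \<le> B"
    have xU: "x \<in> U" using h assms by auto
    have E1: "m x (E a) (E a) = 1" for a using h(5) by (simp add: orthonormal_frame_def)
    have sy: "m x (E a) T = m x T (E a)" for a by (rule metric_sym[OF xU])
    have nT: "norm T \<le> C" and nE: "norm (E a) \<le> C" for a using nC[OF h(3)] h(4) E1 by auto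
    have ps: "\<bar>s\<bar> \<le> s1" "\<bar>- s\<bar> \<le> s1" using h by auto
    note P1 = s1'[of s x T "E _" \<alpha> \<beta>, OF ps(1) h(3) nT nE E1 h(6,7)]
      and P2 = s1'[of "- s" x T "E _" \<alpha> \<beta>, OF ps(2) h(3) nT nE E1 h(6,7)]
    show inU1: "\<xi> x (E a) \<alpha> s \<in> U" for a using P1 by blast
    show inU2: "\<xi> x (E a) \<alpha> (- s) \<in> U" for a using P2 by blast
    have pos: "m y v v \<ge> 0" if "y \<in> U" for y v using metric_pos[OF that, of v] by (cases "v = 0") (auto simp: metric_form_simps)
    have one: "(sqrt (m (\<xi> x (E a) \<alpha> s) (\<zeta> x T (E a) \<alpha> \<beta> s) (\<zeta> x T (E a) \<alpha> \<beta> s))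
               + sqrt (m (\<xi> x (E a) \<alpha> (- s)) (\<zeta> x T (E a) \<alpha> \<beta> (- s)) (\<zeta> x T (E a) \<alpha> \<beta> (- s)))) / 2
       \<le> 1 + s\<^sup>2 / 2 * ((sv x T (E a) \<alpha> \<beta> + \<eta>') - (\<beta> * m x (E a) T)\<^sup>2 + \<eta>')" for a
    proof (rule s2')
      have "(m x T (E a))\<^sup>2 \<le> (\<Sum>b\<in>UNIV. (m x T (E b))\<^sup>2)" by (rule member_le_sum) auto
      then have "(m x (E a) T)\<^sup>2 \<le> 1" using frame_norm[OF xU h(5), of T] h(4) by (simp add: sy)
      then have "\<bar>m x (E a) T\<bar> \<le> 1" by (simp add: abs_square_le_1)
      then have "\<bar>\<beta> * m x (E a) T\<bar> \<le> B * 1" unfolding abs_mult using h(7) by (intro mult_mono) auto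
      then show "\<bar>\<beta> * m x (E a) T\<bar> \<le> C'" using \<eta>' by (simp add: C'_def)
      have "(x, T, E a, \<alpha>, \<beta>) \<in> P" using h nT nE by (auto simp: P_def)
      from D[OF this] show "\<bar>sv x T (E a) \<alpha> \<beta> + \<eta>'\<bar> \<le> C'" using \<eta>' assms(4) by (simp add: C'_def)
      \<comment> \<open>The leading term |T|^2 is replaced by its upper bound 1; the velocity may be
        shorter.\<close>
      show "m (\<xi> x (E a) \<alpha> s) (\<zeta> x T (E a) \<alpha> \<beta> s) (\<zeta> x T (E a) \<alpha> \<beta> s) \<le> 1 + 2 * s * (\<beta> * m x (E a) T) + s\<^sup>2 * (sv x T (E a) \<alpha> \<beta> + \<eta>')"
        using P1[of a] h(4) by linarith
      show "m (\<xi> x (E a) \<alpha> (- s)) (\<zeta> x T (E a) \<alpha> \<beta> (- s)) (\<zeta> x T (E a) \<alpha> \<beta> (- s)) \<le> 1 - 2 * s * (\<beta> * m x (E a) T) + s\<^sup>2 * (sv x T (E a) \<alpha> \<beta> + \<eta>')"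
        using P2[of a] h(4) by simp
    qed (use h pos inU1 inU2 in auto)
    have "(\<Sum>a\<in>UNIV. sqrt (m (\<xi> x (E a) \<alpha> s) (\<zeta> x T (E a) \<alpha> \<beta> s) (\<zeta> x T (E a) \<alpha> \<beta> s))
               + sqrt (m (\<xi> x (E a) \<alpha> (- s)) (\<zeta> x T (E a) \<alpha> \<beta> (- s)) (\<zeta> x T (E a) \<alpha> \<beta> (- s)))) / 2
       \<le> (\<Sum>a\<in>UNIV. 1 + s\<^sup>2 / 2 * ((sv x T (E a) \<alpha> \<beta> + \<eta>') - (\<beta> * m x (E a) T)\<^sup>2 + \<eta>'))"
      unfolding sum_divide_distrib by (intro sum_mono one)
    \<comment> \<open>The subtracted squares are summed by Parseval's identity, \<beta>^2 times the
      squared length of T in the end.\<close>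
    also have "\<dots> = ?n + s\<^sup>2 / 2 * ((\<Sum>a\<in>UNIV. sv x T (E a) \<alpha> \<beta>) - \<beta>\<^sup>2 * (\<Sum>a\<in>UNIV. (m x T (E a))\<^sup>2) + 2 * ?n * \<eta>')"
      by (simp add: sum.distrib sum_subtractf sum_distrib_left algebra_simps sy power_mult_distrib)
    also have "\<dots> = ?n + s\<^sup>2 / 2 * (?n * \<beta>\<^sup>2 - (\<beta>\<^sup>2 + l * \<alpha>\<^sup>2) * m x T T - 2 * \<alpha> * \<beta> * dd F x T + \<eta>)"
      unfolding sum_sv[OF xU h(5)] frame_norm[OF xU h(5)] by (simp add: \<eta>'_def algebra_simps)
    finally have fin: "(\<Sum>a\<in>UNIV. sqrt (m (\<xi> x (E a) \<alpha> s) (\<zeta> x T (E a) \<alpha> \<beta> s) (\<zeta> x T (E a) \<alpha> \<beta> s))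
               + sqrt (m (\<xi> x (E a) \<alpha> (- s)) (\<zeta> x T (E a) \<alpha> \<beta> (- s)) (\<zeta> x T (E a) \<alpha> \<beta> (- s)))) / 2
       \<le> ?n + s\<^sup>2 / 2 * (?n * \<beta>\<^sup>2 - (\<beta>\<^sup>2 + l * \<alpha>\<^sup>2) * m x T T - 2 * \<alpha> * \<beta> * dd F x T + \<eta>)" .
    have div: "S / (2 * ?n) \<le> 1 + s\<^sup>2 / (2 * ?n) * W" if "S / 2 \<le> ?n + s\<^sup>2 / 2 * W" for S W :: real
      using divide_right_mono[OF that, of ?n] by (simp add: add_divide_distrib)
    show "mean_speed x T E \<alpha> \<beta> s
       \<le> 1 + s\<^sup>2 / (2 * ?n) * (?n * \<beta>\<^sup>2 - (\<beta>\<^sup>2 + l * \<alpha>\<^sup>2) * m x T T - 2 * \<alpha> * \<beta> * dd F x T + \<eta>)"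
      unfolding mean_speed_def
      by (rule div[OF fin])
  qed (use s1 s2 in auto)
qed

end

section \<open>Parallel transport\<close>

text \<open>Picard iteration for \<open>z t = exp (- 2 M (t - a)) y t\<close>; this weight makes the integral operator a
  contraction on an interval of any length.\<close>

lemma linear_ode_exists:
  fixes A :: "real \<Rightarrow> real^'n::finite^'n"
  assumes "a \<le> b" "continuous_on {a..b} A"
  shows "\<exists>y. y a = y0 \<and> (\<forall>t\<in>{a..b}. (y has_vector_derivative A t *v y t) (at t within {a..b}))"
proof -
  have "bounded (A ` {a..b})" using assms(2) compact_continuous_image compact_imp_bounded by blast
  then obtain D where D: "\<And>t. t \<in> {a..b} \<Longrightarrow> norm (A t) \<le> D" unfolding bounded_iff by blast
  obtain K where K: "K > 0" "\<And>(Q::real^'n^'n) v. norm (Q *v v) \<le> norm Q * norm v * K"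
    using bounded_bilinear.pos_bounded[OF bounded_bilinear_matrix_vector] by blast
  define M where "M = \<bar>D\<bar> * K + 1"
  have M: "M > 0" using K(1) by (simp add: M_def add_nonneg_pos)
  have AM: "norm (A t *v v) \<le> M * norm v" if "t \<in> {a..b}" for t v
  proof -
    have "norm (A t *v v) \<le> norm (A t) * norm v * K" by (rule K)
    also have "\<dots> \<le> \<bar>D\<bar> * norm v * K" using D[OF that] K(1) by (intro mult_right_mono) auto
    also have "\<dots> \<le> M * norm v" by (simp add: M_def algebra_simps)
    finally show ?thesis .
  qed
  \<comment> \<open>Clamping to [a, b] extends functions to bounded continuous ones on the whole
    line, so that the fixed point can be sought in the complete space of bounded continuous
    functions.\<close>
  define p where "p t = max a (min b t)" for t
  have p: "p t \<in> {a..b}" for t using assms(1) by (auto simp: p_def)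
  have pid: "p t = t" if "t \<in> {a..b}" for t using that by (auto simp: p_def)
  define k where "k z r = exp (2 * M * (r - a)) *\<^sub>R (A r *v apply_bcontfun z r)" for z r
  have ck: "continuous_on {a..b} (k z)" for z unfolding k_def
    by (intro continuous_intros bounded_bilinear.continuous_on[OF bounded_bilinear_matrix_vector] assms(2)) auto
  define h where "h z u = exp (- (2 * M * (u - a))) *\<^sub>R (y0 + integral {a..u} (k z))" for z u
  have ch: "continuous_on {a..b} (h z)" for z unfolding h_def
    by (intro continuous_intros indefinite_integral_continuous_1 integrable_continuous_real ck)
  have bc: "(\<lambda>t. h z (p t)) \<in> bcontfun" for z
  proof -
    have "continuous_on UNIV (\<lambda>t. h z (p t))"
      by (rule continuous_on_compose2[OF ch]) (auto simp: p_def intro!: continuous_intros assms(1))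
    moreover have "range (\<lambda>t. h z (p t)) \<subseteq> h z ` {a..b}" using p by auto
    moreover have "bounded (h z ` {a..b})" using ch compact_continuous_image compact_imp_bounded by blast
    ultimately show ?thesis using bounded_subset by (auto simp: bcontfun_def)
  qed
  define \<T> where "\<T> z = Bcontfun (\<lambda>t. h z (p t))" for z
  have T: "apply_bcontfun (\<T> z) t = h z (p t)" for z t by (simp add: \<T>_def Bcontfun_inverse[OF bc])
  have contr: "dist (\<T> z) (\<T> w) \<le> (1/2) * dist z w" for z w
  proof (rule dist_bound)
    fix t
    define u where "u = p t"
    have u: "u \<in> {a..b}" using p by (simp add: u_def)
    have i: "(k z) integrable_on {a..u}" for z using u by (intro integrable_continuous_real continuous_on_subset[OF ck]) auto
    \<comment> \<open>The purpose of the weight: M exp (2 M (r - a)) integrates to less than half of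
      exp (2 M (u - a)), which becomes the contraction factor 1/2.\<close>
    have ie: "((\<lambda>r. exp (2 * M * (r - a)) * (M * dist z w)) has_integral (exp (2 * M * (u - a)) - 1) * dist z w / 2) {a..u}"
    proof -
      have "((\<lambda>r. exp (2 * M * (r - a)) * (M * dist z w)) has_integral
        exp (2 * M * (u - a)) * dist z w / 2 - exp (2 * M * (a - a)) * dist z w / 2) {a..u}"
        using u M by (intro fundamental_theorem_of_calculus)
         (auto intro!: derivative_eq_intros simp: has_real_derivative_iff_has_vector_derivative[symmetric])
      then show ?thesis by (simp add: algebra_simps diff_divide_distrib)
    qed
    have "norm (integral {a..u} (\<lambda>r. k z r - k w r)) \<le> integral {a..u} (\<lambda>r. exp (2 * M * (r - a)) * (M * dist z w))"
    proof (rule integral_norm_bound_integral)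
      fix r assume r: "r \<in> {a..u}"
      have "norm (k z r - k w r) = exp (2 * M * (r - a)) * norm (A r *v (apply_bcontfun z r - apply_bcontfun w r))"
        by (simp add: k_def matrix_vector_mult_diff_distrib scaleR_diff_right[symmetric])
      also have "\<dots> \<le> exp (2 * M * (r - a)) * (M * norm (apply_bcontfun z r - apply_bcontfun w r))"
        using r u by (intro mult_left_mono AM) auto
      also have "\<dots> \<le> exp (2 * M * (r - a)) * (M * dist z w)"
        using M dist_bounded[of z r w] by (intro mult_left_mono) (auto simp: dist_norm)
      finally show "norm (k z r - k w r) \<le> exp (2 * M * (r - a)) * (M * dist z w)" .
    qed (use i ie in \<open>auto intro: integrable_diff has_integral_integrable\<close>)
    also have "\<dots> = (exp (2 * M * (u - a)) - 1) * dist z w / 2" using ie by (rule integral_unique)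
    finally have n: "norm (integral {a..u} (k z) - integral {a..u} (k w)) \<le> (exp (2 * M * (u - a)) - 1) * dist z w / 2"
      using i by (simp add: integral_diff)
    have "dist (apply_bcontfun (\<T> z) t) (apply_bcontfun (\<T> w) t) = exp (- (2 * M * (u - a))) * norm (integral {a..u} (k z) - integral {a..u} (k w))"
      by (simp add: T u_def[symmetric] h_def dist_norm scaleR_diff_right[symmetric])
    also have "\<dots> \<le> exp (- (2 * M * (u - a))) * ((exp (2 * M * (u - a)) - 1) * dist z w / 2)"
      using n by (intro mult_left_mono) auto
    also have "\<dots> = (1 - exp (- (2 * M * (u - a)))) * dist z w / 2"
    proof -
      have "exp (- q) * ((exp q - 1) * D / 2) = (1 - exp (- q)) * D / 2" for q D :: real
        by (simp add: exp_minus field_simps)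
      then show ?thesis by blast
    qed
    also have "\<dots> \<le> (1/2) * dist z w" by (simp add: algebra_simps)
    finally show "dist (apply_bcontfun (\<T> z) t) (apply_bcontfun (\<T> w) t) \<le> (1/2) * dist z w" .
  qed
  obtain z where z: "\<T> z = z" using banach_fix_type[of "1/2" \<T>] contr by auto
  define y where "y t = exp (2 * M * (t - a)) *\<^sub>R apply_bcontfun z t" for t
  have y: "y t = y0 + integral {a..t} (\<lambda>r. A r *v y r)" if "t \<in> {a..b}" for t
  proof -
    have "apply_bcontfun z t = h z t" using T[of z t] z pid[OF that] by simp
    then show ?thesis
      by (simp add: y_def h_def exp_minus k_def[abs_def] matrix_vector_mult_scaleR)
  qed
  have cy: "continuous_on {a..b} (\<lambda>r. A r *v y r)" unfolding y_def
    by (intro continuous_intros bounded_bilinear.continuous_on[OF bounded_bilinear_matrix_vector] assms(2)) auto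
  have "(y has_vector_derivative A t *v y t) (at t within {a..b})" if "t \<in> {a..b}" for t
  proof -
    have "((\<lambda>t. y0 + integral {a..t} (\<lambda>r. A r *v y r)) has_vector_derivative 0 + A t *v y t) (at t within {a..b})"
      by (intro has_vector_derivative_add has_vector_derivative_const integral_has_vector_derivative cy that)
    then have "((\<lambda>t. y0 + integral {a..t} (\<lambda>r. A r *v y r)) has_vector_derivative A t *v y t) (at t within {a..b})" by simp
    then show ?thesis by (rule has_vector_derivative_transform[OF that, rotated]) (use y in auto)
  qed
  moreover have "y a = y0" using y[of a] assms(1) by simp
  ultimately show ?thesis by blast
qed

context riem_chart begin

text \<open>The equation of parallel transport is linear with continuous coefficients and thus
  solvable on the whole interval; inner products stay constant by metric compatibility.\<close>

lemma parallel_frame_exists: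
  assumes "a \<le> b" "\<And>t. t \<in> {a..b} \<Longrightarrow> x t \<in> U"
    "\<And>t. t \<in> {a..b} \<Longrightarrow> (x has_vector_derivative x' t) (at t within {a..b})"
    "continuous_on {a..b} x'" "orthonormal_frame G (x a) E0"
  shows "\<exists>E. E a = E0 \<and> (\<forall>t\<in>{a..b}. orthonormal_frame G (x t) (E t)) \<and>
     (\<forall>t\<in>{a..b}. \<forall>i. ((\<lambda>t. E t i) has_vector_derivative - Gam G (x t) (x' t) (E t i)) (at t within {a..b}))"
proof -
  have cx: "continuous_on {a..b} x"
    using assms(3) by (meson continuous_on_eq_continuous_within has_vector_derivative_continuous)
  define A where "A t = matrix (\<lambda>v. - Gam G (x t) (x' t) v)" for t
  have A: "A t *v v = - Gam G (x t) (x' t) v" for t v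
  proof -
    have "linear (\<lambda>v. - Gam G (x t) (x' t) v)" by (auto intro!: linearI simp: Gam_simps)
    then show ?thesis by (simp add: A_def matrix_works)
  qed
  have "continuous_on {a..b} A" unfolding A_def matrix_def
    by (intro continuous_on_vec_lambda continuous_on_component continuous_on_minus continuous_on_Gam cx assms continuous_on_const)
  then have "\<exists>y. y a = E0 i \<and> (\<forall>t\<in>{a..b}. (y has_vector_derivative - Gam G (x t) (x' t) (y t)) (at t within {a..b}))" for i
    using linear_ode_exists[OF assms(1), of A "E0 i"] by (simp add: A)
  then obtain e where e: "\<And>i. e i a = E0 i"
    "\<And>i t. t \<in> {a..b} \<Longrightarrow> (e i has_vector_derivative - Gam G (x t) (x' t) (e i t)) (at t within {a..b})" by metis
  have "orthonormal_frame G (x t) (\<lambda>i. e i t)" if t: "t \<in> {a..b}" for t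
  proof -
    have "m (x t) (e i t) (e j t) = m (x a) (e i a) (e j a)" for i j
    proof (rule has_derivative_zero_unique[of "{a..b}" "\<lambda>t. m (x t) (e i t) (e j t)" t a])
      fix u assume u: "u \<in> {a..b}"
      have "((\<lambda>t. m (x t) (e i t) (e j t)) has_derivative
        (\<lambda>h. m (x u) (h *\<^sub>R - Gam G (x u) (x' u) (e i u) + Gam G (x u) (h *\<^sub>R x' u) (e i u)) (e j u)
           + m (x u) (e i u) (h *\<^sub>R - Gam G (x u) (x' u) (e j u) + Gam G (x u) (h *\<^sub>R x' u) (e j u)))) (at u within {a..b})"
        using e(2)[OF u] assms(2,3)[OF u] unfolding has_vector_derivative_def by (intro has_derivative_metric)
      then show "((\<lambda>t. m (x t) (e i t) (e j t)) has_derivative (\<lambda>h. 0)) (at u within {a..b})"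
        by (simp add: Gam_simps metric_form_simps)
    qed (use t assms(1) in auto)
    then show ?thesis using assms(5) e(1) by (simp add: orthonormal_frame_def)
  qed
  then show ?thesis using e by (intro exI[of _ "\<lambda>t i. e i t"]) auto
qed

end

section \<open>Change of charts\<close>

lemma has_derivative_half_square:
  "((\<lambda>t. (t\<^sup>2 / 2) *\<^sub>R v) has_derivative (\<lambda>h. h *\<^sub>R (t *\<^sub>R v))) (at (t::real))"
proof -
  have "((\<lambda>t::real. t\<^sup>2 / 2) has_real_derivative t) (at t)" by (auto intro!: derivative_eq_intros)
  from has_derivative_scaleR_left[OF this[unfolded has_field_derivative_def], of v]
  show ?thesis by (simp add: mult.commute)
qed

lemma has_derivative_affine:
  "((\<lambda>t. v + t *\<^sub>R w) has_derivative (\<lambda>h. h *\<^sub>R w)) (at (t::real))"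
  by (rule derivative_eq_intros refl)+ simp

lemma has_derivative_quadratic:
  "((\<lambda>t. u + t *\<^sub>R v + (t\<^sup>2 / 2) *\<^sub>R w) has_derivative (\<lambda>h. h *\<^sub>R (v + t *\<^sub>R w))) (at (t::real))"
  using has_derivative_add[OF has_derivative_affine has_derivative_half_square] by (simp add: scaleR_add_right)

text \<open>A local isometry \<phi> between two chart images that matches the two functions; it
  stands for a transition map on an overlap. Being isometric makes its differential injective, hence
  bijective.\<close>

locale chart_change =
  c1: riem_chart_function U1 G1 F1 + c2: riem_chart_function U2 G2 F2
  for U1 U2 :: "(real^'n::finite) set" and G1 F1 G2 F2 +
  fixes W :: "(real^'n) set" and \<phi> :: "real^'n \<Rightarrow> real^'n"
  assumes open_W: "open W" and W_U1: "W \<subseteq> U1" and smooth_\<phi>: "smooth_on W \<phi>"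
    and \<phi>_U2: "x \<in> W \<Longrightarrow> \<phi> x \<in> U2"
    and metric_change: "x \<in> W \<Longrightarrow> metric_form G1 x v w = metric_form G2 (\<phi> x) (dd \<phi> x v) (dd \<phi> x w)"
    and F_change: "x \<in> W \<Longrightarrow> F1 x = F2 (\<phi> x)"
begin

lemma linear_d\<phi>: "x \<in> W \<Longrightarrow> linear (dd \<phi> x)"
  by (rule dd_linear[OF smooth_\<phi>])

lemma inj_d\<phi>: assumes "x \<in> W" shows "inj (dd \<phi> x)"
proof -
  have "v = 0" if "dd \<phi> x v = 0" for v
  proof (rule ccontr)
    assume "v \<noteq> 0"
    then have "c1.m x v v > 0" using c1.metric_pos assms W_U1 by blast
    then show False using metric_change[OF assms, of v v] that by (simp add: metric_form_simps)
  qed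
  then show ?thesis using linear_injective_0[OF linear_d\<phi>[OF assms]] by blast
qed

lemma surj_d\<phi>: "x \<in> W \<Longrightarrow> surj (dd \<phi> x)"
  by (rule linear_injective_imp_surjective[OF linear_d\<phi> inj_d\<phi>]) auto

lemma metric_nondeg2:
  assumes "x \<in> W" "\<And>w. c2.m (\<phi> x) u (dd \<phi> x w) = c2.m (\<phi> x) v (dd \<phi> x w)" shows "u = v"
proof (rule c2.metric_nondeg[OF \<phi>_U2[OF assms(1)]])
  fix w
  obtain w' where "w = dd \<phi> x w'" using surj_d\<phi>[OF assms(1)] by (metis surjD)
  then show "c2.m (\<phi> x) u w = c2.m (\<phi> x) v w" using assms(2) by simp
qed

lemma \<phi>_has_derivative: "x \<in> W \<Longrightarrow> (\<phi> has_derivative dd \<phi> x) (at x)"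
  by (rule smooth_on_has_derivative[OF smooth_\<phi>])

text \<open>The difference of the two sides is symmetric in \<open>u, v\<close> while, by metric compatibility, its
  product with \<open>w\<close> is antisymmetric in \<open>v, w\<close>; so it vanishes.\<close>

lemma Gam_change:
  assumes "x \<in> W"
  shows "dd \<phi> x (Gam G1 x u v) = Gam G2 (\<phi> x) (dd \<phi> x u) (dd \<phi> x v) + dd (\<lambda>y. dd \<phi> y v) x u"
proof -
  let ?L = "dd \<phi> x"
  have xU: "x \<in> U1" using assms W_U1 by blast
  define S where "S u v = ?L (Gam G1 x u v) - Gam G2 (\<phi> x) (?L u) (?L v) - dd (\<lambda>y. dd \<phi> y v) x u" for u v
  define T where "T u v w = c2.m (\<phi> x) (S u v) (?L w)" for u v w
  have Ssym: "S u v = S v u" for u v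
    using dd_dd_sym[OF open_W smooth_\<phi> assms, of u v] c1.Gam_sym[OF xU, of u v]
      c2.Gam_sym[OF \<phi>_U2[OF assms], of "?L u" "?L v"] by (simp add: S_def)
  have anti: "T w u v = - T w v u" for u v w
  proof -
    have "dd (\<lambda>y. c1.m y u v) x = dd (\<lambda>y. c2.m (\<phi> y) (dd \<phi> y u) (dd \<phi> y v)) x"
      by (rule frechet_derivative_cong_open[OF open_W assms]) (rule metric_change)
    moreover have "dd (\<lambda>y. c2.m (\<phi> y) (dd \<phi> y u) (dd \<phi> y v)) x =
      (\<lambda>w. c2.m (\<phi> x) (dd (\<lambda>y. dd \<phi> y u) x w + Gam G2 (\<phi> x) (?L w) (?L u)) (?L v)
         + c2.m (\<phi> x) (?L u) (dd (\<lambda>y. dd \<phi> y v) x w + Gam G2 (\<phi> x) (?L w) (?L v)))"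
      by (intro dd_eq c2.has_derivative_metric \<phi>_has_derivative smooth_on_has_derivative[OF smooth_on_dd[OF smooth_\<phi>]] assms \<phi>_U2)
    moreover have "dd (\<lambda>y. c1.m y u v) x = (\<lambda>w. c1.m x (0 + Gam G1 x w u) v + c1.m x u (0 + Gam G1 x w v))"
      by (intro dd_eq c1.has_derivative_metric has_derivative_ident has_derivative_const xU)
    ultimately have "c1.m x (Gam G1 x w u) v + c1.m x u (Gam G1 x w v) =
        c2.m (\<phi> x) (dd (\<lambda>y. dd \<phi> y u) x w + Gam G2 (\<phi> x) (?L w) (?L u)) (?L v)
         + c2.m (\<phi> x) (?L u) (dd (\<lambda>y. dd \<phi> y v) x w + Gam G2 (\<phi> x) (?L w) (?L v))" by (simp add: fun_eq_iff)
    then have "c2.m (\<phi> x) (S w u) (?L v) + c2.m (\<phi> x) (?L u) (S w v) = 0"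
      unfolding S_def metric_change[OF assms] by (simp add: metric_form_simps)
    then show ?thesis using c2.metric_sym[OF \<phi>_U2[OF assms], of "?L u" "S w v"] by (simp add: T_def)
  qed
  have sym: "T u v w = T v u w" for u v w by (simp add: T_def Ssym)
  have "T u v w = 0" for u v w
    using anti[of u v w] sym[of u w v] anti[of w u v] sym[of w v u] anti[of v w u] sym[of v u w] by linarith
  then have "S u v = 0" for u v by (intro metric_nondeg2[OF assms]) (simp add: T_def metric_form_simps)
  then have "S u v = 0" .
  then show ?thesis by (simp add: S_def algebra_simps)
qed

lemma gradient_change: assumes "x \<in> W" shows "c2.X (\<phi> x) = dd \<phi> x (c1.X x)"
proof (rule metric_nondeg2[OF assms])
  fix w
  have xU: "x \<in> U1" using assms W_U1 by blast
  have "dd F1 x = dd (\<lambda>y. F2 (\<phi> y)) x"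
    by (rule frechet_derivative_cong_open[OF open_W assms]) (rule F_change)
  also have "\<dots> = (\<lambda>w. dd F2 (\<phi> x) (dd \<phi> x w))"
    by (intro dd_eq has_derivative_compose[OF \<phi>_has_derivative smooth_on_has_derivative[OF c2.smooth_F]] assms \<phi>_U2)
  finally show "c2.m (\<phi> x) (c2.X (\<phi> x)) (dd \<phi> x w) = c2.m (\<phi> x) (dd \<phi> x (c1.X x)) (dd \<phi> x w)"
    by (simp add: c2.metric_gradient[OF \<phi>_U2[OF assms]] metric_change[OF assms, symmetric] c1.metric_gradient[OF xU])
qed

lemma grad_norm_change: assumes "x \<in> W" shows "c1.m x (c1.X x) (c1.X x) = c2.m (\<phi> x) (c2.X (\<phi> x)) (c2.X (\<phi> x))"
  by (simp add: gradient_change metric_change assms)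

text \<open>The additional second derivative of \<phi> is what the chain rule adds to the
  acceleration of an image curve, so the curves \<open>\<xi>\<close> are natural to second
  order.\<close>

lemma Y_change: assumes "x \<in> W"
  shows "dd \<phi> x (c1.Y x e) = c2.Y (\<phi> x) (dd \<phi> x e) + dd (\<lambda>y. dd \<phi> y e) x e"
  by (simp add: c1.Y_def c2.Y_def linear_add[OF linear_d\<phi>[OF assms]] linear_scale[OF linear_d\<phi>[OF assms]]
     Gam_change[OF assms] gradient_change[OF assms] algebra_simps)

lemma nabla_change: assumes "x \<in> W" shows "c2.H (\<phi> x) (dd \<phi> x v) = dd \<phi> x (c1.H x v)"
proof -
  have xU: "x \<in> U1" using assms W_U1 by blast
  have "dd (\<lambda>y. c2.X (\<phi> y)) x = dd (\<lambda>y. dd \<phi> y (c1.X y)) x"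
    by (rule frechet_derivative_cong_open[OF open_W assms]) (rule gradient_change)
  moreover have "dd (\<lambda>y. c2.X (\<phi> y)) x = (\<lambda>v. dd c2.X (\<phi> x) (dd \<phi> x v))"
    by (intro dd_eq has_derivative_compose[OF \<phi>_has_derivative smooth_on_has_derivative[OF c2.smooth_X]] assms \<phi>_U2)
  moreover have "dd (\<lambda>y. dd \<phi> y (c1.X y)) x = (\<lambda>v. dd (\<lambda>y. dd \<phi> y (c1.X x)) x v + dd \<phi> x (dd c1.X x v))"
    by (intro dd_eq has_derivative_dd_compose[OF open_W smooth_\<phi>] has_derivative_ident smooth_on_has_derivative[OF c1.smooth_X] xU assms UNIV_I)
  ultimately have "dd c2.X (\<phi> x) (dd \<phi> x v) = dd (\<lambda>y. dd \<phi> y (c1.X x)) x v + dd \<phi> x (dd c1.X x v)" by metis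
  then show ?thesis
    by (simp add: nabla_def linear_add[OF linear_d\<phi>[OF assms]] Gam_change[OF assms] gradient_change[OF assms])
qed

lemma trace_change: assumes "x \<in> W" shows "trace (matrix (c1.H x)) = trace (matrix (c2.H (\<phi> x)))"
proof -
  have xU: "x \<in> U1" using assms W_U1 by blast
  note lin = linear_d\<phi>[OF assms]
  obtain J where J: "linear J" "J \<circ> dd \<phi> x = id" using linear_injective_left_inverse[OF lin inj_d\<phi>[OF assms]] by blast
  have lH1: "linear (c1.H x)" by (rule c1.linear_H[OF xU])
  have lH2: "linear (c2.H (\<phi> x))" by (rule c2.linear_H[OF \<phi>_U2[OF assms]])
  have "c1.H x = J \<circ> (c2.H (\<phi> x) \<circ> dd \<phi> x)"
    using J(2) by (auto simp: fun_eq_iff nabla_change[OF assms])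
  then have "matrix (c1.H x) = matrix J ** (matrix (c2.H (\<phi> x)) ** matrix (dd \<phi> x))"
    using matrix_compose[OF linear_compose[OF lin lH2] J(1)] matrix_compose[OF lin lH2] by simp
  then have "trace (matrix (c1.H x)) = trace ((matrix (c2.H (\<phi> x)) ** matrix (dd \<phi> x)) ** matrix J)"
    using trace_mul_sym[of "matrix J"] by metis
  moreover have "matrix (dd \<phi> x) ** matrix J = mat 1"
  proof -
    have "matrix J ** matrix (dd \<phi> x) = mat 1"
      using matrix_compose[OF lin J(1)] J(2) by (simp add: matrix_id_mat_1)
    then show ?thesis using matrix_left_right_inverse by blast
  qed
  ultimately show ?thesis by (simp add: matrix_mul_assoc[symmetric])
qed

lemma frame_change: assumes "x \<in> W" "orthonormal_frame G1 x E"
  shows "orthonormal_frame G2 (\<phi> x) (\<lambda>a. dd \<phi> x (E a))"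
  using assms(2) metric_change[OF assms(1)] by (simp add: orthonormal_frame_def)

text \<open>Value, velocity and, by \<open>Y_change\<close>, acceleration of the two curves agree at
  \<sigma> = 0, so they differ by o(\<sigma>^2), uniformly on compact sets. This error is the price
  of a change of chart.\<close>

lemma \<xi>_change:
  assumes "compact K" "K \<subseteq> W" "\<eta> > 0"
  shows "\<exists>s0>0. \<forall>\<sigma> x e \<alpha>. \<bar>\<sigma>\<bar> \<le> s0 \<longrightarrow> x \<in> K \<longrightarrow> norm e \<le> C \<longrightarrow> \<bar>\<alpha>\<bar> \<le> 1 \<longrightarrow>
     c1.\<xi> x e \<alpha> \<sigma> \<in> W \<and> norm (\<phi> (c1.\<xi> x e \<alpha> \<sigma>) - c2.\<xi> (\<phi> x) (dd \<phi> x e) \<alpha> \<sigma>) \<le> \<eta> * \<sigma>\<^sup>2"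
proof -
  define P where "P = K \<times> cball (0::real^'n) C \<times> {-1..1::real}"
  have "compact P" unfolding P_def by (intro compact_Times assms) auto
  define x where "x = (\<lambda>p::(real^'n) \<times> (real^'n) \<times> real. fst p)"
  define e where "e = (\<lambda>p::(real^'n) \<times> (real^'n) \<times> real. fst (snd p))"
  define \<alpha> where "\<alpha> = (\<lambda>p::(real^'n) \<times> (real^'n) \<times> real. snd (snd p))"
  define \<psi> where "\<psi> = (\<lambda>q. c1.\<xi> (x (snd q)) (e (snd q)) (\<alpha> (snd q)) (fst q))"
  have cont [continuous_intros]: "continuous_on S (\<lambda>q. x (w q))" "continuous_on S (\<lambda>q. e (w q))"
    "continuous_on S (\<lambda>q. \<alpha> (w q))" if "continuous_on S w" for S :: "(real \<times> _) set" and w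
    unfolding x_def e_def \<alpha>_def using that by (auto intro!: continuous_intros)
  have xK: "x p \<in> W" if "p \<in> P" for p using that assms(2) by (auto simp: P_def x_def)
  have xU: "x p \<in> U1" if "p \<in> P" for p using xK[OF that] W_U1 by auto
  have contX: "continuous_on S (\<lambda>q. c1.X (x (snd q)))" if "S \<subseteq> UNIV \<times> P" for S :: "(real \<times> _) set"
    by (rule continuous_on_compose2[OF smooth_on_continuous[OF c1.smooth_X]]) (use that xU in \<open>auto intro!: continuous_intros\<close>)
  have contY: "continuous_on S (\<lambda>q. c1.Y (x (snd q)) (e (snd q)))" if "S \<subseteq> UNIV \<times> P" for S :: "(real \<times> _) set"
    unfolding c1.Y_def by (intro continuous_intros c1.continuous_on_Gam contX that) (use that xU in auto)
  have cont\<psi>: "continuous_on S \<psi>" if "S \<subseteq> UNIV \<times> P" for S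
    unfolding \<psi>_def c1.\<xi>_def by (intro continuous_intros contY that) simp_all
  obtain s1 where s1: "s1 > 0" "s1 \<le> 1" "\<And>\<sigma> p. \<bar>\<sigma>\<bar> \<le> s1 \<Longrightarrow> p \<in> P \<Longrightarrow> \<psi> (\<sigma>, p) \<in> W"
    using uniform_stay_open[OF \<open>compact P\<close> cont\<psi> open_W] xK by (force simp: \<psi>_def c1.\<xi>_def)
  define Z where "Z = (\<lambda>p. - ((\<alpha> p)\<^sup>2) *\<^sub>R c1.Y (x p) (e p))"
  have \<psi>_eq: "\<psi> (\<sigma>, p) = x p + \<sigma> *\<^sub>R (\<alpha> p *\<^sub>R e p) + (\<sigma>\<^sup>2 / 2) *\<^sub>R Z p" for \<sigma> p
    by (simp add: \<psi>_def c1.\<xi>_def Z_def)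
  define \<psi>' where "\<psi>' = (\<lambda>q. \<alpha> (snd q) *\<^sub>R e (snd q) + fst q *\<^sub>R Z (snd q))"
  define A2 where "A2 = (\<lambda>q. dd (\<lambda>y. dd \<phi> y (\<psi>' q)) (\<psi> q) (\<psi>' q) + dd \<phi> (\<psi> q) (Z (snd q)))"
  have d\<psi>: "((\<lambda>\<sigma>. \<psi> (\<sigma>, p)) has_derivative (\<lambda>h. h *\<^sub>R \<psi>' (\<sigma>, p))) (at \<sigma>)" for \<sigma> p
    unfolding \<psi>_eq \<psi>'_def fst_conv snd_conv by (rule has_derivative_quadratic)
  have d\<psi>': "((\<lambda>\<sigma>. \<psi>' (\<sigma>, p)) has_derivative (\<lambda>h. h *\<^sub>R Z p)) (at \<sigma>)" for \<sigma> p
    unfolding \<psi>'_def fst_conv snd_conv by (rule has_derivative_affine)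
  let ?S = "{-s1..s1} \<times> P"
  have S\<psi>: "\<psi> q \<in> W" if "q \<in> ?S" for q using s1(3)[of "fst q" "snd q"] that by auto
  have sub: "?S \<subseteq> UNIV \<times> P" by auto
  have cZ: "continuous_on ?S (\<lambda>q. Z (snd q))" unfolding Z_def by (intro continuous_intros contY sub)
  have c\<psi>': "continuous_on ?S \<psi>'" unfolding \<psi>'_def by (intro continuous_intros cZ)
  have cA2: "continuous_on ?S A2" unfolding A2_def
    by (intro continuous_on_add continuous_on_dd_dd[OF open_W smooth_\<phi>] continuous_on_dd[OF smooth_\<phi>] cont\<psi> sub c\<psi>' cZ S\<psi>)
  obtain s0 where s0: "s0 > 0" "s0 \<le> s1" "\<And>\<sigma> p. \<bar>\<sigma>\<bar> \<le> s0 \<Longrightarrow> p \<in> P \<Longrightarrow> norm (A2 (\<sigma>, p) - A2 (0, p)) \<le> 2 * \<eta>"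
    using uniform_continuity_at_0[OF \<open>compact P\<close> s1(1) cA2, of "2 * \<eta>"] assms(3) by auto
  have "c1.\<xi> xx ee aa \<sigma> \<in> W \<and> norm (\<phi> (c1.\<xi> xx ee aa \<sigma>) - c2.\<xi> (\<phi> xx) (dd \<phi> xx ee) aa \<sigma>) \<le> \<eta> * \<sigma>\<^sup>2"
    if h: "\<bar>\<sigma>\<bar> \<le> s0" "xx \<in> K" "norm ee \<le> C" "\<bar>aa\<bar> \<le> 1" for \<sigma> xx ee aa
  proof -
    define p where "p = (xx, ee, aa)"
    have pP: "p \<in> P" using h by (auto simp: p_def P_def)
    have pv: "x p = xx" "e p = ee" "\<alpha> p = aa" by (simp_all add: p_def x_def e_def \<alpha>_def)
    have xW: "xx \<in> W" using h assms by auto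
    note lin = linear_d\<phi>[OF xW]
    have inW: "\<psi> (t, p) \<in> W" if "\<bar>t\<bar> \<le> s0" for t using s1(3) s0(2) that pP by auto
    define Y2 where "Y2 = - (aa\<^sup>2) *\<^sub>R c2.Y (\<phi> xx) (dd \<phi> xx ee)"
    define D where "D t = \<phi> (\<psi> (t, p)) - (\<phi> xx + t *\<^sub>R (aa *\<^sub>R dd \<phi> xx ee) + (t\<^sup>2 / 2) *\<^sub>R Y2)" for t
    define D1 where "D1 t = dd \<phi> (\<psi> (t, p)) (\<psi>' (t, p)) - (aa *\<^sub>R dd \<phi> xx ee + t *\<^sub>R Y2)" for t
    \<comment> \<open>The acceleration of the image curve at 0: the second derivative of \<phi>
      cancels against the extra term of \<open>Y_change\<close>.\<close>
    have A20: "A2 (0, p) = Y2"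
    proof -
      have l2: "linear (dd (\<lambda>y. dd \<phi> y (aa *\<^sub>R ee)) xx)" "linear (dd (\<lambda>y. dd \<phi> y ee) xx)"
        by (intro dd_linear(1)[OF smooth_on_dd[OF smooth_\<phi>] xW])+
      have "dd (\<lambda>y. dd \<phi> y (aa *\<^sub>R ee)) xx (aa *\<^sub>R ee) = aa *\<^sub>R dd (\<lambda>y. dd \<phi> y (aa *\<^sub>R ee)) xx ee"
        by (rule linear_scale[OF l2(1)])
      also have "\<dots> = aa *\<^sub>R dd (\<lambda>y. dd \<phi> y ee) xx (aa *\<^sub>R ee)"
        using dd_dd_sym[OF open_W smooth_\<phi> xW, of "aa *\<^sub>R ee" ee] by simp
      also have "\<dots> = aa\<^sup>2 *\<^sub>R dd (\<lambda>y. dd \<phi> y ee) xx ee"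
        by (simp add: linear_scale[OF l2(2)] power2_eq_square)
      finally have "A2 (0, p) = aa\<^sup>2 *\<^sub>R dd (\<lambda>y. dd \<phi> y ee) xx ee + dd \<phi> xx (- (aa\<^sup>2) *\<^sub>R c1.Y xx ee)"
        by (simp add: A2_def \<psi>'_def pv \<psi>_eq Z_def)
      also have "\<dots> = Y2" unfolding linear_scale[OF lin] Y_change[OF xW] Y2_def by (simp add: algebra_simps)
      finally show ?thesis .
    qed
    have dD: "(D has_derivative (\<lambda>h. h *\<^sub>R D1 t)) (at t)" if "\<bar>t\<bar> \<le> s0" for t
    proof -
      have "(D has_derivative (\<lambda>h. dd \<phi> (\<psi> (t,p)) (h *\<^sub>R \<psi>' (t,p)) - h *\<^sub>R (aa *\<^sub>R dd \<phi> xx ee + t *\<^sub>R Y2))) (at t)"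
        unfolding D_def[abs_def]
        by (intro has_derivative_diff has_derivative_compose[OF d\<psi> \<phi>_has_derivative[OF inW[OF that]]] has_derivative_quadratic)
      then show ?thesis
        by (rule has_derivative_eq_rhs) (simp add: fun_eq_iff D1_def linear_scale[OF linear_d\<phi>[OF inW[OF that]]] algebra_simps)
    qed
    have dD1: "(D1 has_derivative (\<lambda>h. h *\<^sub>R (A2 (t, p) - Y2))) (at t)" if "\<bar>t\<bar> \<le> s0" for t
    proof -
      have "(D1 has_derivative (\<lambda>h. (dd (\<lambda>y. dd \<phi> y (\<psi>' (t,p))) (\<psi> (t,p)) (h *\<^sub>R \<psi>' (t,p)) + dd \<phi> (\<psi> (t,p)) (h *\<^sub>R Z p)) - h *\<^sub>R Y2)) (at t)"
        unfolding D1_def[abs_def]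
        by (intro has_derivative_diff has_derivative_dd_compose[OF open_W smooth_\<phi> d\<psi> d\<psi>' inW[OF that] UNIV_I] has_derivative_affine)
      then show ?thesis
        by (rule has_derivative_eq_rhs) (simp add: fun_eq_iff A2_def linear_scale[OF linear_d\<phi>[OF inW[OF that]]]
          linear_scale[OF dd_linear(1)[OF smooth_on_dd[OF smooth_\<phi>] inW[OF that]]] algebra_simps)
    qed
    have D0: "D 0 = 0" "D1 0 = 0"
      by (simp_all add: D_def D1_def \<psi>_eq \<psi>'_def pv linear_scale[OF lin])
    \<comment> \<open>Pairing with the unit vector along \<open>D \<sigma>\<close> reduces the
      vector estimate to the real Taylor bound; if \<open>D \<sigma>\<close> is zero, so is
      u.\<close>
    define u where "u = sgn (D \<sigma>)"
    have nu: "norm u \<le> 1" by (simp add: u_def norm_sgn)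
    have "D \<sigma> \<bullet> u \<le> D 0 \<bullet> u + \<sigma> * (D1 0 \<bullet> u) + \<sigma>\<^sup>2 / 2 * (2 * \<eta>)"
    proof (rule taylor2_le[where r = s0 and f'' = "\<lambda>t. (A2 (t, p) - Y2) \<bullet> u"])
      fix t assume t: "\<bar>t\<bar> \<le> s0"
      show "((\<lambda>t. D t \<bullet> u) has_real_derivative D1 t \<bullet> u) (at t)"
        using has_derivative_inner_left[OF dD[OF t], of u] unfolding has_field_derivative_def by (simp add: mult_commute_abs)
      show "((\<lambda>t. D1 t \<bullet> u) has_real_derivative (A2 (t, p) - Y2) \<bullet> u) (at t)"
        using has_derivative_inner_left[OF dD1[OF t], of u] unfolding has_field_derivative_def by (simp add: mult_commute_abs)
      have "(A2 (t, p) - Y2) \<bullet> u \<le> norm (A2 (t, p) - Y2) * norm u" by (rule norm_cauchy_schwarz)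
      also have "\<dots> \<le> norm (A2 (t, p) - Y2) * 1" using nu by (intro mult_left_mono) auto
      also have "\<dots> \<le> 2 * \<eta>" using s0(3)[OF t pP] A20 by simp
      finally show "(A2 (t, p) - Y2) \<bullet> u \<le> 2 * \<eta>" .
    qed (use h in auto)
    then have le: "D \<sigma> \<bullet> u \<le> \<sigma>\<^sup>2 / 2 * (2 * \<eta>)" by (simp add: D0)
    have "norm (D \<sigma>) \<le> \<eta> * \<sigma>\<^sup>2"
    proof -
      have "D \<sigma> \<bullet> u = norm (D \<sigma>)"
        by (cases "D \<sigma> = 0") (simp_all add: u_def sgn_div_norm dot_square_norm power2_eq_square)
      then show ?thesis using le by (simp add: mult.commute)
    qed
    moreover have "\<psi> (\<sigma>, p) = c1.\<xi> xx ee aa \<sigma>" by (simp add: \<psi>_def pv)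
    moreover have "D \<sigma> = \<phi> (\<psi> (\<sigma>, p)) - c2.\<xi> (\<phi> xx) (dd \<phi> xx ee) aa \<sigma>"
      by (simp add: D_def c2.\<xi>_def Y2_def)
    ultimately show ?thesis using inW[OF h(1)] by simp
  qed
  then show ?thesis using s0 by blast
qed

end

section \<open>Curves and distance on a Riemannian manifold\<close>

locale riem_manifold =
  fixes M :: "'a topology" and A :: "('a, 'n::finite) chart set" and g :: "('a, 'n) metric_tensor"
  assumes riem: "riemannian_manifold M A g"
begin

section \<open>Charts and transition maps of a Riemannian manifold\<close>

lemma chart: assumes "c \<in> A"
  shows "openin M (fst c)" "open (chart_image c)"
    "homeomorphic_map (subtopology M (fst c)) (top_of_set (chart_image c)) (snd c)"
  using riem assms unfolding riemannian_manifold_def smooth_manifold_def is_chart_def by blast+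

lemma hausdorff: "Hausdorff_space M"
  using riem unfolding riemannian_manifold_def smooth_manifold_def by blast

lemma cover: "p \<in> topspace M \<Longrightarrow> \<exists>c\<in>A. p \<in> fst c"
  using riem unfolding riemannian_manifold_def smooth_manifold_def by blast

lemma domain_subset: "c \<in> A \<Longrightarrow> fst c \<subseteq> topspace M"
  using chart(1) openin_subset by blast

lemma chart_at: assumes "p \<in> topspace M" shows "chart_at A p \<in> A" "p \<in> fst (chart_at A p)"
  using someI_ex[of "\<lambda>c. c \<in> A \<and> p \<in> fst c"] cover[OF assms] unfolding chart_at_def by blast+

lemma topspace_domain: "c \<in> A \<Longrightarrow> topspace (subtopology M (fst c)) = fst c"
  using domain_subset[of c] by (simp add: Int_absorb1)

lemma chart_inj: "c \<in> A \<Longrightarrow> inj_on (snd c) (fst c)"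
  using homeomorphic_imp_injective_map[OF chart(3)] topspace_domain by metis

lemma inv_left: "c \<in> A \<Longrightarrow> p \<in> fst c \<Longrightarrow> chart_inv c (snd c p) = p"
  using chart_inj by simp

lemma inv_right: "x \<in> chart_image c \<Longrightarrow> snd c (chart_inv c x) = x"
  by (rule f_inv_into_f)

lemma inv_in: "x \<in> chart_image c \<Longrightarrow> chart_inv c x \<in> fst c"
  by (rule inv_into_into)

lemma continuous_chart: "c \<in> A \<Longrightarrow> continuous_map (subtopology M (fst c)) euclidean (snd c)"
  using homeomorphic_imp_continuous_map[OF chart(3)] continuous_map_in_subtopology by blast

lemma continuous_inv: assumes "c \<in> A" shows "continuous_map (top_of_set (chart_image c)) M (chart_inv c)"
proof -
  obtain h where h: "homeomorphic_maps (subtopology M (fst c)) (top_of_set (chart_image c)) (snd c) h"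
    using chart(3)[OF assms] homeomorphic_map_maps by blast
  then have "continuous_map (top_of_set (chart_image c)) (subtopology M (fst c)) h"
    and inv: "\<And>p. p \<in> fst c \<Longrightarrow> h (snd c p) = p"
    using topspace_domain[OF assms] unfolding homeomorphic_maps_def by auto
  then have "continuous_map (top_of_set (chart_image c)) M h" using continuous_map_in_subtopology by blast
  then show ?thesis
    by (rule continuous_map_eq) (use inv inv_left[OF assms] in auto)
qed

lemma open_chart_image: assumes "c \<in> A" "openin M S" shows "open (snd c ` (fst c \<inter> S))"
proof -
  have "open_map (subtopology M (fst c)) (top_of_set (chart_image c)) (snd c)"
    by (rule homeomorphic_imp_open_map[OF chart(3)[OF assms(1)]])
  moreover have "openin (subtopology M (fst c)) (fst c \<inter> S)"
    using assms(2) by (metis openin_subtopology Int_commute)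
  ultimately have "openin (top_of_set (chart_image c)) (snd c ` (fst c \<inter> S))" unfolding open_map_def by blast
  then show ?thesis using chart(2)[OF assms(1)] openin_open_eq by blast
qed

lemma riem_chart: "c \<in> A \<Longrightarrow> riem_chart (chart_image c) (g c)"
  using riem chart(2) unfolding riemannian_manifold_def riemannian_metric_def
  by unfold_locales blast+

abbreviation overlap where "overlap c d \<equiv> snd c ` (fst c \<inter> fst d)"

lemma transition_eq: "c \<in> A \<Longrightarrow> p \<in> fst c \<Longrightarrow> transition c d (snd c p) = snd d p"
  by (simp add: transition_def inv_left)

lemma smooth_transition: "c \<in> A \<Longrightarrow> d \<in> A \<Longrightarrow> smooth_on (overlap c d) (transition c d)"
  using riem unfolding riemannian_manifold_def smooth_manifold_def by blast

lemma metric_transition: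
  "c \<in> A \<Longrightarrow> d \<in> A \<Longrightarrow> p \<in> fst c \<Longrightarrow> p \<in> fst d \<Longrightarrow>
   metric_form (g c) (snd c p) v w = metric_form (g d) (snd d p) (dd (transition c d) (snd c p) v) (dd (transition c d) (snd c p) w)"
  using riem unfolding riemannian_manifold_def riemannian_metric_def by blast

lemma chart_change:
  assumes "c \<in> A" "d \<in> A" "smooth_function A f"
  shows "chart_change (chart_image c) (chart_image d) (g c) (coord_rep c f) (g d) (coord_rep d f) (overlap c d) (transition c d)"
proof -
  interpret c: riem_chart "chart_image c" "g c" by (rule riem_chart[OF assms(1)])
  interpret d: riem_chart "chart_image d" "g d" by (rule riem_chart[OF assms(2)])
  show ?thesis
  proof
    show "smooth_on (chart_image c) (coord_rep c f)" "smooth_on (chart_image d) (coord_rep d f)"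
      using assms by (auto simp: smooth_function_def)
    show "open (overlap c d)" by (rule open_chart_image[OF assms(1) chart(1)[OF assms(2)]])
    show "smooth_on (overlap c d) (transition c d)" by (rule smooth_transition[OF assms(1,2)])
    fix x assume "x \<in> overlap c d"
    then obtain p where p: "p \<in> fst c" "p \<in> fst d" "x = snd c p" by blast
    show "transition c d x \<in> chart_image d" using p by (simp add: transition_eq[OF assms(1)])
    show "coord_rep c f x = coord_rep d f (transition c d x)"
      using p assms by (simp add: transition_eq coord_rep_def inv_left)
    show "metric_form (g c) x v w = metric_form (g d) (transition c d x) (dd (transition c d) x v) (dd (transition c d) x w)" for v w
      using metric_transition[OF assms(1,2) p(1,2)] p by (simp add: transition_eq[OF assms(1)])
  qed auto
qed

lemma eventually_in_open:
  assumes "continuous_map (top_of_set S) M \<gamma>" "t \<in> S" "openin M V" "\<gamma> t \<in> V"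
  shows "eventually (\<lambda>u. \<gamma> u \<in> V) (at t within S)"
proof -
  have "openin (top_of_set S) {u \<in> S. \<gamma> u \<in> V}"
    using openin_continuous_map_preimage[OF assms(1,3)] by simp
  then obtain T where T: "open T" "{u \<in> S. \<gamma> u \<in> V} = S \<inter> T" unfolding openin_open by blast
  then have "t \<in> T" using assms by blast
  then show ?thesis using T unfolding eventually_at_topological by blast
qed

lemma velocity_change:
  assumes "c \<in> A" "d \<in> A" "continuous_map (top_of_set S) M \<gamma>" "t \<in> S" "\<gamma> t \<in> fst c" "\<gamma> t \<in> fst d"
    "((snd c \<circ> \<gamma>) has_vector_derivative D) (at t within S)"
  shows "((snd d \<circ> \<gamma>) has_vector_derivative dd (transition c d) (snd c (\<gamma> t)) D) (at t within S)"
proof -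
  have W: "snd c (\<gamma> t) \<in> overlap c d" using assms by blast
  have d1: "((snd c \<circ> \<gamma>) has_derivative (\<lambda>h. h *\<^sub>R D)) (at t within S)"
    using assms(7) by (simp only: has_vector_derivative_def)
  have d2: "(transition c d has_derivative dd (transition c d) (snd c (\<gamma> t))) (at ((snd c \<circ> \<gamma>) t))"
    using smooth_on_has_derivative[OF smooth_transition[OF assms(1,2)] W] by (simp only: o_apply)
  note has_derivative_compose[OF d1 d2]
  moreover have "(\<lambda>h. dd (transition c d) (snd c (\<gamma> t)) (h *\<^sub>R D)) = (\<lambda>h. h *\<^sub>R dd (transition c d) (snd c (\<gamma> t)) D)"
    using linear_scale[OF dd_linear(1)[OF smooth_transition[OF assms(1,2)] W]] by auto
  ultimately have d: "((\<lambda>u. transition c d ((snd c \<circ> \<gamma>) u)) has_derivative (\<lambda>h. h *\<^sub>R dd (transition c d) (snd c (\<gamma> t)) D)) (at t within S)"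
    by simp
  have "eventually (\<lambda>u. transition c d ((snd c \<circ> \<gamma>) u) = (snd d \<circ> \<gamma>) u) (at t within S)"
    using eventually_in_open[OF assms(3,4) chart(1)[OF assms(1)] assms(5)]
    by (rule eventually_mono) (simp add: transition_eq[OF assms(1)])
  then show ?thesis unfolding has_vector_derivative_def
    by (rule has_derivative_transform_eventually[OF d]) (simp_all add: transition_eq[OF assms(1)] assms)
qed

section \<open>Regularity, speed and length of curves\<close>

lemma C1_curveD:
  assumes "C1_curve M A a b \<gamma>" "c \<in> A"
  obtains D where "\<And>t. t \<in> {a..b} \<Longrightarrow> \<gamma> t \<in> fst c \<Longrightarrow> ((snd c \<circ> \<gamma>) has_vector_derivative D t) (at t within {a..b})"
    "continuous_on {t\<in>{a..b}. \<gamma> t \<in> fst c} D"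
  using assms unfolding C1_curve_def by blast

lemma C1_curve_continuous: "C1_curve M A a b \<gamma> \<Longrightarrow> continuous_map (top_of_set {a..b}) M \<gamma>"
  unfolding C1_curve_def by blast

lemma C1_curve_topspace: "C1_curve M A a b \<gamma> \<Longrightarrow> t \<in> {a..b} \<Longrightarrow> \<gamma> t \<in> topspace M"
  using continuous_map_image_subset_topspace[OF C1_curve_continuous] by fastforce

text \<open>A concatenation agrees with each of its parts on an interval only; regularity is
  transferred there.\<close>

lemma C1_curve_cong:
  assumes "C1_curve M A a b \<gamma>" "\<And>t. t \<in> {a..b} \<Longrightarrow> \<gamma>' t = \<gamma> t"
  shows "C1_curve M A a b \<gamma>'"
  unfolding C1_curve_def
proof (intro conjI ballI)
  show "continuous_map (top_of_set {a..b}) M \<gamma>'"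
    by (rule continuous_map_eq[OF C1_curve_continuous[OF assms(1)]]) (use assms(2) in auto)
  fix c assume "c \<in> A"
  then obtain D where D: "\<And>t. t \<in> {a..b} \<Longrightarrow> \<gamma> t \<in> fst c \<Longrightarrow> ((snd c \<circ> \<gamma>) has_vector_derivative D t) (at t within {a..b})"
    "continuous_on {t\<in>{a..b}. \<gamma> t \<in> fst c} D" using C1_curveD[OF assms(1)] by blast
  have "{t\<in>{a..b}. \<gamma>' t \<in> fst c} = {t\<in>{a..b}. \<gamma> t \<in> fst c}" using assms(2) by auto
  moreover have "((snd c \<circ> \<gamma>') has_vector_derivative D t) (at t within {a..b})" if "t \<in> {a..b}" "\<gamma>' t \<in> fst c" for t
    by (rule has_vector_derivative_transform[OF that(1) _ D(1)]) (use assms(2) that in auto)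
  ultimately show "\<exists>D. (\<forall>t\<in>{a..b}. \<gamma>' t \<in> fst c \<longrightarrow> ((snd c \<circ> \<gamma>') has_vector_derivative D t) (at t within {a..b})) \<and>
        continuous_on {t\<in>{a..b}. \<gamma>' t \<in> fst c} D" using D(2) by (intro exI[of _ D]) auto
qed

lemma C1_curve_affine:
  assumes "C1_curve M A a b \<gamma>" "k > 0"
  shows "C1_curve M A (a * k + r) (b * k + r) (\<lambda>t. \<gamma> ((t - r) / k))"
  unfolding C1_curve_def
proof (intro conjI ballI)
  let ?h = "\<lambda>t. (t - r) / k"
  let ?I = "{a * k + r..b * k + r}"
  have h: "?h ` ?I \<subseteq> {a..b}" using assms(2) by (auto simp: field_simps)
  have "continuous_map (top_of_set ?I) (top_of_set {a..b}) ?h"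
    using h assms(2) by (auto simp: continuous_map_in_subtopology intro!: continuous_intros)
  from continuous_map_compose[OF this C1_curve_continuous[OF assms(1)]]
  show "continuous_map (top_of_set ?I) M (\<lambda>t. \<gamma> (?h t))" by (simp add: o_def)
  fix c assume "c \<in> A"
  then obtain D where D: "\<And>t. t \<in> {a..b} \<Longrightarrow> \<gamma> t \<in> fst c \<Longrightarrow> ((snd c \<circ> \<gamma>) has_vector_derivative D t) (at t within {a..b})"
    "continuous_on {t\<in>{a..b}. \<gamma> t \<in> fst c} D" using C1_curveD[OF assms(1)] by blast
  have "((snd c \<circ> (\<lambda>t. \<gamma> (?h t))) has_vector_derivative (1 / k) *\<^sub>R D (?h t)) (at t within ?I)"
    if "t \<in> ?I" "\<gamma> (?h t) \<in> fst c" for t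
  proof -
    have "(?h has_vector_derivative 1 / k) (at t within ?I)"
      unfolding has_real_derivative_iff_has_vector_derivative[symmetric] using assms(2) by (auto intro!: derivative_eq_intros)
    moreover have "((snd c \<circ> \<gamma>) has_vector_derivative D (?h t)) (at (?h t) within ?h ` ?I)"
      by (rule has_vector_derivative_within_subset[OF D(1) h]) (use that h in blast)+
    ultimately have "((snd c \<circ> \<gamma>) \<circ> ?h has_vector_derivative (1 / k) *\<^sub>R D (?h t)) (at t within ?I)"
      by (rule vector_diff_chain_within)
    then show ?thesis by (simp add: o_def)
  qed
  moreover have "continuous_on {t \<in> ?I. \<gamma> (?h t) \<in> fst c} (\<lambda>t. (1 / k) *\<^sub>R D (?h t))"
  proof (intro continuous_on_scaleR continuous_on_const continuous_on_compose2[OF D(2)])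
    show "continuous_on {t \<in> ?I. \<gamma> (?h t) \<in> fst c} ?h" using assms(2) by (auto intro!: continuous_intros)
    show "?h ` {t \<in> ?I. \<gamma> (?h t) \<in> fst c} \<subseteq> {t \<in> {a..b}. \<gamma> t \<in> fst c}" using h by blast
  qed
  ultimately show "\<exists>D. (\<forall>t\<in>?I. \<gamma> (?h t) \<in> fst c \<longrightarrow> ((snd c \<circ> (\<lambda>t. \<gamma> (?h t))) has_vector_derivative D t) (at t within ?I)) \<and>
        continuous_on {t\<in>?I. \<gamma> (?h t) \<in> fst c} D"
    by (intro exI[of _ "\<lambda>t. (1 / k) *\<^sub>R D (?h t)"] conjI ballI impI)
qed

text \<open>In the interior of a piece the derivatives within \<open>{a..b}\<close> and within
  \<open>{0..1}\<close> are both two-sided, and invariance of the metric removes the chart chosen by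
  \<open>curve_speed\<close>.\<close>

lemma speed_interior:
  assumes "C1_curve M A a b \<gamma>" "0 \<le> a" "b \<le> 1" "t \<in> {a<..<b}" "c \<in> A" "\<gamma> t \<in> fst c"
    "((snd c \<circ> \<gamma>) has_vector_derivative D) (at t within {a..b})"
  shows "curve_speed A g \<gamma> t = sqrt (metric_form (g c) (snd c (\<gamma> t)) D D)"
proof -
  have at: "at t within {a..b} = at t" "at t within {0..1} = at t"
    using assms by (auto intro!: at_within_interior simp: interior_atLeastAtMost_real)
  have p: "\<gamma> t \<in> topspace M" using C1_curve_topspace[OF assms(1)] assms(4) by auto
  define d where "d = chart_at A (\<gamma> t)"
  have d: "d \<in> A" "\<gamma> t \<in> fst d" using chart_at[OF p] by (auto simp: d_def)
  have "((snd d \<circ> \<gamma>) has_vector_derivative dd (transition c d) (snd c (\<gamma> t)) D) (at t within {a..b})"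
    by (rule velocity_change[OF assms(5) d(1) C1_curve_continuous[OF assms(1)] _ assms(6) d(2) assms(7)]) (use assms(4) in auto)
  then have "vector_derivative (snd d \<circ> \<gamma>) (at t within {0..1}) = dd (transition c d) (snd c (\<gamma> t)) D"
    unfolding at by (rule vector_derivative_at)
  then show ?thesis
    by (simp add: curve_speed_def d_def[symmetric] Let_def metric_transition[OF assms(5) d(1) assms(6) d(2)])
qed

lemma speed_in_chart:
  assumes "C1_curve M A a b \<gamma>" "0 \<le> a" "b \<le> 1" "a \<le> u" "v \<le> b" "c \<in> A" "\<And>t. t \<in> {u..v} \<Longrightarrow> \<gamma> t \<in> fst c"
  obtains D where "\<And>t. t \<in> {u..v} \<Longrightarrow> ((snd c \<circ> \<gamma>) has_vector_derivative D t) (at t within {u..v})"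
    "continuous_on {u..v} D" "continuous_on {u..v} (\<lambda>t. sqrt (metric_form (g c) (snd c (\<gamma> t)) (D t) (D t)))"
    "\<And>t. t \<in> {u..v} - {a, b} \<Longrightarrow> curve_speed A g \<gamma> t = sqrt (metric_form (g c) (snd c (\<gamma> t)) (D t) (D t))"
proof -
  obtain D where D: "\<And>t. t \<in> {a..b} \<Longrightarrow> \<gamma> t \<in> fst c \<Longrightarrow> ((snd c \<circ> \<gamma>) has_vector_derivative D t) (at t within {a..b})"
    "continuous_on {t\<in>{a..b}. \<gamma> t \<in> fst c} D" using C1_curveD[OF assms(1,6)] by blast
  interpret c: riem_chart "chart_image c" "g c" by (rule riem_chart[OF assms(6)])
  have sub: "{u..v} \<subseteq> {a..b}" using assms by auto
  have 1: "((snd c \<circ> \<gamma>) has_vector_derivative D t) (at t within {u..v})" if "t \<in> {u..v}" for t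
    by (rule has_vector_derivative_within_subset[OF D(1) sub]) (use that assms sub in auto)
  have 2: "continuous_on {u..v} D" by (rule continuous_on_subset[OF D(2)]) (use assms sub in auto)
  have "continuous_on {u..v} (snd c \<circ> \<gamma>)"
    using 1 by (meson continuous_on_eq_continuous_within has_vector_derivative_continuous)
  then have 3: "continuous_on {u..v} (\<lambda>t. sqrt (metric_form (g c) (snd c (\<gamma> t)) (D t) (D t)))"
    by (intro continuous_on_real_sqrt c.continuous_on_metric 2) (use assms in \<open>auto simp: o_def\<close>)
  have 4: "curve_speed A g \<gamma> t = sqrt (metric_form (g c) (snd c (\<gamma> t)) (D t) (D t))" if "t \<in> {u..v} - {a, b}" for t
    by (rule speed_interior[OF assms(1-3) _ assms(6)]) (use that assms sub in \<open>auto intro!: D(1)\<close>)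
  show ?thesis by (rule that[OF 1 2 3 4])
qed

text \<open>Near each time the curve lies in one chart, where its speed equals a continuous function
  except perhaps at a and b; integrability on small intervals suffices.\<close>

lemma speed_integrable_C1:
  assumes "C1_curve M A a b \<gamma>" "0 \<le> a" "b \<le> 1"
  shows "curve_speed A g \<gamma> integrable_on {a..b}"
  unfolding cbox_interval[symmetric]
proof (rule integrable_on_little_subintervals, rule ballI)
  fix t assume "t \<in> cbox a b"
  then have t: "t \<in> {a..b}" by simp
  then obtain c where c: "c \<in> A" "\<gamma> t \<in> fst c" using cover C1_curve_topspace[OF assms(1)] by blast
  have "eventually (\<lambda>u. \<gamma> u \<in> fst c) (at t within {a..b})"
    by (rule eventually_in_open[OF C1_curve_continuous[OF assms(1)] t chart(1)[OF c(1)] c(2)])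
  then obtain d where d: "d > 0" "\<And>u. u \<in> {a..b} \<Longrightarrow> dist u t < d \<Longrightarrow> \<gamma> u \<in> fst c"
    unfolding eventually_at using c(2) by (metis dist_self)
  show "\<exists>d>0. \<forall>u v. t \<in> cbox u v \<and> cbox u v \<subseteq> ball t d \<and> cbox u v \<subseteq> cbox a b \<longrightarrow> curve_speed A g \<gamma> integrable_on cbox u v"
  proof (intro exI[of _ d] conjI allI impI d(1))
    fix u v assume h: "t \<in> cbox u v \<and> cbox u v \<subseteq> ball t d \<and> cbox u v \<subseteq> cbox a b"
    then have uv: "a \<le> u" "v \<le> b" by auto
    have "\<gamma> r \<in> fst c" if "r \<in> {u..v}" for r
      by (rule d(2)) (use h that in \<open>auto simp: subset_iff dist_commute\<close>)
    then obtain D where D: "continuous_on {u..v} (\<lambda>t. sqrt (metric_form (g c) (snd c (\<gamma> t)) (D t) (D t)))"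
      "\<And>t. t \<in> {u..v} - {a, b} \<Longrightarrow> curve_speed A g \<gamma> t = sqrt (metric_form (g c) (snd c (\<gamma> t)) (D t) (D t))"
      using speed_in_chart[OF assms uv c(1)] by blast
    show "curve_speed A g \<gamma> integrable_on cbox u v"
      unfolding cbox_interval
      by (rule integrable_spike_finite[OF _ _ integrable_continuous_real[OF D(1)], of "{a, b}"]) (use D(2) in auto)
  qed
qed

lemma partition_mono:
  fixes s :: "nat \<Rightarrow> real"
  assumes "\<And>i. i < N \<Longrightarrow> s i < s (Suc i)" "i \<le> j" "j \<le> N"
  shows "s i \<le> s j"
  using assms(2,3)
proof (induction j)
  case (Suc j)
  then show ?case using assms(1)[of j] by (cases "i = Suc j") (auto simp: less_eq_Suc_le intro: order_trans less_imp_le)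
qed auto

lemma speed_integrable:
  assumes "piecewise_C1_curve M A \<gamma>" shows "curve_speed A g \<gamma> integrable_on {0..1}"
proof -
  obtain N :: nat and s where s: "s 0 = 0" "s N = 1" "\<And>i. i < N \<Longrightarrow> s i < s (Suc i)" "\<And>i. i < N \<Longrightarrow> C1_curve M A (s i) (s (Suc i)) \<gamma>"
    using assms unfolding piecewise_C1_curve_def by blast
  have mono: "s i \<le> s j" if "i \<le> j" "j \<le> N" for i j by (rule partition_mono[of N s i j]) (use s(3) that in auto)
  have "curve_speed A g \<gamma> integrable_on {0..s k}" if "k \<le> N" for k
    using that
  proof (induction k)
    case 0
    then show ?case using s(1) integrable_on_refl[of "curve_speed A g \<gamma>" 0] by simp
  next
    case (Suc k)
    show ?case
    proof (rule Henstock_Kurzweil_Integration.integrable_combine[of 0 "s k"])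
      show "curve_speed A g \<gamma> integrable_on {s k..s (Suc k)}"
        using Suc mono[of 0 k] mono[of "Suc k" N] s(1,2) by (intro speed_integrable_C1 s(4)) auto
    qed (use Suc mono[of 0 k] s(1) mono[of k "Suc k"] in auto)
  qed
  from this[of N] show ?thesis using s(2) by simp
qed

lemma speed_nonneg: "piecewise_C1_curve M A \<gamma> \<Longrightarrow> t \<in> {0..1} \<Longrightarrow> \<gamma> t \<in> topspace M \<Longrightarrow> curve_speed A g \<gamma> t \<ge> 0"
proof -
  assume "\<gamma> t \<in> topspace M"
  define d where "d = chart_at A (\<gamma> t)"
  have d: "d \<in> A" "\<gamma> t \<in> fst d" using chart_at[OF \<open>\<gamma> t \<in> topspace M\<close>] by (auto simp: d_def)
  interpret d: riem_chart "chart_image d" "g d" by (rule riem_chart[OF d(1)])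
  have "metric_form (g d) (snd d (\<gamma> t)) v v \<ge> 0" for v
    using d.metric_pos[of "snd d (\<gamma> t)" v] d(2) by (cases "v = 0") (auto simp: metric_form_simps)
  then show ?thesis by (simp add: curve_speed_def Let_def d_def[symmetric])
qed

lemma piecewise_topspace:
  assumes "piecewise_C1_curve M A \<gamma>" "t \<in> {0..1}" shows "\<gamma> t \<in> topspace M"
proof -
  obtain N :: nat and s where s: "s 0 = 0" "s N = 1" "\<And>i. i < N \<Longrightarrow> s i < s (Suc i)" "\<And>i. i < N \<Longrightarrow> C1_curve M A (s i) (s (Suc i)) \<gamma>"
    using assms unfolding piecewise_C1_curve_def by blast
  have claim: "\<gamma> t \<in> topspace M" if "t \<in> {0..s k}" "k \<le> N" "0 < k" for k
    using that
  proof (induction k)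
    case (Suc k)
    show ?case
    proof (cases "t \<in> {s k..s (Suc k)}")
      case True
      then show ?thesis using C1_curve_topspace[OF s(4)[of k]] Suc by auto
    next
      case False
      then have "t < s k" using Suc by auto
      then show ?thesis using Suc s(1) by (cases "k = 0") auto
    qed
  qed auto
  have "N > 0" using s(1,2) by (cases N) auto
  then show ?thesis using claim[of N] assms(2) s(2) by simp
qed

lemma speed_affine:
  assumes "C1_curve M A a b \<gamma>" "0 \<le> a" "b \<le> 1" "k > 0" "0 \<le> a * k + r" "b * k + r \<le> 1"
    "\<And>t. t \<in> {a * k + r..b * k + r} \<Longrightarrow> \<gamma>' t = \<gamma> ((t - r) / k)"
    "t \<in> {a * k + r <..< b * k + r}"
  shows "curve_speed A g \<gamma>' t = (1 / k) * curve_speed A g \<gamma> ((t - r) / k)"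
proof -
  let ?h = "\<lambda>t. (t - r) / k"
  let ?I = "{a * k + r..b * k + r}"
  have ht: "?h t \<in> {a<..<b}" using assms(4,8) by (auto simp: field_simps)
  have tI: "t \<in> ?I" using assms(8) by auto
  have C': "C1_curve M A (a * k + r) (b * k + r) \<gamma>'"
    by (rule C1_curve_cong[OF C1_curve_affine[OF assms(1,4)]]) (use assms(7) in auto)
  have "\<gamma> (?h t) \<in> topspace M" by (rule C1_curve_topspace[OF assms(1)]) (use ht in auto)
  then obtain c where c: "c \<in> A" "\<gamma> (?h t) \<in> fst c" using cover by blast
  obtain D where D: "\<And>t. t \<in> {a..b} \<Longrightarrow> \<gamma> t \<in> fst c \<Longrightarrow> ((snd c \<circ> \<gamma>) has_vector_derivative D t) (at t within {a..b})"
    using C1_curveD[OF assms(1) c(1)] by blast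
  have h: "?h ` ?I \<subseteq> {a..b}" using assms(4) by (auto simp: field_simps)
  have "(?h has_vector_derivative 1 / k) (at t within ?I)"
    unfolding has_real_derivative_iff_has_vector_derivative[symmetric] using assms(4) by (auto intro!: derivative_eq_intros)
  moreover have "((snd c \<circ> \<gamma>) has_vector_derivative D (?h t)) (at (?h t) within ?h ` ?I)"
    by (rule has_vector_derivative_within_subset[OF D(1) h]) (use c ht in auto)
  ultimately have "((snd c \<circ> \<gamma>) \<circ> ?h has_vector_derivative (1 / k) *\<^sub>R D (?h t)) (at t within ?I)"
    by (rule vector_diff_chain_within)
  then have d': "((snd c \<circ> \<gamma>') has_vector_derivative (1 / k) *\<^sub>R D (?h t)) (at t within ?I)"
    by (rule has_vector_derivative_transform[OF tI, rotated]) (use assms(7) in auto)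
  have "curve_speed A g \<gamma>' t = sqrt (metric_form (g c) (snd c (\<gamma>' t)) ((1 / k) *\<^sub>R D (?h t)) ((1 / k) *\<^sub>R D (?h t)))"
    by (rule speed_interior[OF C' assms(5,6,8) c(1) _ d']) (use assms(7)[OF tI] c in auto)
  also have "\<dots> = (1 / k) * sqrt (metric_form (g c) (snd c (\<gamma> (?h t))) (D (?h t)) (D (?h t)))"
    using assms(4) by (simp add: metric_form_simps assms(7)[OF tI] real_sqrt_divide power2_eq_square[symmetric])
  also have "sqrt (metric_form (g c) (snd c (\<gamma> (?h t))) (D (?h t)) (D (?h t))) = curve_speed A g \<gamma> (?h t)"
    by (rule speed_interior[OF assms(1-3) ht c(1,2), symmetric]) (use D c ht in auto)
  finally show ?thesis .
qed

text \<open>By the chain rule the speeds agree up to the factor 1/k except at the images of the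
  break points, which are finitely many; the substitution cancels that factor.\<close>

lemma length_affine:
  assumes "piecewise_C1_curve M A \<gamma>" "k > 0" "0 \<le> r" "k + r \<le> 1"
    "\<And>t. t \<in> {r..k + r} \<Longrightarrow> \<gamma>' t = \<gamma> ((t - r) / k)"
  shows "(curve_speed A g \<gamma>' has_integral curve_length A g \<gamma>) {r..k + r}"
proof -
  obtain N :: nat and s where s: "s 0 = 0" "s N = 1" "\<And>i. i < N \<Longrightarrow> s i < s (Suc i)" "\<And>i. i < N \<Longrightarrow> C1_curve M A (s i) (s (Suc i)) \<gamma>"
    using assms unfolding piecewise_C1_curve_def by blast
  have mono: "s i \<le> s j" if "i \<le> j" "j \<le> N" for i j by (rule partition_mono[of N s i j]) (use s(3) that in auto)
  have bd: "0 \<le> s i" "s i \<le> 1" if "i \<le> N" for i using mono[of 0 i] mono[of i N] that s(1,2) by auto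
  let ?F = "(\<lambda>i. s i * k + r) ` {..N}"
  have len: "(curve_speed A g \<gamma> has_integral curve_length A g \<gamma>) (cbox 0 1)"
    using speed_integrable[OF assms(1)] by (simp add: curve_length_def integrable_integral)
  have "((\<lambda>x. curve_speed A g \<gamma> ((x - r) / k)) has_integral (k * curve_length A g \<gamma>)) ((\<lambda>x. k * x + r) ` {0..1})"
  proof -
    have "(\<lambda>x. (1 / (1 / k)) *\<^sub>R x + - ((1 / (1 / k)) *\<^sub>R (- r / k))) = (\<lambda>x. k * x + r)"
      "(\<lambda>x. curve_speed A g \<gamma> ((1 / k) *\<^sub>R x + - r / k)) = (\<lambda>x. curve_speed A g \<gamma> ((x - r) / k))"
      "(1 / \<bar>1 / k\<bar> ^ DIM(real)) *\<^sub>R curve_length A g \<gamma> = k * curve_length A g \<gamma>"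
      using assms(2) by (simp_all add: diff_divide_distrib)
    then show ?thesis using has_integral_affinity[OF len, of "1 / k" "- r / k"] assms(2) by (simp only: cbox_interval) simp
  qed
  moreover have "(\<lambda>x. k * x + r) ` {0..1} = {r..k + r}"
    using assms(2) image_affinity_atLeastAtMost[of k r 0 1] by (simp add: algebra_simps)
  ultimately have "((\<lambda>x. curve_speed A g \<gamma> ((x - r) / k)) has_integral (k * curve_length A g \<gamma>)) {r..k + r}" by simp
  from has_integral_mult_right[OF this, of "1 / k"]
  have "((\<lambda>x. (1 / k) * curve_speed A g \<gamma> ((x - r) / k)) has_integral curve_length A g \<gamma>) {r..k + r}"
    using assms(2) by simp
  then show ?thesis
  proof (rule has_integral_spike_finite[rotated 2])
    show "finite ?F" by simp
    fix t assume t: "t \<in> {r..k + r} - ?F"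
    define q where "q = (t - r) / k"
    have tq: "t = q * k + r" using assms(2) by (simp add: q_def)
    have q: "q \<in> {0..1}" using t assms(2) by (auto simp: q_def field_simps)
    have qn: "q \<noteq> s i" if "i \<le> N" for i using t tq that by auto
    have "\<exists>i<N. q \<in> {s i<..<s (Suc i)}"
    proof -
      have claim: "q < s j \<Longrightarrow> j \<le> N \<Longrightarrow> \<exists>i<N. q \<in> {s i<..<s (Suc i)}" for j
      proof (induction j)
        case 0
        then show ?case using s(1) q by auto
      next
        case (Suc j)
        then show ?case using qn[of j] by (cases "q < s j") (auto intro!: exI[of _ j])
      qed
      have "q < s N" using qn[of N] s(2) q by auto
      then show ?thesis using claim[of N] by blast
    qed
    then obtain i where i: "i < N" "q \<in> {s i<..<s (Suc i)}" by blast
    have *: "0 \<le> s i * k + r" "s (Suc i) * k + r \<le> 1"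
      using bd[of i] bd[of "Suc i"] i assms(2-4) by (auto intro: add_nonneg_nonneg) (smt (verit) mult_left_le_one_le)
    show "curve_speed A g \<gamma>' t = (1 / k) * curve_speed A g \<gamma> ((t - r) / k)"
    proof (rule speed_affine[OF s(4)[OF i(1)] _ _ assms(2) *])
      show "t \<in> {s i * k + r<..<s (Suc i) * k + r}" using i(2) assms(2) by (simp add: tq)
      fix u assume u: "u \<in> {s i * k + r..s (Suc i) * k + r}"
      have "0 \<le> s i * k" "s (Suc i) * k \<le> k" using bd[of i] bd[of "Suc i"] i assms(2) by (auto simp: mult_le_cancel_right1 intro: mult_left_le_one_le)
      then show "\<gamma>' u = \<gamma> ((u - r) / k)" using u by (intro assms(5)) auto
    qed (use bd[of i] bd[of "Suc i"] i in auto)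
  qed
qed

text \<open>Concatenates, at double speed, two curves whose lengths exceed a and b by less than e/2.
  Real upper bounds spare the case distinction on infinite distances.\<close>

lemma dist_triangle_riem:
  assumes "riemannian_dist M A g p q \<le> ereal a" "riemannian_dist M A g q r \<le> ereal b"
  shows "riemannian_dist M A g p r \<le> ereal (a + b)"
proof -
  let ?C = "\<lambda>p q. {\<gamma>. piecewise_C1_curve M A \<gamma> \<and> \<gamma> 0 = p \<and> \<gamma> 1 = q}"
  have join: "riemannian_dist M A g p r \<le> ereal (curve_length A g \<gamma>1) + ereal (curve_length A g \<gamma>2)"
    if h: "\<gamma>1 \<in> ?C p q" "\<gamma>2 \<in> ?C q r" for \<gamma>1 \<gamma>2
  proof -
    define \<gamma> where "\<gamma> t = (if t \<le> 1/2 then \<gamma>1 ((t - 0) / (1/2)) else \<gamma>2 ((t - 1/2) / (1/2)))" for t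
    have e1: "\<gamma> t = \<gamma>1 ((t - 0) / (1/2))" if "t \<in> {0..1/2}" for t using that by (auto simp: \<gamma>_def)
    have e2: "\<gamma> t = \<gamma>2 ((t - 1/2) / (1/2))" if "t \<in> {1/2..1}" for t using that h by (auto simp: \<gamma>_def)
    have l1: "(curve_speed A g \<gamma> has_integral curve_length A g \<gamma>1) {0..1/2}"
      using length_affine[of \<gamma>1 "1/2" 0 \<gamma>] h e1 by simp
    have l2: "(curve_speed A g \<gamma> has_integral curve_length A g \<gamma>2) {1/2..1}"
      using length_affine[of \<gamma>2 "1/2" "1/2" \<gamma>] h e2 by simp
    have "(curve_speed A g \<gamma> has_integral curve_length A g \<gamma>1 + curve_length A g \<gamma>2) {0..1}"
      by (rule has_integral_combine[OF _ _ l1 l2]) auto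
    then have len: "curve_length A g \<gamma> = curve_length A g \<gamma>1 + curve_length A g \<gamma>2"
      by (simp add: curve_length_def integral_unique)
    obtain N1 :: nat and s1 where s1: "s1 0 = 0" "s1 N1 = 1" "\<And>i. i < N1 \<Longrightarrow> s1 i < s1 (Suc i)" "\<And>i. i < N1 \<Longrightarrow> C1_curve M A (s1 i) (s1 (Suc i)) \<gamma>1"
      using h unfolding piecewise_C1_curve_def by blast
    obtain N2 :: nat and s2 where s2: "s2 0 = 0" "s2 N2 = 1" "\<And>i. i < N2 \<Longrightarrow> s2 i < s2 (Suc i)" "\<And>i. i < N2 \<Longrightarrow> C1_curve M A (s2 i) (s2 (Suc i)) \<gamma>2"
      using h unfolding piecewise_C1_curve_def by blast
    \<comment> \<open>The break points of both halves; at i = N1 the two formulas agree, since s1 N1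
      = 1 and s2 0 = 0.\<close>
    define s where "s i = (if i \<le> N1 then s1 i * (1/2) + 0 else s2 (i - N1) * (1/2) + 1/2)" for i
    have N2s: "s (N1 + j) = s2 j * (1/2) + 1/2" for j using s1(2) s2(1) by (auto simp: s_def)
    have "s i < s (Suc i) \<and> C1_curve M A (s i) (s (Suc i)) \<gamma>" if "i < N1 + N2" for i
    proof (cases "i < N1")
      case True
      have b: "0 \<le> s1 i" "s1 (Suc i) \<le> 1"
        using partition_mono[of N1 s1 0 i] partition_mono[of N1 s1 "Suc i" N1] True s1(1-3) by auto
      have "C1_curve M A (s1 i * (1/2) + 0) (s1 (Suc i) * (1/2) + 0) \<gamma>"
        by (rule C1_curve_cong[OF C1_curve_affine[OF s1(4)[OF True]]], simp, rule e1, use b in auto)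
      then show ?thesis using True s1(3)[OF True] by (simp add: s_def)
    next
      case False
      define j where "j = i - N1"
      have j: "i = N1 + j" "j < N2" using False that by (auto simp: j_def)
      have b: "0 \<le> s2 j" "s2 (Suc j) \<le> 1"
        using partition_mono[of N2 s2 0 j] partition_mono[of N2 s2 "Suc j" N2] j s2(1-3) by auto
      have "C1_curve M A (s2 j * (1/2) + 1/2) (s2 (Suc j) * (1/2) + 1/2) \<gamma>"
        by (rule C1_curve_cong[OF C1_curve_affine[OF s2(4)[OF j(2)]]], simp, rule e2, use b in auto)
      then show ?thesis using s2(3)[OF j(2)] N2s[of j] N2s[of "Suc j"] j(1) by simp
    qed
    moreover have "s 0 = 0" "s (N1 + N2) = 1" using s1(1) s2(2) N2s[of N2] by (auto simp: s_def)
    ultimately have "piecewise_C1_curve M A \<gamma>" unfolding piecewise_C1_curve_def by blast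
    moreover have "\<gamma> 0 = p" "\<gamma> 1 = r" using h by (auto simp: \<gamma>_def)
    ultimately have "riemannian_dist M A g p r \<le> ereal (curve_length A g \<gamma>)"
      unfolding riemannian_dist_def by (intro INF_lower) auto
    then show ?thesis by (simp add: len)
  qed
  show ?thesis
  proof (rule ereal_le_epsilon2)
    fix e :: real assume e: "0 < e"
    have ex: "\<exists>\<gamma>\<in>?C p' q'. curve_length A g \<gamma> < u + e / 2"
      if "riemannian_dist M A g p' q' \<le> ereal u" for p' q' u
    proof -
      have "riemannian_dist M A g p' q' < ereal (u + e / 2)"
        by (rule order_le_less_trans[OF that]) (use e in simp)
      then show ?thesis unfolding riemannian_dist_def INF_less_iff by auto
    qed
    obtain \<gamma>1 where g1: "\<gamma>1 \<in> ?C p q" "curve_length A g \<gamma>1 < a + e / 2" using ex[OF assms(1)] by blast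
    obtain \<gamma>2 where g2: "\<gamma>2 \<in> ?C q r" "curve_length A g \<gamma>2 < b + e / 2" using ex[OF assms(2)] by blast
    have "riemannian_dist M A g p r \<le> ereal (curve_length A g \<gamma>1 + curve_length A g \<gamma>2)"
      using join[OF g1(1) g2(1)] by simp
    also have "\<dots> \<le> ereal (a + b + e)" using g1 g2 by simp
    finally show "riemannian_dist M A g p r \<le> ereal (a + b) + ereal e" by simp
  qed
qed

text \<open>A curve that is C^1 in one chart is so in all others by smoothness of the transitions,
  hence is admissible in the infimum.\<close>

lemma dist_chart_curve_unit:
  assumes "c \<in> A" "\<And>t. t \<in> {0..1} \<Longrightarrow> x t \<in> chart_image c"
    "\<And>t. t \<in> {0..1} \<Longrightarrow> (x has_vector_derivative x' t) (at t within {0..1})" "continuous_on {0..1} x'"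
  shows "riemannian_dist M A g (chart_inv c (x 0)) (chart_inv c (x 1))
     \<le> ereal (integral {0..1} (\<lambda>t. sqrt (metric_form (g c) (x t) (x' t) (x' t))))"
proof -
  define \<gamma> where "\<gamma> t = chart_inv c (x t)" for t
  have cx: "continuous_on {0..1} x"
    using assms(3) by (meson continuous_on_eq_continuous_within has_vector_derivative_continuous)
  have \<gamma>c: "\<gamma> t \<in> fst c" "snd c (\<gamma> t) = x t" if "t \<in> {0..1}" for t
    using inv_in[OF assms(2)[OF that]] inv_right[OF assms(2)[OF that]] by (auto simp: \<gamma>_def)
  have cm: "continuous_map (top_of_set {0..1}) M \<gamma>"
  proof -
    have "continuous_map (top_of_set {0..1}) (top_of_set (chart_image c)) x"
      using cx assms(2) by (auto simp: continuous_map_in_subtopology)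
    from continuous_map_compose[OF this continuous_inv[OF assms(1)]] show ?thesis by (simp add: o_def \<gamma>_def[abs_def])
  qed
  have vc: "((snd c \<circ> \<gamma>) has_vector_derivative x' t) (at t within {0..1})" if "t \<in> {0..1}" for t
    by (rule has_vector_derivative_transform[OF that _ assms(3)[OF that]]) (use \<gamma>c in auto)
  have vd: "((snd d \<circ> \<gamma>) has_vector_derivative dd (transition c d) (x t) (x' t)) (at t within {0..1})"
    if "t \<in> {0..1}" "d \<in> A" "\<gamma> t \<in> fst d" for t d
    using velocity_change[OF assms(1) that(2) cm that(1) \<gamma>c(1)[OF that(1)] that(3) vc[OF that(1)]] \<gamma>c(2)[OF that(1)] by simp
  have "C1_curve M A 0 1 \<gamma>" unfolding C1_curve_def
  proof (intro conjI cm ballI)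
    fix d assume d: "d \<in> A"
    have "continuous_on {t\<in>{0..1}. \<gamma> t \<in> fst d} (\<lambda>t. dd (transition c d) (x t) (x' t))"
    proof (intro continuous_on_dd[OF smooth_transition[OF assms(1) d]] continuous_on_subset[OF cx] continuous_on_subset[OF assms(4)])
      fix t assume "t \<in> {t\<in>{0..1}. \<gamma> t \<in> fst d}"
      then show "x t \<in> overlap c d" using \<gamma>c[of t] by (metis (mono_tags, lifting) IntI imageI mem_Collect_eq)
    qed auto
    then show "\<exists>D. (\<forall>t\<in>{0..1}. \<gamma> t \<in> fst d \<longrightarrow> ((snd d \<circ> \<gamma>) has_vector_derivative D t) (at t within {0..1})) \<and>
        continuous_on {t\<in>{0..1}. \<gamma> t \<in> fst d} D"
      using vd[OF _ d] by (intro exI[of _ "\<lambda>t. dd (transition c d) (x t) (x' t)"] conjI ballI impI)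
  qed
  then have "piecewise_C1_curve M A \<gamma>" unfolding piecewise_C1_curve_def
    by (intro exI[of _ "1::nat"] exI[of _ real]) auto
  then have "riemannian_dist M A g (\<gamma> 0) (\<gamma> 1) \<le> ereal (curve_length A g \<gamma>)"
    unfolding riemannian_dist_def by (intro INF_lower) auto
  moreover have "curve_length A g \<gamma> = integral {0..1} (\<lambda>t. sqrt (metric_form (g c) (x t) (x' t) (x' t)))"
    unfolding curve_length_def
  proof (rule integral_cong)
    fix t :: real assume t: "t \<in> {0..1}"
    define d where "d = chart_at A (\<gamma> t)"
    have "\<gamma> t \<in> topspace M" using \<gamma>c(1)[OF t] domain_subset[OF assms(1)] by blast
    from chart_at[OF this] have d: "d \<in> A" "\<gamma> t \<in> fst d" by (auto simp: d_def)
    \<comment> \<open>The derivative within [0, 1] is unique at the end points as well, so no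
      exceptional times arise.\<close>
    have "vector_derivative (snd d \<circ> \<gamma>) (at t within {0..1}) = dd (transition c d) (x t) (x' t)"
      using vector_derivative_within_cbox[of 0 1 t, unfolded cbox_interval, OF _ t vd[OF t d]] by simp
    then show "curve_speed A g \<gamma> t = sqrt (metric_form (g c) (x t) (x' t) (x' t))"
      using metric_transition[OF assms(1) d(1) \<gamma>c(1)[OF t] d(2)] \<gamma>c(2)[OF t]
      by (simp add: curve_speed_def d_def[symmetric] Let_def)
  qed
  ultimately show ?thesis by (simp add: \<gamma>_def)
qed

text \<open>Affine reparametrization to the unit interval. The degenerate case a = b is included; it
  bounds the distance of a point to itself by 0.\<close>

lemma dist_chart_curve:
  assumes "c \<in> A" "a \<le> b" "\<And>t. t \<in> {a..b} \<Longrightarrow> x t \<in> chart_image c"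
    "\<And>t. t \<in> {a..b} \<Longrightarrow> (x has_vector_derivative x' t) (at t within {a..b})" "continuous_on {a..b} x'"
  shows "riemannian_dist M A g (chart_inv c (x a)) (chart_inv c (x b))
     \<le> ereal (integral {a..b} (\<lambda>t. sqrt (metric_form (g c) (x t) (x' t) (x' t))))"
proof -
  interpret c: riem_chart "chart_image c" "g c" by (rule riem_chart[OF assms(1)])
  let ?h = "\<lambda>u. a + u * (b - a)"
  have h: "?h ` {0..1} \<subseteq> {a..b}"
  proof clarify
    fix u :: real assume "u \<in> {0..1}"
    then have "0 \<le> u * (b - a)" "u * (b - a) \<le> 1 * (b - a)" using assms(2) by (auto intro!: mult_nonneg_nonneg mult_left_le_one_le)
    then show "?h u \<in> {a..b}" by simp
  qed
  have cx: "continuous_on {a..b} x"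
    using assms(4) by (meson continuous_on_eq_continuous_within has_vector_derivative_continuous)
  define q where "q t = sqrt (metric_form (g c) (x t) (x' t) (x' t))" for t
  have cq: "continuous_on {a..b} q" unfolding q_def
    by (intro continuous_on_real_sqrt c.continuous_on_metric cx assms)
  have d: "(x \<circ> ?h has_vector_derivative (b - a) *\<^sub>R x' (?h u)) (at u within {0..1})" if "u \<in> {0..1}" for u
  proof (rule vector_diff_chain_within)
    show "(?h has_vector_derivative (b - a)) (at u within {0..1})"
      unfolding has_real_derivative_iff_has_vector_derivative[symmetric] by (auto intro!: derivative_eq_intros)
    show "(x has_vector_derivative x' (?h u)) (at (?h u) within ?h ` {0..1})"
      by (rule has_vector_derivative_within_subset[OF assms(4) h]) (use h that in blast)
  qed
  have "riemannian_dist M A g (chart_inv c ((x \<circ> ?h) 0)) (chart_inv c ((x \<circ> ?h) 1))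
     \<le> ereal (integral {0..1} (\<lambda>u. sqrt (metric_form (g c) ((x \<circ> ?h) u) ((b - a) *\<^sub>R x' (?h u)) ((b - a) *\<^sub>R x' (?h u)))))"
  proof (rule dist_chart_curve_unit[OF assms(1) _ d])
    show "(x \<circ> ?h) t \<in> chart_image c" if "t \<in> {0..1}" for t
      unfolding o_apply by (rule assms(3)) (use h that in blast)
    show "continuous_on {0..1} (\<lambda>u. (b - a) *\<^sub>R x' (?h u))"
      by (intro continuous_on_scaleR continuous_on_const continuous_on_compose2[OF assms(5) _ h]) (auto intro!: continuous_intros)
  qed
  moreover have "integral {0..1} (\<lambda>u. sqrt (metric_form (g c) ((x \<circ> ?h) u) ((b - a) *\<^sub>R x' (?h u)) ((b - a) *\<^sub>R x' (?h u)))) = integral {a..b} q"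
  proof -
    have hi: "((\<lambda>u. (b - a) *\<^sub>R q (?h u)) has_integral integral {?h 0..?h 1} q) {0..1}"
    proof (rule has_integral_substitution[where c = a and d = b])
      show "(?h has_real_derivative (b - a)) (at u within {0..1})" for u by (auto intro!: derivative_eq_intros)
    qed (use assms(2) h cq in auto)
    have eq: "sqrt (metric_form (g c) ((x \<circ> ?h) u) ((b - a) *\<^sub>R x' (?h u)) ((b - a) *\<^sub>R x' (?h u))) = (b - a) *\<^sub>R q (?h u)" for u
      using assms(2) by (simp add: metric_form_simps q_def real_sqrt_mult mult.assoc[symmetric])
    show ?thesis unfolding eq using integral_unique[OF hi] by (simp del: integral_mult_right integral_scaleR_right integral_cmul)
  qed
  ultimately show ?thesis by (simp add: q_def[abs_def])
qed

text \<open>The coordinate segment from x to y serves as the competitor.\<close>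

lemma dist_le_norm:
  assumes "c \<in> A" "compact K" "K \<subseteq> chart_image c"
  obtains C where "C > 0" "\<And>x y. closed_segment x y \<subseteq> K \<Longrightarrow>
     riemannian_dist M A g (chart_inv c x) (chart_inv c y) \<le> ereal (C * norm (x - y))"
proof -
  interpret c: riem_chart "chart_image c" "g c" by (rule riem_chart[OF assms(1)])
  obtain C where C: "C > 0" "\<And>x v. x \<in> K \<Longrightarrow> c.m x v v \<le> C * (norm v)\<^sup>2" using c.metric_bounds[OF assms(2,3)] by metis
  have "riemannian_dist M A g (chart_inv c x) (chart_inv c y) \<le> ereal (sqrt C * norm (x - y))"
    if "closed_segment x y \<subseteq> K" for x y
  proof -
    define z where "z t = x + t *\<^sub>R (y - x)" for t
    have z: "z t \<in> K" if "t \<in> {0..1}" for t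
    proof -
      have "z t \<in> closed_segment x y"
        using that unfolding closed_segment_def z_def by (auto intro!: exI[of _ t] simp: algebra_simps)
      then show ?thesis using \<open>closed_segment x y \<subseteq> K\<close> by blast
    qed
    have cz: "continuous_on {0..1} z" unfolding z_def by (intro continuous_intros)
    have "riemannian_dist M A g (chart_inv c (z 0)) (chart_inv c (z 1)) \<le> ereal (integral {0..1} (\<lambda>t. sqrt (c.m (z t) (y - x) (y - x))))"
    proof (rule dist_chart_curve[OF assms(1)])
      show "(z has_vector_derivative y - x) (at t within {0..1})" for t unfolding z_def
        by (auto intro!: derivative_eq_intros)
    qed (use z assms(3) in auto)
    also have "integral {0..1} (\<lambda>t. sqrt (c.m (z t) (y - x) (y - x))) \<le> integral {0..1} (\<lambda>t::real. sqrt C * norm (y - x))"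
    proof (rule integral_le)
      show "(\<lambda>t. sqrt (c.m (z t) (y - x) (y - x))) integrable_on {0..1}"
        by (intro integrable_continuous_real continuous_on_real_sqrt c.continuous_on_metric cz continuous_on_const) (use z assms(3) in auto)
      fix t :: real assume "t \<in> {0..1}"
      from real_sqrt_le_mono[OF C(2)[OF z[OF this], of "y - x"]]
      show "sqrt (c.m (z t) (y - x) (y - x)) \<le> sqrt C * norm (y - x)" by (simp add: real_sqrt_mult)
    qed (rule integrable_continuous_real, rule continuous_on_const)
    finally show ?thesis by (simp add: z_def norm_minus_commute)
  qed
  then show ?thesis using C that[of "sqrt C"] by simp
qed

text \<open>The distance is infinite if no curve joins the points. Segments in charts make it finite
  locally, so the points at finite distance from p form an open and closed set.\<close>

lemma dist_finite:
  assumes "connected_space M" "p \<in> topspace M" "q \<in> topspace M"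
  shows "\<exists>r. riemannian_dist M A g p q \<le> ereal r"
proof -
  define S where "S = {q \<in> topspace M. \<exists>r. riemannian_dist M A g p q \<le> ereal r}"
  have loc: "\<exists>V. openin M V \<and> q \<in> V \<and> (\<forall>q1\<in>V. \<forall>q2\<in>V. \<exists>r. riemannian_dist M A g q1 q2 \<le> ereal r)" if "q \<in> topspace M" for q
  proof -
    obtain c where c: "c \<in> A" "q \<in> fst c" using cover \<open>q \<in> topspace M\<close> by blast
    then obtain e where e: "e > 0" "cball (snd c q) e \<subseteq> chart_image c"
      using chart(2)[OF c(1)] open_contains_cball by blast
    obtain C where "C > 0" and C: "\<And>x y. closed_segment x y \<subseteq> cball (snd c q) e \<Longrightarrow>
     riemannian_dist M A g (chart_inv c x) (chart_inv c y) \<le> ereal (C * norm (x - y))"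
      using dist_le_norm[OF c(1) compact_cball e(2)] by blast
    define V where "V = {p \<in> fst c. snd c p \<in> ball (snd c q) e}"
    have "openin (subtopology M (fst c)) V"
      unfolding V_def
      by (rule openin_continuous_map_preimage[OF continuous_chart[OF c(1)], of "ball (snd c q) e", unfolded topspace_domain[OF c(1)]])
        (simp add: open_openin[symmetric])
    then have "openin M V" using openin_trans_full[OF _ chart(1)[OF c(1)]] by blast
    moreover have "\<exists>r. riemannian_dist M A g q1 q2 \<le> ereal r" if "q1 \<in> V" "q2 \<in> V" for q1 q2
    proof -
      have "closed_segment (snd c q1) (snd c q2) \<subseteq> cball (snd c q) e"
        using that by (intro closed_segment_subset) (auto simp: V_def)
      from C[OF this] show ?thesis using that inv_left[OF c(1)] by (auto simp: V_def)
    qed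
    ultimately show ?thesis using c e by (intro exI[of _ V]) (auto simp: V_def)
  qed
  have "openin M S"
  proof (subst openin_subopen, rule ballI)
    fix q assume q: "q \<in> S"
    then obtain V where V: "openin M V" "q \<in> V" "\<forall>q1\<in>V. \<forall>q2\<in>V. \<exists>r. riemannian_dist M A g q1 q2 \<le> ereal r"
      using loc[of q] unfolding S_def by blast
    have "V \<subseteq> S"
    proof
      fix q' assume q': "q' \<in> V"
      then obtain a where a: "riemannian_dist M A g q q' \<le> ereal a" using V by blast
      obtain b where "riemannian_dist M A g p q \<le> ereal b" using q by (auto simp: S_def)
      from dist_triangle_riem[OF this a] show "q' \<in> S" using q' openin_subset[OF V(1)] by (auto simp: S_def)
    qed
    then show "\<exists>T. openin M T \<and> q \<in> T \<and> T \<subseteq> S" using V by blast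
  qed
  moreover have "openin M (topspace M - S)"
  proof (subst openin_subopen, rule ballI)
    fix q assume q: "q \<in> topspace M - S"
    then obtain V where V: "openin M V" "q \<in> V" "\<forall>q1\<in>V. \<forall>q2\<in>V. \<exists>r. riemannian_dist M A g q1 q2 \<le> ereal r"
      using loc[of q] by blast
    have "V \<inter> S = {}"
    proof (rule ccontr)
      assume "V \<inter> S \<noteq> {}"
      then obtain q' where q': "q' \<in> V" "q' \<in> S" by blast
      then obtain a where a: "riemannian_dist M A g q' q \<le> ereal a" using V by blast
      obtain b where "riemannian_dist M A g p q' \<le> ereal b" using q' by (auto simp: S_def)
      from dist_triangle_riem[OF this a] have "q \<in> S" using q by (auto simp: S_def)
      then show False using q by blast
    qed
    then show "\<exists>T. openin M T \<and> q \<in> T \<and> T \<subseteq> topspace M - S" using V openin_subset[OF V(1)] by blast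
  qed
  moreover have "S \<subseteq> topspace M" by (auto simp: S_def)
  moreover have "p \<in> S" using loc[OF assms(2)] assms(2) by (auto simp: S_def)
  ultimately have "S = topspace M" using assms(1) unfolding connected_space_clopen_in closedin_def by blast
  then show ?thesis using assms(3) by (auto simp: S_def)
qed

end

section \<open>Compact shrinking solitons\<close>

context riem_chart_function begin

lemma \<xi>_stay:
  assumes "compact K" "K \<subseteq> V" "open V" "V \<subseteq> U"
  shows "\<exists>s0>0. \<forall>\<sigma> x e \<alpha>. \<bar>\<sigma>\<bar> \<le> s0 \<longrightarrow> x \<in> K \<longrightarrow> norm e \<le> C \<longrightarrow> \<bar>\<alpha>\<bar> \<le> 1 \<longrightarrow> \<xi> x e \<alpha> \<sigma> \<in> V"
proof -
  define P where "P = K \<times> cball (0::real^'n) C \<times> {-1..1::real}"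
  have "compact P" unfolding P_def by (intro compact_Times assms) auto
  have "continuous_on ({-1..1::real} \<times> P) (\<lambda>(\<sigma>, x, e, \<alpha>). \<xi> x e \<alpha> \<sigma>)"
    unfolding \<xi>_def Y_def case_prod_unfold
    by (intro continuous_intros continuous_on_Gam continuous_on_compose2[OF smooth_on_continuous[OF smooth_X]])
      (use assms(2,4) in \<open>auto simp: P_def\<close>)
  from uniform_stay_open[OF \<open>compact P\<close> this assms(3)] assms(2)
  obtain s0 where s0: "s0 > 0" "\<And>\<sigma> p. \<bar>\<sigma>\<bar> \<le> s0 \<Longrightarrow> p \<in> P \<Longrightarrow> (\<lambda>(\<sigma>, x, e, \<alpha>). \<xi> x e \<alpha> \<sigma>) (\<sigma>, p) \<in> V"
    by (force simp: P_def \<xi>_def)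
  have "\<xi> x e \<alpha> \<sigma> \<in> V" if "\<bar>\<sigma>\<bar> \<le> s0" "x \<in> K" "norm e \<le> C" "\<bar>\<alpha>\<bar> \<le> 1" for \<sigma> x e \<alpha>
    using s0(2)[of \<sigma> "(x, e, \<alpha>)"] that by (auto simp: P_def abs_le_iff)
  then show ?thesis using s0(1) by blast
qed

lemma frame_bounded:
  assumes "compact K" "K \<subseteq> U"
  obtains C where "C > 0" "\<And>x E a. x \<in> K \<Longrightarrow> orthonormal_frame G x E \<Longrightarrow> norm (E a) \<le> C"
proof -
  obtain c where c: "c > 0" "\<And>x v. x \<in> K \<Longrightarrow> c * (norm v)\<^sup>2 \<le> m x v v" using metric_bounds[OF assms] by metis
  have "norm (E a) \<le> 1 / sqrt c" if "x \<in> K" "orthonormal_frame G x E" for x E a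
  proof -
    have "c * (norm (E a))\<^sup>2 \<le> 1" using c(2)[OF that(1), of "E a"] that(2) by (simp add: orthonormal_frame_def)
    then have "(norm (E a))\<^sup>2 \<le> 1 / c" using c(1) by (simp add: field_simps)
    then show ?thesis using real_le_rsqrt real_sqrt_divide by fastforce
  qed
  then show ?thesis using c(1) that[of "1 / sqrt c"] by simp
qed

end

locale soliton_manifold = riem_manifold M A g
  for M :: "'a topology" and A :: "('a, 'n::finite) chart set" and g +
  fixes f :: "'a \<Rightarrow> real" and l :: real
  assumes compact: "compact_space M" and nonempty: "topspace M \<noteq> {}"
    and l_pos: "l > 0" and smooth_f: "smooth_function A f"
    and soliton: "gradient_soliton_equation A g f l"
    and normalized: "\<forall>p\<in>topspace M. scalar_curvature A g p + grad_norm_sq A g f p = 2 * l * f p"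
begin

abbreviation F where "F c \<equiv> coord_rep c f"

lemma soliton_chart: assumes "c \<in> A" shows "soliton_chart (chart_image c) (g c) (F c) l"
proof -
  interpret c: riem_chart "chart_image c" "g c" by (rule riem_chart[OF assms])
  show ?thesis
    using smooth_f soliton assms unfolding smooth_function_def gradient_soliton_equation_def by unfold_locales blast+
qed

lemma F_eq: "c \<in> A \<Longrightarrow> p \<in> fst c \<Longrightarrow> F c (snd c p) = f p"
  by (simp add: coord_rep_def inv_left)

text \<open>\<open>chart_at\<close> picks some chart. The gradient norm is invariant under
  isometries, and the scalar curvature is l n - tr H, whose trace is invariant under
  conjugation.\<close>

lemma chart_invariance:
  assumes "c \<in> A" "p \<in> fst c"
  shows "grad_norm_sq A g f p = metric_form (g c) (snd c p) (gradient (g c) (F c) (snd c p)) (gradient (g c) (F c) (snd c p))"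
    "scalar_curvature A g p = scalar_curvature_coord (g c) (snd c p)"
proof -
  have p: "p \<in> topspace M" using assms domain_subset by blast
  define d where "d = chart_at A p"
  have d: "d \<in> A" "p \<in> fst d" using chart_at[OF p] by (auto simp: d_def)
  interpret cc: chart_change "chart_image d" "chart_image c" "g d" "F d" "g c" "F c" "overlap d c" "transition d c"
    by (rule chart_change[OF d(1) assms(1) smooth_f])
  interpret c: soliton_chart "chart_image c" "g c" "F c" l by (rule soliton_chart[OF assms(1)])
  interpret d: soliton_chart "chart_image d" "g d" "F d" l by (rule soliton_chart[OF d(1)])
  have W: "snd d p \<in> overlap d c" using d assms by blast
  have tr: "transition d c (snd d p) = snd c p" by (rule transition_eq[OF d])
  show "grad_norm_sq A g f p = metric_form (g c) (snd c p) (gradient (g c) (F c) (snd c p)) (gradient (g c) (F c) (snd c p))"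
    using cc.grad_norm_change[OF W] by (simp add: grad_norm_sq_def d_def[symmetric] Let_def tr)
  show "scalar_curvature A g p = scalar_curvature_coord (g c) (snd c p)"
    using cc.trace_change[OF W] d(2) assms(2)
    by (simp add: scalar_curvature_def d_def[symmetric] Let_def c.scalar_curvature_trace d.scalar_curvature_trace tr)
qed

lemma scalar_curvature_chart:
  assumes "c \<in> A" "x \<in> chart_image c"
  shows "scalar_curvature_coord (g c) x = soliton_chart.Q (g c) (F c) l x"
proof -
  interpret c: soliton_chart "chart_image c" "g c" "F c" l by (rule soliton_chart[OF assms(1)])
  define p where "p = chart_inv c x"
  have p: "p \<in> fst c" "snd c p = x" using inv_in[OF assms(2)] inv_right[OF assms(2)] by (auto simp: p_def)
  then have "p \<in> topspace M" using domain_subset[OF assms(1)] by blast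
  then have "scalar_curvature A g p + grad_norm_sq A g f p = 2 * l * f p" using normalized by blast
  then show ?thesis using F_eq[OF assms(1) p(1)] by (simp add: chart_invariance[OF assms(1) p(1)] p(2) c.Q_def)
qed

lemma scalar_curvature_Q: "c \<in> A \<Longrightarrow> p \<in> fst c \<Longrightarrow> scalar_curvature A g p = soliton_chart.Q (g c) (F c) l (snd c p)"
  using chart_invariance(2) scalar_curvature_chart by simp

lemma continuous_local:
  fixes h :: "'a \<Rightarrow> real"
  assumes "\<And>c. c \<in> A \<Longrightarrow> \<exists>k. continuous_on (chart_image c) k \<and> (\<forall>p\<in>fst c. h p = k (snd c p))"
  shows "continuous_map M euclideanreal h"
  unfolding continuous_map_def
proof (intro conjI allI impI)
  fix V :: "real set" assume "openin euclideanreal V"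
  then have V: "open V" using open_openin by blast
  show "openin M {p \<in> topspace M. h p \<in> V}"
  proof (subst openin_subopen, rule ballI)
    fix p assume p: "p \<in> {p \<in> topspace M. h p \<in> V}"
    then obtain c where c: "c \<in> A" "p \<in> fst c" using cover by blast
    obtain k where k: "continuous_on (chart_image c) k" "\<forall>p\<in>fst c. h p = k (snd c p)" using assms[OF c(1)] by blast
    have op: "open (chart_image c \<inter> k -` V)" by (rule continuous_open_preimage[OF k(1) chart(2)[OF c(1)] V])
    have "openin (subtopology M (fst c)) {q \<in> fst c. snd c q \<in> chart_image c \<inter> k -` V}"
      by (rule openin_continuous_map_preimage[OF continuous_chart[OF c(1)], of "chart_image c \<inter> k -` V", unfolded topspace_domain[OF c(1)]])
        (use op open_openin in blast)
    then have "openin M {q \<in> fst c. snd c q \<in> chart_image c \<inter> k -` V}" using openin_trans_full[OF _ chart(1)[OF c(1)]] by blast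
    moreover have "{q \<in> fst c. snd c q \<in> chart_image c \<inter> k -` V} \<subseteq> {p \<in> topspace M. h p \<in> V}"
      using k(2) domain_subset[OF c(1)] by auto
    moreover have "p \<in> {q \<in> fst c. snd c q \<in> chart_image c \<inter> k -` V}" using c p k(2) by auto
    ultimately show "\<exists>T. openin M T \<and> p \<in> T \<and> T \<subseteq> {p \<in> topspace M. h p \<in> V}" by blast
  qed
qed auto

lemma attains_max:
  assumes "continuous_map M euclideanreal h"
  shows "\<exists>p\<in>topspace M. \<forall>q\<in>topspace M. h q \<le> h p"
proof -
  have "compactin euclideanreal (h ` topspace M)"
    using image_compactin[OF _ assms] compact compact_space_def by blast
  then have "Topological_Spaces.compact (h ` topspace M)" by simp
  then show ?thesis using compact_attains_sup[of "h ` topspace M"] nonempty by blast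
qed

lemma continuous_scalar_curvature: "continuous_map M euclideanreal (scalar_curvature A g)"
proof (rule continuous_local)
  fix c assume c: "c \<in> A"
  interpret c: soliton_chart "chart_image c" "g c" "F c" l by (rule soliton_chart[OF c])
  show "\<exists>k. continuous_on (chart_image c) k \<and> (\<forall>p\<in>fst c. scalar_curvature A g p = k (snd c p))"
    using smooth_on_continuous[OF c.smooth_Q] scalar_curvature_Q[OF c] by blast
qed

lemma continuous_f: "continuous_map M euclideanreal f"
proof (rule continuous_local)
  fix c assume c: "c \<in> A"
  show "\<exists>k. continuous_on (chart_image c) k \<and> (\<forall>p\<in>fst c. f p = k (snd c p))"
    using smooth_on_continuous[of "chart_image c" "F c"] smooth_f c F_eq[OF c] unfolding smooth_function_def by metis
qed

text \<open>A minimum over the compact space is a minimum in any chart around it, where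
  \<open>scalar_curvature_min_nonneg\<close> applies.\<close>

lemma scalar_curvature_nonneg:
  assumes "p \<in> topspace M" shows "scalar_curvature A g p \<ge> 0"
proof -
  obtain q where q: "q \<in> topspace M" "\<And>r. r \<in> topspace M \<Longrightarrow> scalar_curvature A g q \<le> scalar_curvature A g r"
    using attains_max[of "\<lambda>p. - scalar_curvature A g p"] continuous_scalar_curvature
    by (auto intro: continuous_map_minus)
  obtain c where c: "c \<in> A" "q \<in> fst c" using cover[OF q(1)] by blast
  interpret c: soliton_chart "chart_image c" "g c" "F c" l by (rule soliton_chart[OF c(1)])
  have "c.Q (snd c q) \<ge> 0"
  proof (rule c.scalar_curvature_min_nonneg)
    fix y assume y: "y \<in> chart_image c"
    show "scalar_curvature_coord (g c) y = c.Q y" by (rule scalar_curvature_chart[OF c(1) y])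
    show "c.Q (snd c q) \<le> c.Q y"
      using q(2)[of "chart_inv c y"] domain_subset[OF c(1)] inv_in[OF y] inv_right[OF y]
        scalar_curvature_Q[OF c] scalar_curvature_Q[OF c(1) inv_in[OF y]] by auto
  qed (use c l_pos in auto)
  then show ?thesis using q(2)[OF assms] scalar_curvature_Q[OF c] by simp
qed

definition Rmax where "Rmax = (GREATEST r. r \<in> scalar_curvature A g ` topspace M)"

lemma Rmax_ge: assumes "p \<in> topspace M" shows "scalar_curvature A g p \<le> Rmax"
proof -
  obtain q where q: "q \<in> topspace M" "\<forall>r\<in>topspace M. scalar_curvature A g r \<le> scalar_curvature A g q"
    using attains_max[OF continuous_scalar_curvature] by blast
  have "Rmax = scalar_curvature A g q" unfolding Rmax_def by (rule Greatest_equality) (use q in auto)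
  then show ?thesis using q assms by simp
qed

lemma Rmax_nonneg: "Rmax \<ge> 0"
  using nonempty Rmax_ge scalar_curvature_nonneg by (metis all_not_in_conv order_trans)

lemma f_bounds: assumes "p \<in> topspace M" shows "0 \<le> f p" "f p \<le> Rmax / (2 * l)"
proof -
  have grad: "grad_norm_sq A g f p \<ge> 0"
  proof -
    obtain c where c: "c \<in> A" "p \<in> fst c" using cover[OF assms] by blast
    interpret c: soliton_chart "chart_image c" "g c" "F c" l by (rule soliton_chart[OF c(1)])
    show ?thesis unfolding chart_invariance(1)[OF c]
      using c.metric_pos[of "snd c p"] c(2) by (cases "c.X (snd c p) = 0") (auto simp: metric_form_simps less_imp_le)
  qed
  then have "0 \<le> 2 * l * f p" using normalized assms scalar_curvature_nonneg[OF assms] by (metis add_nonneg_nonneg)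
  then show "0 \<le> f p" using l_pos by (simp add: zero_le_mult_iff)
  obtain q where q: "q \<in> topspace M" "\<forall>r\<in>topspace M. f r \<le> f q" using attains_max[OF continuous_f] by blast
  obtain c where c: "c \<in> A" "q \<in> fst c" using cover[OF q(1)] by blast
  interpret c: soliton_chart "chart_image c" "g c" "F c" l by (rule soliton_chart[OF c(1)])
  have xq: "snd c q \<in> chart_image c" using c by blast
  have "dd (F c) (snd c q) = (\<lambda>v. 0)"
  proof (rule differential_zero_maxmin[OF xq c.open_U smooth_on_has_derivative[OF c.smooth_F xq]], rule disjI1, rule ballI)
    fix y assume y: "y \<in> chart_image c"
    show "F c y \<le> F c (snd c q)"
      using q(2) inv_in[OF y] domain_subset[OF c(1)] F_eq[OF c] by (auto simp: coord_rep_def)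
  qed
  then have "c.X (snd c q) = 0" by (simp add: gradient_def partial_def vec_eq_iff matrix_vector_mult_def)
  then have "grad_norm_sq A g f q = 0" unfolding chart_invariance(1)[OF c] by (simp add: metric_form_simps)
  then have "2 * l * f q \<le> Rmax" using normalized q(1) Rmax_ge[OF q(1)] by (metis add.right_neutral)
  then have "f q \<le> Rmax / (2 * l)" using l_pos by (simp add: field_simps)
  then show "f p \<le> Rmax / (2 * l)" using q assms by force
qed

text \<open>A coordinate ball \<open>(c, y, \<rho>)\<close>; half balls will cover the manifold, and the double ball is still
  contained in the image of the chart.\<close>

definition good_ball where
  "good_ball = (\<lambda>(c, y, \<rho>). c \<in> A \<and> \<rho> > 0 \<and> cball y (2 * \<rho>) \<subseteq> chart_image c)"

lemma finite_cover:
  obtains I where "finite I" "\<And>i. i \<in> I \<Longrightarrow> good_ball i"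
    "\<And>p. p \<in> topspace M \<Longrightarrow> \<exists>(c, y, \<rho>)\<in>I. p \<in> fst c \<and> snd c p \<in> ball y (\<rho> / 2)"
proof -
  define V where "V = (\<lambda>(c::('a,'n) chart, y, \<rho>::real). {p \<in> fst c. snd c p \<in> ball y (\<rho> / 2)})"
  have op: "openin M (V i)" if "good_ball i" for i
  proof -
    obtain c y \<rho> where i: "i = (c, y, \<rho>)" by (cases i)
    then have c: "c \<in> A" using that by (simp add: good_ball_def)
    have "openin (subtopology M (fst c)) {p \<in> fst c. snd c p \<in> ball y (\<rho> / 2)}"
      by (rule openin_continuous_map_preimage[OF continuous_chart[OF c], of "ball y (\<rho> / 2)", unfolded topspace_domain[OF c]])
        (simp add: open_openin[symmetric])
    then show ?thesis using openin_trans_full[OF _ chart(1)[OF c]] by (simp add: V_def i)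
  qed
  have "topspace M \<subseteq> \<Union> (V ` {i. good_ball i})"
  proof
    fix p assume "p \<in> topspace M"
    then obtain c where c: "c \<in> A" "p \<in> fst c" using cover by blast
    then obtain e where e: "e > 0" "cball (snd c p) e \<subseteq> chart_image c"
      using chart(2)[OF c(1)] open_contains_cball by blast
    have "good_ball (c, snd c p, e / 2)" "p \<in> V (c, snd c p, e / 2)" using c e by (auto simp: good_ball_def V_def)
    then show "p \<in> \<Union> (V ` {i. good_ball i})" by blast
  qed
  moreover have "\<forall>S \<in> V ` {i. good_ball i}. openin M S" using op by auto
  ultimately obtain \<F> where F: "finite \<F>" "\<F> \<subseteq> V ` {i. good_ball i}" "topspace M \<subseteq> \<Union> \<F>"
    using compact unfolding compact_space_alt by meson
  obtain I where I: "finite I" "I \<subseteq> {i. good_ball i}" "\<F> = V ` I" using finite_subset_image[OF F(1,2)] by blast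
  have "\<exists>(c, y, \<rho>)\<in>I. p \<in> fst c \<and> snd c p \<in> ball y (\<rho> / 2)" if "p \<in> topspace M" for p
    using F(3) I(3) that by (fastforce simp: V_def)
  then show ?thesis using that[of I] I by blast
qed

text \<open>The image of a closed ball under the inverse chart. In a Hausdorff space it is also
  closed, so intersections of two such sets are compact.\<close>

lemma compact_ball:
  assumes "good_ball (c, y, \<rho>)" shows "compactin M {p \<in> fst c. snd c p \<in> cball y \<rho>}"
proof -
  have c: "c \<in> A" "cball y \<rho> \<subseteq> chart_image c" using assms by (auto simp: good_ball_def subset_iff)
  have "compactin (top_of_set (chart_image c)) (cball y \<rho>)" using c by (simp add: compactin_subtopology)
  from image_compactin[OF this continuous_inv[OF c(1)]]
  have "compactin M (chart_inv c ` cball y \<rho>)" .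
  moreover have "chart_inv c ` cball y \<rho> = {p \<in> fst c. snd c p \<in> cball y \<rho>}"
  proof (intro equalityI subsetI)
    fix p assume "p \<in> chart_inv c ` cball y \<rho>"
    then obtain x where x: "x \<in> cball y \<rho>" "p = chart_inv c x" by blast
    then have "x \<in> chart_image c" using c by blast
    then show "p \<in> {p \<in> fst c. snd c p \<in> cball y \<rho>}" using inv_in[of x c] inv_right[of x c] x by simp
  next
    fix p assume "p \<in> {p \<in> fst c. snd c p \<in> cball y \<rho>}"
    then show "p \<in> chart_inv c ` cball y \<rho>" using inv_left[OF c(1), of p] by (intro image_eqI[of _ _ "snd c p"]) auto
  qed
  ultimately show ?thesis by simp
qed

abbreviation xi where "xi c \<equiv> riem_chart_function.\<xi> (g c) (F c)"

text \<open>Both points result from the same variation of p, constructed in two charts from frame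
  vectors that correspond under the transition.\<close>

definition switch_cost_le where
  "switch_cost_le \<kappa> \<sigma> c d p \<longleftrightarrow> (\<forall>E \<alpha> a. orthonormal_frame (g c) (snd c p) E \<longrightarrow> \<bar>\<alpha>\<bar> \<le> 1 \<longrightarrow>
     riemannian_dist M A g (chart_inv c (xi c (snd c p) (E a) \<alpha> \<sigma>))
       (chart_inv d (xi d (snd d p) (dd (transition c d) (snd c p) (E a)) \<alpha> \<sigma>)) \<le> ereal \<kappa>)"

text \<open>In the coordinates of d the two points differ by o(\<sigma>^2), and the Riemannian
  distance is Lipschitz with respect to the coordinates.\<close>

lemma switch_chart:
  assumes "good_ball (c, y, \<rho>)" "good_ball (d, z, \<rho>')" "\<eta> > 0"
  shows "\<exists>s0>0. \<forall>\<sigma> p. \<bar>\<sigma>\<bar> \<le> s0 \<longrightarrow> p \<in> fst c \<longrightarrow> snd c p \<in> cball y \<rho> \<longrightarrow> p \<in> fst d \<longrightarrow> snd d p \<in> cball z \<rho>' \<longrightarrow>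
     switch_cost_le (\<eta> * \<sigma>\<^sup>2) \<sigma> c d p"
proof -
  have c: "c \<in> A" "cball y \<rho> \<subseteq> chart_image c" and d: "d \<in> A" "\<rho>' > 0" "cball z (2 * \<rho>') \<subseteq> chart_image d" "cball z \<rho>' \<subseteq> chart_image d"
    using assms by (auto simp: good_ball_def subset_iff)
  interpret cc: chart_change "chart_image c" "chart_image d" "g c" "F c" "g d" "F d" "overlap c d" "transition c d"
    by (rule chart_change[OF c(1) d(1) smooth_f])
  define S where "S = {p \<in> fst c. snd c p \<in> cball y \<rho>} \<inter> {p \<in> fst d. snd d p \<in> cball z \<rho>'}"
  have "compactin M S" unfolding S_def
    by (intro closed_Int_compactin compactin_imp_closedin[OF hausdorff] compact_ball assms)
  then have "compactin (subtopology M (fst c)) S" by (auto simp: compactin_subtopology S_def)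
  from image_compactin[OF this continuous_chart[OF c(1)]]
  have K: "Topological_Spaces.compact (snd c ` S)" by simp
  have KW: "snd c ` S \<subseteq> overlap c d" by (auto simp: S_def)
  obtain C where C: "C > 0" "\<And>x E a. x \<in> cball y \<rho> \<Longrightarrow> orthonormal_frame (g c) x E \<Longrightarrow> norm (E a) \<le> C"
    using cc.c1.frame_bounded[OF compact_cball c(2)] by metis
  obtain C' where C': "C' > 0" "\<And>x E a. x \<in> cball z \<rho>' \<Longrightarrow> orthonormal_frame (g d) x E \<Longrightarrow> norm (E a) \<le> C'"
    using cc.c2.frame_bounded[OF compact_cball d(4)] by metis
  obtain L where L: "L > 0" "\<And>x y. closed_segment x y \<subseteq> cball z (2 * \<rho>') \<Longrightarrow>
     riemannian_dist M A g (chart_inv d x) (chart_inv d y) \<le> ereal (L * norm (x - y))"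
    using dist_le_norm[OF d(1) compact_cball d(3)] by blast
  \<comment> \<open>The accuracy \<eta> / L compensates the Lipschitz constant L.\<close>
  obtain s1 where s1: "s1 > 0" "\<And>\<sigma> x e \<alpha>. \<bar>\<sigma>\<bar> \<le> s1 \<Longrightarrow> x \<in> snd c ` S \<Longrightarrow> norm e \<le> C \<Longrightarrow> \<bar>\<alpha>\<bar> \<le> 1 \<Longrightarrow>
     xi c x e \<alpha> \<sigma> \<in> overlap c d \<and> norm (transition c d (xi c x e \<alpha> \<sigma>) - xi d (transition c d x) (dd (transition c d) x e) \<alpha> \<sigma>) \<le> (\<eta> / L) * \<sigma>\<^sup>2"
    using cc.\<xi>_change[OF K KW, of "\<eta> / L" C] assms(3) L(1) by (metis divide_pos_pos)
  \<comment> \<open>Radius 3/2 \<rho>' and an error of at most \<rho>' / 2 remain within 2 \<rho>',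
    where L is valid; for this \<open>good_ball\<close> asks for the double radius.\<close>
  obtain s2 where s2: "s2 > 0" "\<And>\<sigma> x e \<alpha>. \<bar>\<sigma>\<bar> \<le> s2 \<Longrightarrow> x \<in> cball z \<rho>' \<Longrightarrow> norm e \<le> C' \<Longrightarrow> \<bar>\<alpha>\<bar> \<le> 1 \<Longrightarrow> xi d x e \<alpha> \<sigma> \<in> ball z (3 / 2 * \<rho>')"
    using cc.c2.\<xi>_stay[OF compact_cball, of z \<rho>' "ball z (3 / 2 * \<rho>')" C'] d(2,3) by (force simp: subset_iff)
  \<comment> \<open>Makes (\<eta> / L) \<sigma>^2 at most \<rho>' / 2.\<close>
  define s3 where "s3 = sqrt (\<rho>' / 2 * (L / \<eta>))"
  have s3: "s3 > 0" using d(2) L(1) assms(3) by (simp add: s3_def)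
  show ?thesis
    unfolding switch_cost_le_def
  proof (intro exI[of _ "min s1 (min s2 s3)"] conjI allI impI)
    fix \<sigma> p E \<alpha> a
    assume h: "\<bar>\<sigma>\<bar> \<le> min s1 (min s2 s3)" "p \<in> fst c" "snd c p \<in> cball y \<rho>" "p \<in> fst d" "snd d p \<in> cball z \<rho>'"
       "orthonormal_frame (g c) (snd c p) E" "\<bar>\<alpha>::real\<bar> \<le> 1"
    let ?e = "dd (transition c d) (snd c p) (E a)"
    let ?u = "transition c d (xi c (snd c p) (E a) \<alpha> \<sigma>)" and ?v = "xi d (snd d p) ?e \<alpha> \<sigma>"
    have W: "snd c p \<in> overlap c d" and pS: "snd c p \<in> snd c ` S" using h by (auto simp: S_def)
    have tr: "transition c d (snd c p) = snd d p" by (rule transition_eq[OF c(1) h(2)])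
    have uv: "xi c (snd c p) (E a) \<alpha> \<sigma> \<in> overlap c d" "norm (?u - ?v) \<le> (\<eta> / L) * \<sigma>\<^sup>2"
      using s1(2)[OF _ pS C(2)[OF h(3,6)] h(7), of \<sigma> a] h(1) tr by auto
    have "orthonormal_frame (g d) (snd d p) (\<lambda>a. dd (transition c d) (snd c p) (E a))"
      using cc.frame_change[OF W h(6)] tr by simp
    from C'(2)[OF h(5) this] have v: "?v \<in> ball z (3 / 2 * \<rho>')" using h by (intro s2(2)) auto
    have "\<sigma>\<^sup>2 \<le> s3\<^sup>2" using h(1) s3 by (intro abs_le_square_iff[THEN iffD1]) auto
    then have "(\<eta> / L) * \<sigma>\<^sup>2 \<le> (\<eta> / L) * (\<rho>' / 2 * (L / \<eta>))"
      using assms(3) L(1) d(2) by (intro mult_left_mono) (auto simp: s3_def)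
    also have "\<dots> = \<rho>' / 2" using assms(3) L(1) by simp
    finally have "dist ?u ?v \<le> \<rho>' / 2" unfolding dist_norm by (rule order_trans[OF uv(2)])
    moreover have "dist z ?u \<le> dist z ?v + dist ?u ?v" by (rule dist_triangle2)
    ultimately have "closed_segment ?u ?v \<subseteq> cball z (2 * \<rho>')" using v d(2) by (intro closed_segment_subset) auto
    from L(2)[OF this] have "riemannian_dist M A g (chart_inv d ?u) (chart_inv d ?v) \<le> ereal (L * norm (?u - ?v))" .
    also have "\<dots> \<le> ereal (\<eta> * \<sigma>\<^sup>2)"
      using mult_left_mono[OF uv(2), of L] L(1) by simp
    finally have "riemannian_dist M A g (chart_inv d ?u) (chart_inv d ?v) \<le> ereal (\<eta> * \<sigma>\<^sup>2)" .
    moreover have "chart_inv d ?u = chart_inv c (xi c (snd c p) (E a) \<alpha> \<sigma>)"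
    proof -
      obtain q where q: "q \<in> fst c" "q \<in> fst d" "snd c q = xi c (snd c p) (E a) \<alpha> \<sigma>" using uv(1) by force
      then show ?thesis using transition_eq[OF c(1) q(1)] inv_left[OF c(1) q(1)] inv_left[OF d(1) q(2)] by metis
    qed
    ultimately show "riemannian_dist M A g (chart_inv c (xi c (snd c p) (E a) \<alpha> \<sigma>)) (chart_inv d ?v) \<le> ereal (\<eta> * \<sigma>\<^sup>2)" by simp
  qed (use s1 s2 s3 in auto)
qed

end

lemma (in riem_chart_function) continuous_on_\<zeta>:
  assumes "continuous_on T x" "continuous_on T v" "continuous_on T e" "continuous_on T \<alpha>" "continuous_on T \<beta>"
    "\<And>t. t \<in> T \<Longrightarrow> x t \<in> U"
  shows "continuous_on T (\<lambda>t. \<zeta> (x t) (v t) (e t) (\<alpha> t) (\<beta> t) \<sigma>)"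
proof -
  have cX: "continuous_on T (\<lambda>t. X (x t))"
    by (rule continuous_on_compose2[OF smooth_on_continuous[OF smooth_X] assms(1)]) (use assms(6) in auto)
  show ?thesis unfolding \<zeta>_def Y_def
    by (intro continuous_intros continuous_on_Gam continuous_on_DGam continuous_on_dd[OF smooth_X] cX assms) simp_all
qed

text \<open>Separates the estimate for one curve from the choice of constants:
  \<open>average\<close> and \<open>switch\<close> are uniform facts that do not refer to \<gamma>.
  The constant \<delta> regularizes the arc length, k is the frequency of the test function, and B a
  bound for k known before the curve.\<close>

locale test_curve = soliton_manifold M A g f l
  for M :: "'a topology" and A :: "('a, 'n::finite) chart set" and g f l +
  fixes \<gamma> :: "real \<Rightarrow> 'a" and N :: nat and b :: "nat \<Rightarrow> real" and \<delta> s \<eta> k B :: real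
    and I :: "(('a, 'n) chart \<times> (real^'n) \<times> real) set"
  assumes b0: "b 0 = 0" and bN: "b N = 1" and b_less: "i < N \<Longrightarrow> b i < b (Suc i)"
    and C1: "i < N \<Longrightarrow> C1_curve M A (b i) (b (Suc i)) \<gamma>"
    and \<delta>: "\<delta> > 0" and s: "s > 0" and \<eta>: "\<eta> > 0" and k: "k > 0" "k \<le> B"
    and good: "ci \<in> I \<Longrightarrow> good_ball ci"
    and average: "(c, y, \<rho>) \<in> I \<Longrightarrow> x \<in> cball y \<rho> \<Longrightarrow> soliton_chart.mean_speed_bound (chart_image c) (g c) (F c) l B \<eta> s x"
    and switch: "(c, y, \<rho>) \<in> I \<Longrightarrow> (d, z, \<rho>') \<in> I \<Longrightarrow> \<bar>\<sigma>\<bar> = s \<Longrightarrow> p \<in> fst c \<Longrightarrow> snd c p \<in> cball y \<rho> \<Longrightarrow>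
      p \<in> fst d \<Longrightarrow> snd d p \<in> cball z \<rho>' \<Longrightarrow> switch_cost_le (\<eta> * s\<^sup>2) \<sigma> c d p"
begin

lemma piecewise: "piecewise_C1_curve M A \<gamma>"
  unfolding piecewise_C1_curve_def using b0 bN b_less C1 by blast

lemma b_mono: "i \<le> j \<Longrightarrow> j \<le> N \<Longrightarrow> b i \<le> b j"
  by (rule partition_mono[of N b]) (use b_less in auto)

lemma b_range: "i \<le> N \<Longrightarrow> 0 \<le> b i \<and> b i \<le> 1"
  using b_mono[of 0 i] b_mono[of i N] b0 bN by auto

lemma speed_int: "curve_speed A g \<gamma> integrable_on {0..1}"
  by (rule speed_integrable[OF piecewise])

lemma speed_int_sub: "0 \<le> u \<Longrightarrow> v \<le> 1 \<Longrightarrow> curve_speed A g \<gamma> integrable_on {u..v}"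
  by (rule integrable_on_subinterval[OF speed_int]) auto

lemma \<gamma>_top: "t \<in> {0..1} \<Longrightarrow> \<gamma> t \<in> topspace M"
  by (rule piecewise_topspace[OF piecewise])

definition \<theta> where "\<theta> t = \<delta> * t + integral {0..t} (curve_speed A g \<gamma>)"

lemma \<theta>_diff: assumes "0 \<le> u" "u \<le> v" "v \<le> 1"
  shows "\<theta> v - \<theta> u = \<delta> * (v - u) + integral {u..v} (curve_speed A g \<gamma>)"
proof -
  have "integral {0..u} (curve_speed A g \<gamma>) + integral {u..v} (curve_speed A g \<gamma>) = integral {0..v} (curve_speed A g \<gamma>)"
    by (rule Henstock_Kurzweil_Integration.integral_combine[OF assms(1,2)]) (use assms speed_int_sub in auto)
  then show ?thesis by (simp add: \<theta>_def algebra_simps)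
qed

lemma \<theta>_ge: assumes "0 \<le> u" "u \<le> v" "v \<le> 1" shows "\<theta> v - \<theta> u \<ge> \<delta> * (v - u)"
proof -
  have "0 \<le> integral {u..v} (curve_speed A g \<gamma>)"
    using assms speed_nonneg[OF piecewise] \<gamma>_top by (intro integral_nonneg speed_int_sub) auto
  then show ?thesis using \<theta>_diff[OF assms] by simp
qed

lemma \<theta>_mono: assumes "0 \<le> u" "u \<le> v" "v \<le> 1" shows "\<theta> u \<le> \<theta> v"
  using \<theta>_ge[OF assms] \<delta> assms by (smt (verit) mult_nonneg_nonneg)

lemma \<theta>_0: "\<theta> 0 = 0" by (simp add: \<theta>_def)

lemma \<theta>_continuous: "continuous_on {0..1} \<theta>"
  unfolding \<theta>_def by (intro continuous_intros indefinite_integral_continuous_1 speed_int)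

text \<open>\<open>curve_speed\<close> may be arbitrary at the break points, but two points do not
  affect the integral, so \<theta> has the expected one-sided derivative even there.\<close>

lemma piece_data:
  assumes "i < N" "b i \<le> u" "u \<le> v" "v \<le> b (Suc i)" "c \<in> A" "\<And>t. t \<in> {u..v} \<Longrightarrow> \<gamma> t \<in> fst c"
  obtains D where "\<And>t. t \<in> {u..v} \<Longrightarrow> ((snd c \<circ> \<gamma>) has_vector_derivative D t) (at t within {u..v})"
    "continuous_on {u..v} D" "continuous_on {u..v} (\<lambda>t. sqrt (metric_form (g c) (snd c (\<gamma> t)) (D t) (D t)))"
    "\<And>t. t \<in> {u..v} \<Longrightarrow> (\<theta> has_vector_derivative sqrt (metric_form (g c) (snd c (\<gamma> t)) (D t) (D t)) + \<delta>) (at t within {u..v})"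
proof -
  have r: "0 \<le> b i" "b (Suc i) \<le> 1" using b_range[of i] b_range[of "Suc i"] assms(1) by auto
  obtain D where D: "\<And>t. t \<in> {u..v} \<Longrightarrow> ((snd c \<circ> \<gamma>) has_vector_derivative D t) (at t within {u..v})"
    "continuous_on {u..v} D" and cq: "continuous_on {u..v} (\<lambda>t. sqrt (metric_form (g c) (snd c (\<gamma> t)) (D t) (D t)))"
    and sp: "\<And>t. t \<in> {u..v} - {b i, b (Suc i)} \<Longrightarrow> curve_speed A g \<gamma> t = sqrt (metric_form (g c) (snd c (\<gamma> t)) (D t) (D t))"
    using speed_in_chart[OF C1[OF assms(1)] r assms(2,4,5,6)] by blast
  define q where "q t = sqrt (metric_form (g c) (snd c (\<gamma> t)) (D t) (D t))" for t
  have eq: "\<theta> t = \<theta> u + \<delta> * (t - u) + integral {u..t} q" if "t \<in> {u..v}" for t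
  proof -
    have "integral {u..t} (curve_speed A g \<gamma>) = integral {u..t} q"
      by (rule integral_spike[of "{b i, b (Suc i)}"]) (use sp that in \<open>auto simp: q_def\<close>)
    moreover have "\<theta> t - \<theta> u = \<delta> * (t - u) + integral {u..t} (curve_speed A g \<gamma>)"
      by (rule \<theta>_diff) (use that assms r in auto)
    ultimately show ?thesis by simp
  qed
  have "(\<theta> has_vector_derivative q t + \<delta>) (at t within {u..v})" if t: "t \<in> {u..v}" for t
  proof -
    have "((\<lambda>t. \<theta> u + \<delta> * (t - u)) has_vector_derivative \<delta>) (at t within {u..v})"
      unfolding has_real_derivative_iff_has_vector_derivative[symmetric] by (auto intro!: derivative_eq_intros)
    moreover have "((\<lambda>t. integral {u..t} q) has_vector_derivative q t) (at t within {u..v})"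
      by (rule integral_has_vector_derivative[OF _ t]) (use cq in \<open>simp add: q_def[abs_def]\<close>)
    ultimately have "((\<lambda>t. \<theta> u + \<delta> * (t - u) + integral {u..t} q) has_vector_derivative \<delta> + q t) (at t within {u..v})"
      by (rule has_vector_derivative_add)
    then have "((\<lambda>t. \<theta> u + \<delta> * (t - u) + integral {u..t} q) has_vector_derivative q t + \<delta>) (at t within {u..v})"
      by (simp add: add.commute)
    then show ?thesis by (rule has_vector_derivative_transform[OF t, rotated]) (rule eq)
  qed
  then show ?thesis using that[OF D cq] by (simp add: q_def)
qed

definition Fm where "Fm = Rmax / (2 * l)"

text \<open>The integrand of the second variation for the test function \<phi> = sin (k r), with its
  f-term integrated by parts: (\<phi>^2)'' = 2 k^2 cos (2 k r), and |f| <= Fm.\<close>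

definition \<psi> where
  "\<psi> r = (real CARD('n) - 1) * (k * cos (k * r))\<^sup>2 - l * (sin (k * r))\<^sup>2 + Fm * \<bar>2 * k\<^sup>2 * cos (2 * (k * r))\<bar>"

text \<open>The derivative of \<open>Hh\<close> bounds the mean speed of the varied curves.  The term with \<open>f\<close> stems from
  integration by parts, the last one from \<open>\<delta>\<close>, which keeps the parametrization \<open>\<theta>\<close> strictly increasing
  where the speed of \<open>\<gamma>\<close> vanishes.\<close>

definition Hh where
  "Hh t = \<theta> t + s\<^sup>2 / (2 * real CARD('n)) *
     (integral {0..\<theta> t} \<psi> - k * sin (2 * (k * \<theta> t)) * f (\<gamma> t) + \<eta> * \<theta> t + 2 * \<delta> * (B\<^sup>2 + l) * t)"

lemma \<psi>_continuous: "continuous_on S \<psi>"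
  unfolding \<psi>_def by (intro continuous_intros)

definition P where "P c t e \<sigma> = chart_inv c (xi c (snd c (\<gamma> t)) e (sin (k * \<theta> t)) \<sigma>)"

text \<open>The running estimate: at time \<open>t\<close> there is a frame for which the average distance of the
  \<open>2 n\<close> varied points from the starting point is at most \<open>Hh t - Hh 0\<close> plus the cost \<open>\<kappa>\<close> of the
  changes of chart so far.\<close>

definition reach where
  "reach c t \<kappa> \<longleftrightarrow> (\<exists>E r1 r2. orthonormal_frame (g c) (snd c (\<gamma> t)) E \<and>
     (\<forall>a. riemannian_dist M A g (\<gamma> 0) (P c t (E a) s) \<le> ereal (r1 a) \<and>
          riemannian_dist M A g (\<gamma> 0) (P c t (E a) (- s)) \<le> ereal (r2 a)) \<and>
     (\<Sum>a\<in>UNIV. r1 a + r2 a) / (2 * real CARD('n)) \<le> Hh t - Hh 0 + \<kappa>)"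

lemma reach_switch:
  assumes "(c, y, \<rho>) \<in> I" "(d, z, \<rho>') \<in> I" "\<gamma> t \<in> fst c" "snd c (\<gamma> t) \<in> cball y \<rho>"
      "\<gamma> t \<in> fst d" "snd d (\<gamma> t) \<in> cball z \<rho>'" "reach c t \<kappa>"
  shows "reach d t (\<kappa> + \<eta> * s\<^sup>2)"
proof -
  obtain E r1 r2 where E: "orthonormal_frame (g c) (snd c (\<gamma> t)) E"
    and r1: "\<And>a. riemannian_dist M A g (\<gamma> 0) (P c t (E a) s) \<le> ereal (r1 a)"
    and r2: "\<And>a. riemannian_dist M A g (\<gamma> 0) (P c t (E a) (- s)) \<le> ereal (r2 a)"
    and le: "(\<Sum>a\<in>UNIV. r1 a + r2 a) / (2 * real CARD('n)) \<le> Hh t - Hh 0 + \<kappa>"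
    using assms(7) unfolding reach_def by blast
  define E' where "E' a = dd (transition c d) (snd c (\<gamma> t)) (E a)" for a
  have cd: "c \<in> A" "d \<in> A" using good[OF assms(1)] good[OF assms(2)] by (auto simp: good_ball_def)
  interpret cc: chart_change "chart_image c" "chart_image d" "g c" "F c" "g d" "F d" "overlap c d" "transition c d"
    by (rule chart_change[OF cd smooth_f])
  have W: "snd c (\<gamma> t) \<in> overlap c d" using assms by blast
  have "orthonormal_frame (g d) (snd d (\<gamma> t)) E'"
    using cc.frame_change[OF W E] transition_eq[OF cd(1) assms(3)] by (simp add: E'_def[abs_def])
  moreover have sw: "riemannian_dist M A g (P c t (E a) \<sigma>) (P d t (E' a) \<sigma>) \<le> ereal (\<eta> * s\<^sup>2)" if "\<bar>\<sigma>\<bar> = s" for a \<sigma>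
    using switch[OF assms(1,2) that assms(3-6)] E unfolding P_def E'_def switch_cost_le_def by simp
  have "riemannian_dist M A g (\<gamma> 0) (P d t (E' a) s) \<le> ereal (r1 a + \<eta> * s\<^sup>2)" for a
    by (rule dist_triangle_riem[OF r1 sw]) (use s in auto)
  moreover have "riemannian_dist M A g (\<gamma> 0) (P d t (E' a) (- s)) \<le> ereal (r2 a + \<eta> * s\<^sup>2)" for a
    by (rule dist_triangle_riem[OF r2 sw]) (use s in auto)
  moreover have "(\<Sum>a\<in>(UNIV::'n set). (r1 a + \<eta> * s\<^sup>2) + (r2 a + \<eta> * s\<^sup>2)) / (2 * real CARD('n)) \<le> Hh t - Hh 0 + (\<kappa> + \<eta> * s\<^sup>2)"
  proof -
    have "(\<Sum>a\<in>(UNIV::'n set). (r1 a + \<eta> * s\<^sup>2) + (r2 a + \<eta> * s\<^sup>2)) = (\<Sum>a\<in>UNIV. r1 a + r2 a) + 2 * real CARD('n) * (\<eta> * s\<^sup>2)"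
      by (simp add: sum.distrib)
    then show ?thesis using le by (simp add: add_divide_distrib)
  qed
  ultimately show ?thesis unfolding reach_def
    by (intro exI[of _ E'] exI[of _ "\<lambda>a. r1 a + \<eta> * s\<^sup>2"] exI[of _ "\<lambda>a. r2 a + \<eta> * s\<^sup>2"]) blast
qed

lemma reach_start:
  assumes "(c, y, \<rho>) \<in> I" "\<gamma> 0 \<in> fst c" shows "reach c 0 0"
proof -
  have c: "c \<in> A" using good[OF assms(1)] by (auto simp: good_ball_def)
  interpret c: soliton_chart "chart_image c" "g c" "F c" l by (rule soliton_chart[OF c])
  have x: "snd c (\<gamma> 0) \<in> chart_image c" using assms by blast
  obtain E where E: "orthonormal_frame (g c) (snd c (\<gamma> 0)) E" using c.exists_frame[OF x] by blast
  \<comment> \<open>sin (k \<theta>) vanishes at the start, so all varied points coincide with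
    \<gamma> 0.\<close>
  have "P c 0 (E a) \<sigma> = \<gamma> 0" for a \<sigma> by (simp add: P_def \<theta>_0 c.\<xi>_def inv_left[OF c assms(2)])
  moreover have "riemannian_dist M A g (\<gamma> 0) (\<gamma> 0) \<le> ereal 0"
  proof -
    have "riemannian_dist M A g (chart_inv c (snd c (\<gamma> 0))) (chart_inv c (snd c (\<gamma> 0))) \<le> ereal 0"
      using dist_chart_curve[OF c, of 0 0 "\<lambda>_. snd c (\<gamma> 0)" "\<lambda>_. 0"] x by simp
    then show ?thesis by (simp add: inv_left[OF c assms(2)])
  qed
  ultimately show ?thesis unfolding reach_def
    by (intro exI[of _ E] exI[of _ "\<lambda>_. 0"] conjI allI E) auto
qed

lemma \<theta>_image: "0 \<le> u \<Longrightarrow> v \<le> 1 \<Longrightarrow> \<theta> ` {u..v} \<subseteq> {0..\<theta> 1}"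
  using \<theta>_mono[of 0] \<theta>_mono[of _ 1] \<theta>_0 by force

text \<open>The frame is moved by parallel transport; the lengths of the varied curves bound the
  increase of the distances, and their mean speed is at most the derivative of
  \<open>Hh\<close>.\<close>

lemma reach_piece:
  assumes "i < N" "b i \<le> u" "u \<le> v" "v \<le> b (Suc i)" "(c, y, \<rho>) \<in> I"
    "\<And>t. t \<in> {u..v} \<Longrightarrow> \<gamma> t \<in> fst c \<and> snd c (\<gamma> t) \<in> cball y \<rho>" "reach c u \<kappa>"
  shows "reach c v \<kappa>"
proof -
  let ?n = "real CARD('n)"
  obtain E0 r1 r2 where E0: "orthonormal_frame (g c) (snd c (\<gamma> u)) E0"
    and r1: "\<And>a. riemannian_dist M A g (\<gamma> 0) (P c u (E0 a) s) \<le> ereal (r1 a)"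
    and r2: "\<And>a. riemannian_dist M A g (\<gamma> 0) (P c u (E0 a) (- s)) \<le> ereal (r2 a)"
    and le: "(\<Sum>a\<in>UNIV. r1 a + r2 a) / (2 * ?n) \<le> Hh u - Hh 0 + \<kappa>"
    using assms(7) unfolding reach_def by blast
  have c: "c \<in> A" using good[OF assms(5)] by (auto simp: good_ball_def)
  interpret c: soliton_chart "chart_image c" "g c" "F c" l by (rule soliton_chart[OF c])
  have uv: "0 \<le> u" "v \<le> 1" using b_range[of i] b_range[of "Suc i"] assms(1-4) by auto
  have dom: "\<gamma> t \<in> fst c" and ball: "snd c (\<gamma> t) \<in> cball y \<rho>" if "t \<in> {u..v}" for t using assms(6)[OF that] by auto
  define x where "x t = snd c (\<gamma> t)" for t
  have xU: "x t \<in> chart_image c" if "t \<in> {u..v}" for t using dom[OF that] by (simp add: x_def)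
  obtain D where D0: "\<And>t. t \<in> {u..v} \<Longrightarrow> ((snd c \<circ> \<gamma>) has_vector_derivative D t) (at t within {u..v})"
    and cD: "continuous_on {u..v} D" and cq0: "continuous_on {u..v} (\<lambda>t. sqrt (metric_form (g c) (snd c (\<gamma> t)) (D t) (D t)))"
    and d\<theta>0: "\<And>t. t \<in> {u..v} \<Longrightarrow> (\<theta> has_vector_derivative sqrt (metric_form (g c) (snd c (\<gamma> t)) (D t) (D t)) + \<delta>) (at t within {u..v})"
    using piece_data[OF assms(1-4) c dom] by blast
  have dx: "(x has_vector_derivative D t) (at t within {u..v})" if "t \<in> {u..v}" for t
    using D0[OF that] by (simp add: x_def[abs_def] o_def)
  have cx: "continuous_on {u..v} x"
    using dx by (meson continuous_on_eq_continuous_within has_vector_derivative_continuous)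
  \<comment> \<open>The derivative of \<theta>, positive owing to \<delta>.\<close>
  define q where "q t = sqrt (c.m (x t) (D t) (D t)) + \<delta>" for t
  have cq: "continuous_on {u..v} q" using cq0 unfolding q_def x_def by (intro continuous_on_add continuous_on_const)
  have d\<theta>: "(\<theta> has_vector_derivative q t) (at t within {u..v})" if "t \<in> {u..v}" for t
    using d\<theta>0[OF that] by (simp add: q_def x_def)
  have c\<theta>: "continuous_on {u..v} \<theta>" by (rule continuous_on_subset[OF \<theta>_continuous]) (use uv in auto)
  have mpos: "c.m (x t) w w \<ge> 0" if "t \<in> {u..v}" for t w
    using c.metric_pos[OF xU[OF that], of w] by (cases "w = 0") (auto simp: metric_form_simps)
  have qpos: "q t > 0" if "t \<in> {u..v}" for t using mpos[OF that] \<delta> by (simp add: q_def add_nonneg_pos)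
  obtain E where Eu: "E u = E0" and Eo: "\<And>t. t \<in> {u..v} \<Longrightarrow> orthonormal_frame (g c) (x t) (E t)"
    and dE: "\<And>t a. t \<in> {u..v} \<Longrightarrow> ((\<lambda>t. E t a) has_vector_derivative - Gam (g c) (x t) (D t) (E t a)) (at t within {u..v})"
    using c.parallel_frame_exists[of u v x D E0, OF assms(3) xU dx cD] E0 by (auto simp: x_def)
  have cE: "continuous_on {u..v} (\<lambda>t. E t a)" for a
    using dE by (meson continuous_on_eq_continuous_within has_vector_derivative_continuous)
  define \<alpha> where "\<alpha> t = sin (k * \<theta> t)" for t
  define \<beta> where "\<beta> t = k * cos (k * \<theta> t)" for t
  have c\<alpha>: "continuous_on {u..v} \<alpha>" "continuous_on {u..v} \<beta>" unfolding \<alpha>_def \<beta>_def by (intro continuous_intros c\<theta>)+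
  have d\<alpha>: "(\<alpha> has_vector_derivative q t * \<beta> t) (at t within {u..v})" if "t \<in> {u..v}" for t
  proof -
    have "((\<lambda>t. sin (k * \<theta> t)) has_real_derivative cos (k * \<theta> t) * (k * q t)) (at t within {u..v})"
      using d\<theta>[OF that] unfolding has_real_derivative_iff_has_vector_derivative[symmetric]
      by (auto intro!: derivative_eq_intros)
    then show ?thesis unfolding has_real_derivative_iff_has_vector_derivative \<alpha>_def[abs_def] \<beta>_def by (simp add: ac_simps)
  qed
  define X where "X a \<sigma> t = c.\<xi> (x t) (E t a) (\<alpha> t) \<sigma>" for a \<sigma> t
  define V where "V a \<sigma> t = c.\<zeta> (x t) (D t) (E t a) (\<alpha> t) (q t * \<beta> t) \<sigma>" for a \<sigma> t
  define L where "L a \<sigma> t = sqrt (c.m (X a \<sigma> t) (V a \<sigma> t) (V a \<sigma> t))" for a \<sigma> t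
  have dX: "(X a \<sigma> has_vector_derivative V a \<sigma> t) (at t within {u..v})" if "t \<in> {u..v}" for a \<sigma> t
    unfolding X_def[abs_def] V_def by (rule c.\<xi>_has_derivative[OF dx dE d\<alpha> xU]) (use that in auto)
  have cV: "continuous_on {u..v} (V a \<sigma>)" for a \<sigma>
    unfolding V_def[abs_def] by (intro c.continuous_on_\<zeta> cx cD cE c\<alpha> continuous_on_mult cq xU)
  have cX: "continuous_on {u..v} (X a \<sigma>)" for a \<sigma>
    using dX by (meson continuous_on_eq_continuous_within has_vector_derivative_continuous)
  \<comment> \<open>The velocity with respect to \<theta>; the summand \<delta> of q keeps its
    length below 1.\<close>
  define T where "T t = (1 / q t) *\<^sub>R D t" for t
  have mT: "c.m (x t) (T t) (T t) = c.m (x t) (D t) (D t) / (q t)\<^sup>2" for t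
    by (simp add: T_def metric_form_simps power2_eq_square)
  have mT1: "c.m (x t) (T t) (T t) \<le> 1" if "t \<in> {u..v}" for t
  proof -
    have "c.m (x t) (D t) (D t) = (sqrt (c.m (x t) (D t) (D t)))\<^sup>2" using mpos[OF that] by simp
    also have "\<dots> \<le> (q t)\<^sup>2" using mpos[OF that] \<delta> by (intro power_mono) (auto simp: q_def)
    finally show ?thesis using qpos[OF that] by (simp add: mT)
  qed
  have \<alpha>1: "\<bar>\<alpha> t\<bar> \<le> 1" for t by (simp add: \<alpha>_def)
  have \<beta>B: "\<bar>\<beta> t\<bar> \<le> B" for t
  proof -
    have "\<bar>\<beta> t\<bar> \<le> k * 1" unfolding \<beta>_def abs_mult using k by (intro mult_mono) auto
    then show ?thesis using k by simp
  qed
  have av: "(\<forall>a. X a s t \<in> chart_image c \<and> X a (- s) t \<in> chart_image c) \<and>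
     (\<Sum>a\<in>UNIV. L a s t + L a (- s) t) / (2 * ?n) \<le>
     q t * (1 + s\<^sup>2 / (2 * ?n) * (?n * (\<beta> t)\<^sup>2 - ((\<beta> t)\<^sup>2 + l * (\<alpha> t)\<^sup>2) * c.m (x t) (T t) (T t) - 2 * \<alpha> t * \<beta> t * dd (F c) (x t) (T t) + \<eta>))"
    if t: "t \<in> {u..v}" for t
  proof -
    have "x t \<in> cball y \<rho>" using ball[OF t] by (simp add: x_def)
    from average[OF assms(5) this, unfolded c.mean_speed_bound_def, rule_format, OF mT1[OF t] Eo[OF t] \<alpha>1 \<beta>B]
    have av: "\<forall>a. X a s t \<in> chart_image c \<and> X a (- s) t \<in> chart_image c"
      "c.mean_speed (x t) (T t) (E t) (\<alpha> t) (\<beta> t) s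
      \<le> 1 + s\<^sup>2 / (2 * ?n) * (?n * (\<beta> t)\<^sup>2 - ((\<beta> t)\<^sup>2 + l * (\<alpha> t)\<^sup>2) * c.m (x t) (T t) (T t) - 2 * \<alpha> t * \<beta> t * dd (F c) (x t) (T t) + \<eta>)"
      unfolding X_def by blast+
    \<comment> \<open>Homogeneity passes from the parameter t to \<theta>, in which the velocity T
      and the rate \<beta> satisfy the bounds of \<open>average\<close>.\<close>
    have Vq: "V a \<sigma> t = q t *\<^sub>R c.\<zeta> (x t) (T t) (E t a) (\<alpha> t) (\<beta> t) \<sigma>" for a \<sigma>
      unfolding V_def c.\<zeta>_scale[OF xU[OF t], symmetric] using qpos[OF t] by (simp add: T_def)
    have Lq: "L a \<sigma> t = q t * sqrt (c.m (X a \<sigma> t) (c.\<zeta> (x t) (T t) (E t a) (\<alpha> t) (\<beta> t) \<sigma>) (c.\<zeta> (x t) (T t) (E t a) (\<alpha> t) (\<beta> t) \<sigma>))" for a \<sigma>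
      using qpos[OF t] by (simp add: L_def Vq metric_form_simps mult.assoc[symmetric] real_sqrt_mult)
    have "(\<Sum>a\<in>UNIV. L a s t + L a (- s) t) / (2 * ?n) = q t * c.mean_speed (x t) (T t) (E t) (\<alpha> t) (\<beta> t) s"
      unfolding Lq c.mean_speed_def X_def by (simp add: sum_distrib_left distrib_left)
    also have "\<dots> \<le> q t * (1 + s\<^sup>2 / (2 * ?n) * (?n * (\<beta> t)\<^sup>2 - ((\<beta> t)\<^sup>2 + l * (\<alpha> t)\<^sup>2) * c.m (x t) (T t) (T t) - 2 * \<alpha> t * \<beta> t * dd (F c) (x t) (T t) + \<eta>))"
      using av(2) qpos[OF t] by (intro mult_left_mono) auto
    finally show ?thesis using av(1) by blast
  qed
  have XU: "X a \<sigma> t \<in> chart_image c" if "t \<in> {u..v}" "\<bar>\<sigma>\<bar> = s" for a \<sigma> t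
    using av[OF that(1)] that(2) by (auto simp: abs_if split: if_splits)
  have cL: "continuous_on {u..v} (L a \<sigma>)" if "\<bar>\<sigma>\<bar> = s" for a \<sigma>
    unfolding L_def[abs_def] by (intro continuous_on_real_sqrt c.continuous_on_metric cX cV XU that)
  have dist: "riemannian_dist M A g (P c u (E0 a) \<sigma>) (P c v (E v a) \<sigma>) \<le> ereal (integral {u..v} (L a \<sigma>))" if "\<bar>\<sigma>\<bar> = s" for a \<sigma>
    using dist_chart_curve[OF c assms(3) XU[OF _ that] dX cV, of a] unfolding L_def[abs_def]
    by (simp add: P_def X_def Eu \<alpha>_def x_def)
  \<comment> \<open>The derivative of \<open>Hh\<close>; the inner bracket is the product rule for
    (\<phi>^2)' f along the curve, where (\<phi>^2)' = k sin (2 k \<theta>).\<close>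
  define h where "h t = q t + s\<^sup>2 / (2 * ?n) * (q t * \<psi> (\<theta> t) - (2 * k\<^sup>2 * cos (2 * (k * \<theta> t)) * q t * f (\<gamma> t)
     + k * sin (2 * (k * \<theta> t)) * dd (F c) (x t) (D t)) + \<eta> * q t + 2 * \<delta> * (B\<^sup>2 + l))" for t
  have dH: "(Hh has_vector_derivative h t) (at t within {u..v})" if t: "t \<in> {u..v}" for t
  proof -
    have sub: "\<theta> ` {u..v} \<subseteq> {0..\<theta> 1}" by (rule \<theta>_image[OF uv])
    have "((\<lambda>r. integral {0..r} \<psi>) has_vector_derivative \<psi> (\<theta> t)) (at (\<theta> t) within {0..\<theta> 1})"
      by (rule integral_has_vector_derivative[OF \<psi>_continuous]) (use sub t in blast)
    then have "((\<lambda>r. integral {0..r} \<psi>) has_vector_derivative \<psi> (\<theta> t)) (at (\<theta> t) within \<theta> ` {u..v})"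
      by (rule has_vector_derivative_within_subset[OF _ sub])
    from vector_diff_chain_within[OF d\<theta>[OF t] this]
    have 1: "((\<lambda>t. integral {0..\<theta> t} \<psi>) has_real_derivative q t * \<psi> (\<theta> t)) (at t within {u..v})"
      by (simp add: o_def has_real_derivative_iff_has_vector_derivative)
    have "((\<lambda>t. F c (x t)) has_derivative (\<lambda>h. dd (F c) (x t) (h *\<^sub>R D t))) (at t within {u..v})"
      by (rule has_derivative_compose[OF dx[OF t, unfolded has_vector_derivative_def] smooth_on_has_derivative[OF c.smooth_F xU[OF t]]])
    then have "((\<lambda>t. F c (x t)) has_vector_derivative dd (F c) (x t) (D t)) (at t within {u..v})"
      using linear_scale[OF dd_linear(1)[OF c.smooth_F xU[OF t]]] by (simp add: has_vector_derivative_def)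
    then have "((\<lambda>t. f (\<gamma> t)) has_vector_derivative dd (F c) (x t) (D t)) (at t within {u..v})"
      by (rule has_vector_derivative_transform[OF t, rotated]) (use F_eq[OF c] dom in \<open>simp add: x_def\<close>)
    then have 2: "((\<lambda>t. f (\<gamma> t)) has_real_derivative dd (F c) (x t) (D t)) (at t within {u..v})"
      by (simp add: has_real_derivative_iff_has_vector_derivative)
    have 3: "(\<theta> has_real_derivative q t) (at t within {u..v})" using d\<theta>[OF t] by (simp add: has_real_derivative_iff_has_vector_derivative)
    have "(Hh has_real_derivative h t) (at t within {u..v})"
      unfolding Hh_def[abs_def] h_def
      by (rule derivative_eq_intros 1 2 3 refl)+ (simp add: power2_eq_square algebra_simps)
    then show ?thesis by (simp add: has_real_derivative_iff_has_vector_derivative)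
  qed
  have point: "(\<Sum>a\<in>UNIV. L a s t + L a (- s) t) / (2 * ?n) \<le> h t" if t: "t \<in> {u..v}" for t
  proof -
    define \<tau> where "\<tau> = c.m (x t) (T t) (T t)"
    define w where "w = (\<beta> t)\<^sup>2 + l * (\<alpha> t)\<^sup>2"
    have w0: "w \<ge> 0" using l_pos by (simp add: w_def)
    have wB: "w \<le> B\<^sup>2 + l"
    proof -
      have "(\<beta> t)\<^sup>2 \<le> B\<^sup>2" using \<beta>B[of t] k abs_le_square_iff[of "\<beta> t" B] by simp
      moreover have "(\<alpha> t)\<^sup>2 \<le> 1" using \<alpha>1[of t] by (simp add: abs_square_le_1)
      then have "l * (\<alpha> t)\<^sup>2 \<le> l * 1" using l_pos by (intro mult_left_mono) auto
      ultimately show ?thesis by (simp add: w_def)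
    qed
    \<comment> \<open>The deficit from unit speed costs at most 2 \<delta>, because q^2 - (q -
      \<delta>)^2 <= 2 \<delta> q.\<close>
    have q\<tau>: "q t * (1 - \<tau>) \<le> 2 * \<delta>"
    proof -
      have "q t * \<tau> = c.m (x t) (D t) (D t) / q t" using qpos[OF t] by (simp add: \<tau>_def mT power2_eq_square)
      moreover have "c.m (x t) (D t) (D t) = (q t - \<delta>)\<^sup>2" using mpos[OF t] by (simp add: q_def)
      moreover have "(q t - \<delta>)\<^sup>2 \<ge> q t * (q t - 2 * \<delta>)" by (simp add: power2_eq_square algebra_simps)
      then have "(q t - \<delta>)\<^sup>2 / q t \<ge> q t - 2 * \<delta>" using qpos[OF t] by (simp add: pos_le_divide_eq mult.commute)
      ultimately show ?thesis by (simp add: algebra_simps)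
    qed
    have 1: "q t * (w * (1 - \<tau>)) \<le> 2 * \<delta> * (B\<^sup>2 + l)"
    proof -
      have "q t * (w * (1 - \<tau>)) = (q t * (1 - \<tau>)) * w" by simp
      also have "\<dots> \<le> (2 * \<delta>) * w" using q\<tau> w0 by (rule mult_right_mono)
      also have "\<dots> \<le> (2 * \<delta>) * (B\<^sup>2 + l)" using wB \<delta> by (intro mult_left_mono) auto
      finally show ?thesis by simp
    qed
    define cc where "cc = 2 * k\<^sup>2 * cos (2 * (k * \<theta> t))"
    have 2: "cc * f (\<gamma> t) \<le> Fm * \<bar>cc\<bar>"
    proof -
      have "\<gamma> t \<in> topspace M" by (rule \<gamma>_top) (use t uv in auto)
      from f_bounds[OF this] have "\<bar>f (\<gamma> t)\<bar> \<le> Fm" by (simp add: Fm_def)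
      then have "\<bar>cc\<bar> * \<bar>f (\<gamma> t)\<bar> \<le> \<bar>cc\<bar> * Fm" by (intro mult_left_mono) auto
      then show ?thesis using abs_ge_self[of "cc * f (\<gamma> t)"] by (simp add: abs_mult mult.commute)
    qed
    \<comment> \<open>By the double angle formula the first order term in f is (\<phi>^2)' df(D),
      which is exactly a summand of the product rule in \<open>h\<close>.\<close>
    have ab: "2 * \<alpha> t * \<beta> t * q t * dd (F c) (x t) (T t) = k * sin (2 * (k * \<theta> t)) * dd (F c) (x t) (D t)"
      using qpos[OF t] by (simp add: T_def linear_scale[OF dd_linear(1)[OF c.smooth_F xU[OF t]]] \<alpha>_def \<beta>_def sin_double)
    have \<psi>': "\<psi> (\<theta> t) = (?n - 1) * (\<beta> t)\<^sup>2 - l * (\<alpha> t)\<^sup>2 + Fm * \<bar>cc\<bar>" by (simp add: \<psi>_def \<alpha>_def \<beta>_def cc_def)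
    have "q t * (?n * (\<beta> t)\<^sup>2 - w * \<tau> - 2 * \<alpha> t * \<beta> t * dd (F c) (x t) (T t) + \<eta>)
       = q t * ((?n - 1) * (\<beta> t)\<^sup>2 - l * (\<alpha> t)\<^sup>2) + q t * (w * (1 - \<tau>)) - 2 * \<alpha> t * \<beta> t * q t * dd (F c) (x t) (T t) + \<eta> * q t"
      by (simp add: w_def algebra_simps)
    also have "\<dots> \<le> q t * ((?n - 1) * (\<beta> t)\<^sup>2 - l * (\<alpha> t)\<^sup>2) + 2 * \<delta> * (B\<^sup>2 + l) - k * sin (2 * (k * \<theta> t)) * dd (F c) (x t) (D t) + \<eta> * q t"
      using 1 unfolding ab by simp
    also have "\<dots> \<le> q t * \<psi> (\<theta> t) - (cc * q t * f (\<gamma> t) + k * sin (2 * (k * \<theta> t)) * dd (F c) (x t) (D t)) + \<eta> * q t + 2 * \<delta> * (B\<^sup>2 + l)"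
      using mult_left_mono[OF 2, of "q t"] qpos[OF t] unfolding \<psi>' by (simp add: algebra_simps)
    finally have "s\<^sup>2 / (2 * ?n) * (q t * (?n * (\<beta> t)\<^sup>2 - w * \<tau> - 2 * \<alpha> t * \<beta> t * dd (F c) (x t) (T t) + \<eta>))
       \<le> s\<^sup>2 / (2 * ?n) * (q t * \<psi> (\<theta> t) - (cc * q t * f (\<gamma> t) + k * sin (2 * (k * \<theta> t)) * dd (F c) (x t) (D t)) + \<eta> * q t + 2 * \<delta> * (B\<^sup>2 + l))"
      by (intro mult_left_mono) auto
    moreover have eqQ: "q t * (1 + s\<^sup>2 / (2 * ?n) * Q) = q t + s\<^sup>2 / (2 * ?n) * (q t * Q)" for Q by (simp add: algebra_simps)
    note conjunct2[OF av[OF t], unfolded eqQ, folded \<tau>_def w_def]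
    ultimately show ?thesis unfolding h_def cc_def[symmetric] by linarith
  qed
  have iL: "(L a \<sigma>) integrable_on {u..v}" if "\<bar>\<sigma>\<bar> = s" for a \<sigma>
    by (rule integrable_continuous_real[OF cL[OF that]])
  have ss: "\<bar>s\<bar> = s" "\<bar>- s\<bar> = s" using s by auto
  have ih: "(h has_integral Hh v - Hh u) {u..v}" by (rule fundamental_theorem_of_calculus[OF assms(3) dH])
  have "(\<Sum>a\<in>UNIV. integral {u..v} (L a s) + integral {u..v} (L a (- s))) / (2 * ?n)
      = integral {u..v} (\<lambda>t. (\<Sum>a\<in>UNIV. L a s t + L a (- s) t) / (2 * ?n))"
    using iL[OF ss(1)] iL[OF ss(2)] by (simp add: integral_sum integral_add integrable_add)
  also have "\<dots> \<le> integral {u..v} h"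
    using iL[OF ss(1)] iL[OF ss(2)] ih point
    by (intro integral_le integrable_sum integrable_add integrable_on_divide) (auto simp: has_integral_integrable)
  also have "\<dots> = Hh v - Hh u" using ih by (rule integral_unique)
  finally have tot: "(\<Sum>a\<in>UNIV. integral {u..v} (L a s) + integral {u..v} (L a (- s))) / (2 * ?n) \<le> Hh v - Hh u" .
  show ?thesis unfolding reach_def
  proof (rule exI[of _ "E v"], rule exI[of _ "\<lambda>a. r1 a + integral {u..v} (L a s)"],
      rule exI[of _ "\<lambda>a. r2 a + integral {u..v} (L a (- s))"], intro conjI allI)
    show "orthonormal_frame (g c) (snd c (\<gamma> v)) (E v)" using Eo[of v] assms(3) by (simp add: x_def)
    show "riemannian_dist M A g (\<gamma> 0) (P c v (E v a) s) \<le> ereal (r1 a + integral {u..v} (L a s))" for a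
      by (rule dist_triangle_riem[OF r1 dist[OF ss(1)]])
    show "riemannian_dist M A g (\<gamma> 0) (P c v (E v a) (- s)) \<le> ereal (r2 a + integral {u..v} (L a (- s)))" for a
      by (rule dist_triangle_riem[OF r2 dist[OF ss(2)]])
    have "(\<Sum>a\<in>UNIV. r1 a + integral {u..v} (L a s) + (r2 a + integral {u..v} (L a (- s)))) / (2 * ?n)
      = (\<Sum>a\<in>UNIV. r1 a + r2 a) / (2 * ?n) + (\<Sum>a\<in>UNIV. integral {u..v} (L a s) + integral {u..v} (L a (- s))) / (2 * ?n)"
      by (simp add: sum.distrib add_divide_distrib)
    then show "(\<Sum>a\<in>UNIV. r1 a + integral {u..v} (L a s) + (r2 a + integral {u..v} (L a (- s)))) / (2 * ?n) \<le> Hh v - Hh 0 + \<kappa>"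
      using le tot by linarith
  qed
qed

end

section \<open>Staying in coordinate balls and subdividing the curve\<close>

context soliton_manifold begin

text \<open>The lower bound \<mu> of the metric turns an increase r of \<theta> into a coordinate
  displacement below \<rho> / 2, too short to lead from the half ball out of the ball.\<close>

definition stay_radius :: "(('a, 'n) chart \<times> (real^'n) \<times> real) \<Rightarrow> real \<Rightarrow> bool" where
  "stay_radius = (\<lambda>(c, y, \<rho>) r. \<exists>\<mu>>0. (\<forall>x\<in>cball y \<rho>. \<forall>v. \<mu> * (norm v)\<^sup>2 \<le> metric_form (g c) x v v) \<and> r < sqrt \<mu> * \<rho> / 2)"

lemma stay_radius_exists: assumes "good_ball i" shows "\<exists>r0>0. \<forall>r. 0 < r \<longrightarrow> r \<le> r0 \<longrightarrow> stay_radius i r"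
proof -
  obtain c y \<rho> where i: "i = (c, y, \<rho>)" by (cases i)
  have c: "c \<in> A" "\<rho> > 0" "cball y \<rho> \<subseteq> chart_image c" using assms by (auto simp: i good_ball_def subset_iff)
  interpret c: riem_chart "chart_image c" "g c" by (rule riem_chart[OF c(1)])
  obtain \<mu> where m: "\<mu> > 0" "\<And>x v. x \<in> cball y \<rho> \<Longrightarrow> \<mu> * (norm v)\<^sup>2 \<le> c.m x v v"
    using c.metric_bounds[OF compact_cball c(3)] by metis
  have "stay_radius i r" if "0 < r" "r \<le> sqrt \<mu> * \<rho> / 4" for r
    unfolding stay_radius_def i using m c(2) that by (auto intro!: exI[of _ \<mu>] simp: field_simps)
  moreover have "sqrt \<mu> * \<rho> / 4 > 0" using m c by simp
  ultimately show ?thesis by blast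
qed

end

context test_curve begin

text \<open>Reduces a transitive relation of times to intervals within a single C^1 piece.\<close>

lemma piece_induct:
  assumes uv: "0 \<le> u" "u \<le> v" "v \<le> 1"
    and refl: "\<And>t. t \<in> {u..v} \<Longrightarrow> Q t t"
    and trans: "\<And>x y z. u \<le> x \<Longrightarrow> x \<le> y \<Longrightarrow> y \<le> z \<Longrightarrow> z \<le> v \<Longrightarrow> Q x y \<Longrightarrow> Q y z \<Longrightarrow> Q x z"
    and piece: "\<And>i x y. i < N \<Longrightarrow> b i \<le> x \<Longrightarrow> x \<le> y \<Longrightarrow> y \<le> b (Suc i) \<Longrightarrow> u \<le> x \<Longrightarrow> y \<le> v \<Longrightarrow> Q x y"
  shows "Q u v"
proof -
  \<comment> \<open>Break points clamped to [u, v]; a nontrivial step from \<open>w i\<close> to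
    \<open>w (Suc i)\<close> lies inside piece i.\<close>
  define w where "w i = max u (min v (b i))" for i
  have w: "w i \<in> {u..v}" for i using uv by (auto simp: w_def)
  have "Q u (w i)" if "i \<le> N" for i
    using that
  proof (induction i)
    case 0
    have "w 0 = u" using uv b0 by (simp add: w_def)
    then show ?case using refl uv by simp
  next
    case (Suc i)
    have le: "w i \<le> w (Suc i)" using b_less[of i] Suc.prems by (auto simp: w_def)
    have Q2: "Q (w i) (w (Suc i))"
    proof (cases "w i = w (Suc i)")
      case True
      then show ?thesis using refl[OF w[of i]] by simp
    next
      case False
      then have "b i \<le> w i" "w (Suc i) \<le> b (Suc i)" using le uv by (auto simp: w_def max_def min_def split: if_splits)
      then show ?thesis using Suc.prems le w[of i] w[of "Suc i"] by (intro piece[of i]) auto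
    qed
    have Q1: "Q u (w i)" using Suc.IH Suc.prems by simp
    show ?case by (rule trans[OF order_refl _ le _ Q1 Q2]) (use w[of i] w[of "Suc i"] in simp_all)
  qed
  from this[of N] show ?thesis using uv bN by (simp add: w_def)
qed

text \<open>The coordinate speed is at most 1 / sqrt \<mu> times the Riemannian speed, hence times
  the derivative of \<theta>.\<close>

lemma coordinate_bound:
  assumes "i < N" "b i \<le> u" "u \<le> v" "v \<le> b (Suc i)" "c \<in> A" "\<mu> > 0"
    "\<And>x w. x \<in> K \<Longrightarrow> \<mu> * (norm w)\<^sup>2 \<le> metric_form (g c) x w w"
    "\<And>t. t \<in> {u..v} \<Longrightarrow> \<gamma> t \<in> fst c \<and> snd c (\<gamma> t) \<in> K"
  shows "norm (snd c (\<gamma> v) - snd c (\<gamma> u)) \<le> (\<theta> v - \<theta> u) / sqrt \<mu>"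
proof -
  have dom: "\<gamma> t \<in> fst c" if "t \<in> {u..v}" for t using assms(8)[OF that] by blast
  obtain D where D: "\<And>t. t \<in> {u..v} \<Longrightarrow> ((snd c \<circ> \<gamma>) has_vector_derivative D t) (at t within {u..v})"
    and cD: "continuous_on {u..v} D" "continuous_on {u..v} (\<lambda>t. sqrt (metric_form (g c) (snd c (\<gamma> t)) (D t) (D t)))"
    and d\<theta>: "\<And>t. t \<in> {u..v} \<Longrightarrow> (\<theta> has_vector_derivative sqrt (metric_form (g c) (snd c (\<gamma> t)) (D t) (D t)) + \<delta>) (at t within {u..v})"
    using piece_data[OF assms(1-5) dom] by blast
  have 1: "(D has_integral ((snd c \<circ> \<gamma>) v - (snd c \<circ> \<gamma>) u)) {u..v}"
    by (rule fundamental_theorem_of_calculus[OF assms(3) D])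
  have 2: "((\<lambda>t. sqrt (metric_form (g c) (snd c (\<gamma> t)) (D t) (D t)) + \<delta>) has_integral (\<theta> v - \<theta> u)) {u..v}"
    by (rule fundamental_theorem_of_calculus[OF assms(3) d\<theta>])
  have 3: "((\<lambda>t. (1 / sqrt \<mu>) * (sqrt (metric_form (g c) (snd c (\<gamma> t)) (D t) (D t)) + \<delta>)) has_integral (1 / sqrt \<mu>) * (\<theta> v - \<theta> u)) {u..v}"
    by (rule has_integral_mult_right[OF 2])
  have "norm (integral {u..v} D) \<le> integral {u..v} (\<lambda>t. (1 / sqrt \<mu>) * (sqrt (metric_form (g c) (snd c (\<gamma> t)) (D t) (D t)) + \<delta>))"
  proof (rule integral_norm_bound_integral)
    fix t assume t: "t \<in> {u..v}"
    have "sqrt (\<mu> * (norm (D t))\<^sup>2) \<le> sqrt (metric_form (g c) (snd c (\<gamma> t)) (D t) (D t))"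
      using assms(7,8) t by (intro real_sqrt_le_mono) blast
    then have "sqrt \<mu> * norm (D t) \<le> sqrt (metric_form (g c) (snd c (\<gamma> t)) (D t) (D t)) + \<delta>"
      using \<delta> by (simp add: real_sqrt_mult)
    then show "norm (D t) \<le> (1 / sqrt \<mu>) * (sqrt (metric_form (g c) (snd c (\<gamma> t)) (D t) (D t)) + \<delta>)"
      using assms(6) by (simp add: field_simps)
  qed (use 1 3 in \<open>auto simp: has_integral_integrable\<close>)
  then show ?thesis unfolding integral_unique[OF 1] integral_unique[OF 3] by simp
qed

text \<open>A continuity argument: as long as the curve is in the closed ball,
  \<open>coordinate_bound\<close> keeps it in the open one, so there is no first time of
  exit.\<close>

lemma stay_in_ball:
  assumes ci: "(c, y, \<rho>) \<in> I" and r: "stay_radius (c, y, \<rho>) r"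
    and uv: "0 \<le> u" "u \<le> v" "v \<le> 1" and start: "\<gamma> u \<in> fst c" "snd c (\<gamma> u) \<in> ball y (\<rho> / 2)" and \<theta>r: "\<theta> v - \<theta> u \<le> r"
  shows "\<forall>t\<in>{u..v}. \<gamma> t \<in> fst c \<and> snd c (\<gamma> t) \<in> cball y \<rho>"
proof -
  have gb: "good_ball (c, y, \<rho>)" by (rule good[OF ci])
  then have c: "c \<in> A" by (simp add: good_ball_def)
  obtain \<mu> where m: "\<mu> > 0" "\<And>x v. x \<in> cball y \<rho> \<Longrightarrow> \<mu> * (norm v)\<^sup>2 \<le> metric_form (g c) x v v" "r < sqrt \<mu> * \<rho> / 2"
    using r unfolding stay_radius_def by auto
  \<comment> \<open>The invariant: the distance from the centre grows at most like \<theta> / sqrt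
    \<mu>, which by the choice of r stays below \<rho>.\<close>
  define G where "G t \<longleftrightarrow> \<gamma> t \<in> fst c \<and> norm (snd c (\<gamma> t) - y) \<le> \<rho> / 2 + (\<theta> t - \<theta> u) / sqrt \<mu>" for t
  have small: "\<rho> / 2 + (\<theta> t - \<theta> u) / sqrt \<mu> < \<rho>" if "t \<in> {u..v}" for t
  proof -
    have "\<theta> t - \<theta> u < sqrt \<mu> * \<rho> / 2" using \<theta>_mono[of t v] that uv \<theta>r m(3) by auto
    then have "(\<theta> t - \<theta> u) / sqrt \<mu> < \<rho> / 2" using m(1) by (simp add: field_simps)
    then show ?thesis by linarith
  qed
  define V where "V = {p \<in> fst c. snd c p \<in> ball y \<rho>}"
  define V' where "V' = {p \<in> fst c. snd c p \<in> cball y \<rho>}"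
  have "openin (subtopology M (fst c)) V" unfolding V_def
    by (rule openin_continuous_map_preimage[OF continuous_chart[OF c], of "ball y \<rho>", unfolded topspace_domain[OF c]])
      (simp add: open_openin[symmetric])
  then have Vo: "openin M V" using openin_trans_full[OF _ chart(1)[OF c]] by blast
  have V'c: "closedin M V'" unfolding V'_def by (rule compactin_imp_closedin[OF hausdorff compact_ball[OF gb]])
  have GV: "\<gamma> t \<in> V" if "G t" "t \<in> {u..v}" for t
    using that small[OF that(2)] by (auto simp: G_def V_def dist_norm norm_minus_commute)
  have "G u \<longrightarrow> (\<forall>t\<in>{u..v}. G t)"
  proof (rule piece_induct[OF uv, where Q = "\<lambda>x z. G x \<longrightarrow> (\<forall>t\<in>{x..z}. G t)"])
    fix x z w assume "x \<le> z" "z \<le> w" "G x \<longrightarrow> (\<forall>t\<in>{x..z}. G t)" "G z \<longrightarrow> (\<forall>t\<in>{z..w}. G t)"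
    then show "G x \<longrightarrow> (\<forall>t\<in>{x..w}. G t)" by (metis atLeastAtMost_iff linear order_refl)
  next
    fix i x z assume h: "i < N" "b i \<le> x" "x \<le> z" "z \<le> b (Suc i)" "u \<le> x" "z \<le> v"
    have cm: "continuous_map (top_of_set {x..z}) M \<gamma>"
    proof -
      have "top_of_set {x..z} = subtopology (top_of_set {b i..b (Suc i)}) {x..z}"
        using h by (simp add: subtopology_subtopology Int_absorb1)
      then show ?thesis using continuous_map_from_subtopology[OF C1_curve_continuous[OF C1[OF h(1)]]] by simp
    qed
    show "G x \<longrightarrow> (\<forall>t\<in>{x..z}. G t)"
    proof
      assume Gx: "G x"
      have step: "G t" if t: "t \<in> {x..z}" and K: "\<And>q. q \<in> {x..t} \<Longrightarrow> \<gamma> q \<in> V'" for t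
      proof -
        have "norm (snd c (\<gamma> t) - snd c (\<gamma> x)) \<le> (\<theta> t - \<theta> x) / sqrt \<mu>"
          by (rule coordinate_bound[OF h(1,2) _ _ c m(1), where K = "cball y \<rho>"]) (use m(2) t h K in \<open>auto simp: V'_def\<close>)
        moreover have "norm (snd c (\<gamma> t) - y) \<le> norm (snd c (\<gamma> t) - snd c (\<gamma> x)) + norm (snd c (\<gamma> x) - y)"
          using norm_triangle_ineq[of "snd c (\<gamma> t) - snd c (\<gamma> x)" "snd c (\<gamma> x) - y"] by simp
        moreover have "\<gamma> t \<in> fst c" using K[of t] t by (simp add: V'_def)
        ultimately show ?thesis using Gx by (simp add: G_def diff_divide_distrib)
      qed
      have VV': "V \<subseteq> V'" by (auto simp: V_def V'_def)
      \<comment> \<open>The times outside the open ball; a first one exists because Z is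
        compact.\<close>
      define Z where "Z = {t \<in> {x..z}. \<gamma> t \<notin> V}"
      have "Z = {}"
      proof (rule ccontr)
        assume ne: "Z \<noteq> {}"
        have "openin (top_of_set {x..z}) {t \<in> {x..z}. \<gamma> t \<in> V}"
          using openin_continuous_map_preimage[OF cm Vo] by simp
        moreover have "Z = {x..z} - {t \<in> {x..z}. \<gamma> t \<in> V}" by (auto simp: Z_def)
        ultimately have "closedin (top_of_set {x..z}) Z" by (simp add: closedin_diff)
        then have "closed Z" using closedin_closed_trans by blast
        moreover have "Z \<subseteq> {x..z}" by (auto simp: Z_def)
        ultimately have "Topological_Spaces.compact Z" using compact_eq_bounded_closed bounded_subset by (metis bounded_closed_interval)
        then obtain t where t: "t \<in> Z" "\<And>q. q \<in> Z \<Longrightarrow> t \<le> q" using compact_attains_inf[OF _ ne] by blast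
        have tz: "t \<in> {x..z}" "\<gamma> t \<notin> V" using t(1) by (auto simp: Z_def)
        have lt: "\<gamma> q \<in> V" if "q \<in> {x..<t}" for q using t(2)[of q] that tz by (force simp: Z_def)
        have "x < t" using GV[OF Gx] h tz by (cases "x = t") auto
        \<comment> \<open>At time t the curve might leave the domain of the chart. This is excluded
          because V' is closed in M and contains all earlier points.\<close>
        have "\<gamma> t \<in> V'"
        proof (rule ccontr)
          assume "\<gamma> t \<notin> V'"
          moreover have "\<gamma> t \<in> topspace M" using \<gamma>_top tz h uv by auto
          ultimately have "eventually (\<lambda>q. \<gamma> q \<in> topspace M - V') (at t within {x..z})"
            using V'c by (intro eventually_in_open[OF cm tz(1)]) auto
          then obtain d where d: "d > 0" "\<And>q. q \<in> {x..z} \<Longrightarrow> q \<noteq> t \<Longrightarrow> dist q t < d \<Longrightarrow> \<gamma> q \<notin> V'"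
            unfolding eventually_at by auto
          define q where "q = max x (t - d / 2)"
          have "q \<in> {x..<t}" "dist q t < d" using \<open>x < t\<close> d(1) by (auto simp: q_def dist_real_def)
          then show False using d(2)[of q] lt[of q] VV' tz by auto
        qed
        then have "\<gamma> q \<in> V'" if "q \<in> {x..t}" for q using lt[of q] VV' that by (cases "q = t") auto
        from step[OF tz(1) this] have "\<gamma> t \<in> V" using GV tz h by auto
        then show False using tz by blast
      qed
      then have "\<gamma> q \<in> V'" if "q \<in> {x..z}" for q using that VV' by (auto simp: Z_def)
      then show "\<forall>t\<in>{x..z}. G t" using step by auto
    qed
  qed auto
  moreover have "G u" using start by (simp add: G_def dist_norm norm_minus_commute)
  ultimately show ?thesis using GV by (auto simp: V_def less_imp_le)
qed

lemma reach_step: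
  assumes "(c, y, \<rho>) \<in> I" "stay_radius (c, y, \<rho>) r" "0 \<le> u" "u \<le> v" "v \<le> 1"
    "\<gamma> u \<in> fst c" "snd c (\<gamma> u) \<in> ball y (\<rho> / 2)" "\<theta> v - \<theta> u \<le> r" "reach c u \<kappa>"
  shows "reach c v \<kappa> \<and> \<gamma> v \<in> fst c \<and> snd c (\<gamma> v) \<in> cball y \<rho>"
proof -
  have stay: "\<forall>t\<in>{u..v}. \<gamma> t \<in> fst c \<and> snd c (\<gamma> t) \<in> cball y \<rho>" by (rule stay_in_ball[OF assms(1-8)])
  have "reach c u \<kappa> \<longrightarrow> reach c v \<kappa>"
  proof (rule piece_induct[OF assms(3-5), where Q = "\<lambda>x z. reach c x \<kappa> \<longrightarrow> reach c z \<kappa>"])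
    fix i x z assume h: "i < N" "b i \<le> x" "x \<le> z" "z \<le> b (Suc i)" "u \<le> x" "z \<le> v"
    show "reach c x \<kappa> \<longrightarrow> reach c z \<kappa>" using reach_piece[OF h(1-4) assms(1)] stay h by auto
  qed auto
  then show ?thesis using assms(4,9) stay by auto
qed

text \<open>The intermediate value theorem gives times equidistant in \<theta>. At each step the
  chart is exchanged for one whose half ball contains the point, so there are at most J changes,
  whatever the curve.\<close>

lemma chain:
  assumes cov: "\<And>p. p \<in> topspace M \<Longrightarrow> \<exists>(c, y, \<rho>)\<in>I. p \<in> fst c \<and> snd c p \<in> ball y (\<rho> / 2)"
    and r: "\<And>i. i \<in> I \<Longrightarrow> stay_radius i r" and J: "J > 0" "\<theta> 1 \<le> real J * r" and j: "j \<le> J"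
  shows "\<exists>t\<in>{0..1}. \<theta> t = real j * \<theta> 1 / real J \<and> (\<exists>(c, y, \<rho>)\<in>I. \<gamma> t \<in> fst c \<and> snd c (\<gamma> t) \<in> ball y (\<rho> / 2) \<and> reach c t (real j * (\<eta> * s\<^sup>2)))"
  using j
proof (induction j)
  case 0
  obtain c y \<rho> where "(c, y, \<rho>) \<in> I" "\<gamma> 0 \<in> fst c" "snd c (\<gamma> 0) \<in> ball y (\<rho> / 2)" using cov[OF \<gamma>_top[of 0]] by auto
  moreover from this have "reach c 0 0" by (intro reach_start)
  ultimately show ?case by (intro bexI[of _ 0]) (auto simp: \<theta>_0)
next
  case (Suc j)
  then obtain t c y \<rho> where t: "t \<in> {0..1}" "\<theta> t = real j * \<theta> 1 / real J" "(c, y, \<rho>) \<in> I" "\<gamma> t \<in> fst c"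
    "snd c (\<gamma> t) \<in> ball y (\<rho> / 2)" "reach c t (real j * (\<eta> * s\<^sup>2))" by auto
  have \<theta>1: "\<theta> 1 \<ge> 0" using \<theta>_mono[of 0 1] \<theta>_0 by simp
  have "\<theta> t \<le> real (Suc j) * \<theta> 1 / real J" unfolding t(2) using \<theta>1 by (intro divide_right_mono mult_right_mono) auto
  moreover have "real (Suc j) * \<theta> 1 / real J \<le> \<theta> 1"
  proof -
    have "real (Suc j) * \<theta> 1 \<le> real J * \<theta> 1" using Suc.prems \<theta>1 by (intro mult_right_mono) auto
    then show ?thesis using J(1) by (simp add: divide_le_eq mult.commute)
  qed
  moreover have "continuous_on {t..1} \<theta>" by (rule continuous_on_subset[OF \<theta>_continuous]) (use t in auto)
  ultimately obtain t' where t': "t \<le> t'" "t' \<le> 1" "\<theta> t' = real (Suc j) * \<theta> 1 / real J"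
    using IVT'[of \<theta> t "real (Suc j) * \<theta> 1 / real J" 1] t(1) by auto
  have "\<theta> t' - \<theta> t = \<theta> 1 / real J" unfolding t(2) t'(3) by (simp add: algebra_simps add_divide_distrib)
  also have "\<dots> \<le> r" using J by (simp add: divide_le_eq mult.commute)
  finally have st: "reach c t' (real j * (\<eta> * s\<^sup>2)) \<and> \<gamma> t' \<in> fst c \<and> snd c (\<gamma> t') \<in> cball y \<rho>"
    by (intro reach_step[OF t(3) r[OF t(3)] _ t'(1,2) t(4,5) _ t(6)]) (use t(1) in auto)
  have t'01: "t' \<in> {0..1}" using t t' by auto
  obtain d z \<rho>' where d: "(d, z, \<rho>') \<in> I" "\<gamma> t' \<in> fst d" "snd d (\<gamma> t') \<in> ball z (\<rho>' / 2)" using cov[OF \<gamma>_top[OF t'01]] by auto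
  have "\<rho>' > 0" using good[OF d(1)] by (simp add: good_ball_def)
  then have "snd d (\<gamma> t') \<in> cball z \<rho>'" using d(3) by auto
  then have "reach d t' (real j * (\<eta> * s\<^sup>2) + \<eta> * s\<^sup>2)" using st d by (intro reach_switch[OF t(3) d(1)]) auto
  then have "reach d t' (real (Suc j) * (\<eta> * s\<^sup>2))" by (simp add: algebra_simps)
  then show ?case using t'01 t'(3) d by (intro bexI[of _ t']) auto
qed

text \<open>cos (2 k r) changes sign at pi / (4 k) and 3 pi / (4 k); the three parts contribute 1 /
  (2 k), 1 / k and 1 / (2 k).\<close>

lemma integral_abs_cos: "integral {0..pi / k} (\<lambda>r. \<bar>cos (2 * (k * r))\<bar>) \<le> 2 / k"
proof -
  have d: "((\<lambda>r. sin (2 * (k * r)) / (2 * k)) has_vector_derivative cos (2 * (k * r))) (at r within S)" for r S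
    unfolding has_real_derivative_iff_has_vector_derivative[symmetric] using k by (auto intro!: derivative_eq_intros)
  have i: "((\<lambda>r. cos (2 * (k * r))) has_integral sin (2 * (k * v)) / (2 * k) - sin (2 * (k * u)) / (2 * k)) {u..v}" if "u \<le> v" for u v
    by (rule fundamental_theorem_of_calculus[OF that d])
  define a b' e where "a = pi / (4 * k)" and "b' = 3 * pi / (4 * k)" and "e = pi / k"
  have ord: "0 \<le> a" "a \<le> b'" "b' \<le> e" using k by (auto simp: a_def b'_def e_def field_simps)
  have ka: "2 * (k * a) = pi / 2" "2 * (k * b') = 3 / 2 * pi" "2 * (k * e) = 2 * pi" using k by (auto simp: a_def b'_def e_def)
  have mono: "u \<le> v \<Longrightarrow> 2 * (k * u) \<le> 2 * (k * v)" for u v using k by simp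
  have s32: "sin (3 * pi / 2) = -1" using sin_3over2_pi by (metis times_divide_eq_left)
  have c1: "((\<lambda>r. \<bar>cos (2 * (k * r))\<bar>) has_integral 1 / (2 * k)) {0..a}"
  proof (rule has_integral_eq)
    show "((\<lambda>r. cos (2 * (k * r))) has_integral 1 / (2 * k)) {0..a}" using i[OF ord(1)] by (simp add: ka)
    fix r assume "r \<in> {0..a}"
    then have "cos (2 * (k * r)) \<ge> 0" using mono[of r a] ka(1) k by (intro cos_ge_zero) (auto intro: order_trans[of _ 0])
    then show "cos (2 * (k * r)) = \<bar>cos (2 * (k * r))\<bar>" by simp
  qed
  have c2: "((\<lambda>r. \<bar>cos (2 * (k * r))\<bar>) has_integral 1 / k) {a..b'}"
  proof (rule has_integral_eq)
    have "- (sin (2 * (k * b')) / (2 * k) - sin (2 * (k * a)) / (2 * k)) = 1 / k"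
      unfolding ka sin_3over2_pi sin_pi_half by (simp add: field_simps)
    then show "((\<lambda>r. - cos (2 * (k * r))) has_integral 1 / k) {a..b'}"
      using has_integral_neg[OF i[OF ord(2)]] by metis
    fix r assume "r \<in> {a..b'}"
    then have "pi / 2 \<le> 2 * (k * r)" "2 * (k * r) \<le> 3 / 2 * pi" using mono[of a r] mono[of r b'] ka by auto
    then have "cos (2 * (k * r) - pi) \<ge> 0" by (intro cos_ge_zero) auto
    then have "cos (2 * (k * r)) \<le> 0" by (simp add: cos_diff)
    then show "- cos (2 * (k * r)) = \<bar>cos (2 * (k * r))\<bar>" by simp
  qed
  have c3: "((\<lambda>r. \<bar>cos (2 * (k * r))\<bar>) has_integral 1 / (2 * k)) {b'..e}"
  proof (rule has_integral_eq)
    show "((\<lambda>r. cos (2 * (k * r))) has_integral 1 / (2 * k)) {b'..e}" using i[OF ord(3)] by (simp add: ka s32)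
    fix r assume "r \<in> {b'..e}"
    then have "3 / 2 * pi \<le> 2 * (k * r)" "2 * (k * r) \<le> 2 * pi" using mono[of b' r] mono[of r e] ka by auto
    then have "cos (2 * (k * r) - 2 * pi) \<ge> 0" by (intro cos_ge_zero) auto
    then have "cos (2 * (k * r)) \<ge> 0" by (simp add: cos_diff)
    then show "cos (2 * (k * r)) = \<bar>cos (2 * (k * r))\<bar>" by simp
  qed
  have "((\<lambda>r. \<bar>cos (2 * (k * r))\<bar>) has_integral 1 / (2 * k) + 1 / k + 1 / (2 * k)) {0..e}"
    by (rule has_integral_combine[OF _ ord(3) has_integral_combine[OF ord(1,2) c1 c2] c3]) (use ord in simp)
  then have "integral {0..e} (\<lambda>r. \<bar>cos (2 * (k * r))\<bar>) = 1 / (2 * k) + 1 / k + 1 / (2 * k)" by (rule integral_unique)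
  then show ?thesis using k by (simp add: e_def field_simps)
qed

lemma Fm_nonneg: "Fm \<ge> 0"
  using Rmax_nonneg l_pos by (simp add: Fm_def)

text \<open>The squares of sine and cosine have mean 1/2 over [0, pi / k]; the last summand is Fm
  times 2 k^2 times 2 / k.\<close>

lemma integral_\<psi>:
  "integral {0..pi / k} \<psi> \<le> (real CARD('n) - 1) * k * pi / 2 - l * pi / (2 * k) + 4 * k * Fm"
proof -
  let ?n = "real CARD('n)"
  define \<psi>1 where "\<psi>1 r = (?n - 1) * (k * cos (k * r))\<^sup>2 - l * (sin (k * r))\<^sup>2" for r
  define \<Psi> where "\<Psi> r = (?n - 1) * k\<^sup>2 * (r / 2 + sin (k * r) * cos (k * r) / (2 * k)) - l * (r / 2 - sin (k * r) * cos (k * r) / (2 * k))" for r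
  have "(\<Psi> has_real_derivative \<psi>1 r) (at r within S)" for r S
  proof -
    have "((\<lambda>r. sin (k * r) * cos (k * r) / (2 * k)) has_real_derivative ((cos (k * r))\<^sup>2 - (sin (k * r))\<^sup>2) / 2) (at r within S)"
      using k by (auto intro!: derivative_eq_intros simp: field_simps power2_eq_square)
    then have "(\<Psi> has_real_derivative ((?n - 1) * k\<^sup>2 * (1 / 2 + ((cos (k * r))\<^sup>2 - (sin (k * r))\<^sup>2) / 2) - l * (1 / 2 - ((cos (k * r))\<^sup>2 - (sin (k * r))\<^sup>2) / 2))) (at r within S)"
      unfolding \<Psi>_def[abs_def] by (intro DERIV_diff DERIV_cmult DERIV_add DERIV_cdivide DERIV_ident)
    then show ?thesis by (simp add: \<psi>1_def power_mult_distrib sin_squared_eq algebra_simps diff_divide_distrib)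
  qed
  then have "(\<psi>1 has_integral \<Psi> (pi / k) - \<Psi> 0) {0..pi / k}"
    using k by (intro fundamental_theorem_of_calculus) (auto simp: has_real_derivative_iff_has_vector_derivative[symmetric])
  then have hi: "(\<psi>1 has_integral \<Psi> (pi / k) - \<Psi> 0) {0..pi / k}" .
  have 1: "(\<psi>1 has_integral (?n - 1) * k * pi / 2 - l * pi / (2 * k)) {0..pi / k}"
  proof -
    have "\<Psi> (pi / k) - \<Psi> 0 = (?n - 1) * k * pi / 2 - l * pi / (2 * k)"
      using k by (simp add: \<Psi>_def power2_eq_square mult.commute)
    then show ?thesis using hi by simp
  qed
  have "(\<lambda>r. \<bar>cos (2 * (k * r))\<bar>) integrable_on {0..pi / k}" by (intro integrable_continuous_real continuous_intros)
  then have 2: "((\<lambda>r. (Fm * (2 * k\<^sup>2)) * \<bar>cos (2 * (k * r))\<bar>) has_integral (Fm * (2 * k\<^sup>2)) * integral {0..pi / k} (\<lambda>r. \<bar>cos (2 * (k * r))\<bar>)) {0..pi / k}"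
    by (intro has_integral_mult_right integrable_integral)
  have "\<psi> = (\<lambda>r. \<psi>1 r + (Fm * (2 * k\<^sup>2)) * \<bar>cos (2 * (k * r))\<bar>)"
    by (simp add: fun_eq_iff \<psi>_def \<psi>1_def abs_mult)
  then have "integral {0..pi / k} \<psi> = ((?n - 1) * k * pi / 2 - l * pi / (2 * k)) + (Fm * (2 * k\<^sup>2)) * integral {0..pi / k} (\<lambda>r. \<bar>cos (2 * (k * r))\<bar>)"
    using integral_unique[OF has_integral_add[OF 1 2]] by simp
  also have "(Fm * (2 * k\<^sup>2)) * integral {0..pi / k} (\<lambda>r. \<bar>cos (2 * (k * r))\<bar>) \<le> (Fm * (2 * k\<^sup>2)) * (2 / k)"
    using Fm_nonneg by (intro mult_left_mono integral_abs_cos) auto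
  also have "(Fm * (2 * k\<^sup>2)) * (2 / k) = 4 * k * Fm" using k by (simp add: power2_eq_square)
  finally show ?thesis by simp
qed

text \<open>At \<theta> = pi / k the test function vanishes again, so all varied points are \<gamma>
  1 and each bound r1, r2 is at least d0; the boundary term of \<open>Hh\<close> vanishes there
  too.\<close>

lemma distance_bound:
  assumes cov: "\<And>p. p \<in> topspace M \<Longrightarrow> \<exists>(c, y, \<rho>)\<in>I. p \<in> fst c \<and> snd c p \<in> ball y (\<rho> / 2)"
    and r: "\<And>i. i \<in> I \<Longrightarrow> stay_radius i r" and J: "J > 0" "\<theta> 1 \<le> real J * r"
    and k\<theta>: "k * \<theta> 1 = pi" and d: "ereal d0 \<le> riemannian_dist M A g (\<gamma> 0) (\<gamma> 1)"
  shows "d0 \<le> \<theta> 1 + s\<^sup>2 / (2 * real CARD('n)) *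
     ((real CARD('n) - 1) * k * pi / 2 - l * pi / (2 * k) + 4 * k * Fm + \<eta> * \<theta> 1 + 2 * \<delta> * (B\<^sup>2 + l)) + real J * (\<eta> * s\<^sup>2)"
proof -
  let ?n = "real CARD('n)"
  obtain t c y \<rho> where t: "t \<in> {0..1}" "\<theta> t = real J * \<theta> 1 / real J" "(c, y, \<rho>) \<in> I" "\<gamma> t \<in> fst c" "reach c t (real J * (\<eta> * s\<^sup>2))"
    using chain[OF cov r J order_refl] by blast
  have "\<theta> t = \<theta> 1" using t(2) J(1) by simp
  moreover have "\<delta> * (1 - t) \<le> \<theta> 1 - \<theta> t" using \<theta>_ge[of t 1] t(1) by auto
  \<comment> \<open>\<theta> increases strictly by its summand \<delta> t, so the last point of the
    chain is the end of the curve.\<close>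
  ultimately have "t = 1" using \<delta> t(1) by (simp add: mult_le_0_iff)
  then have re: "\<gamma> 1 \<in> fst c" "reach c 1 (real J * (\<eta> * s\<^sup>2))" using t by auto
  have c: "c \<in> A" using good[OF t(3)] by (auto simp: good_ball_def)
  interpret c: soliton_chart "chart_image c" "g c" "F c" l by (rule soliton_chart[OF c])
  have P1: "P c 1 e \<sigma> = \<gamma> 1" for e \<sigma> by (simp add: P_def k\<theta> c.\<xi>_def inv_left[OF c re(1)])
  obtain r1 r2 where r1: "\<And>a. riemannian_dist M A g (\<gamma> 0) (\<gamma> 1) \<le> ereal (r1 a)" "\<And>a. riemannian_dist M A g (\<gamma> 0) (\<gamma> 1) \<le> ereal (r2 a)"
    and le: "(\<Sum>a\<in>(UNIV::'n set). r1 a + r2 a) / (2 * ?n) \<le> Hh 1 - Hh 0 + real J * (\<eta> * s\<^sup>2)"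
    using re(2) unfolding reach_def P1 by blast
  have "d0 \<le> r1 a" "d0 \<le> r2 a" for a using order_trans[OF d r1(1)[of a]] order_trans[OF d r1(2)[of a]] by auto
  then have "(\<Sum>a\<in>(UNIV::'n set). d0 + d0) \<le> (\<Sum>a\<in>(UNIV::'n set). r1 a + r2 a)" by (intro sum_mono add_mono)
  then have "(\<Sum>a\<in>(UNIV::'n set). d0 + d0) / (2 * ?n) \<le> (\<Sum>a\<in>(UNIV::'n set). r1 a + r2 a) / (2 * ?n)" by (rule divide_right_mono) simp
  then have "d0 \<le> Hh 1 - Hh 0 + real J * (\<eta> * s\<^sup>2)" using le by simp
  moreover have "Hh 0 = 0" by (simp add: Hh_def \<theta>_0)
  moreover have \<theta>k: "\<theta> 1 = pi / k" using k\<theta> k by (simp add: field_simps)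
  have "Hh 1 \<le> \<theta> 1 + s\<^sup>2 / (2 * ?n) *
     ((?n - 1) * k * pi / 2 - l * pi / (2 * k) + 4 * k * Fm + \<eta> * \<theta> 1 + 2 * \<delta> * (B\<^sup>2 + l))"
  proof -
    have "Hh 1 = \<theta> 1 + s\<^sup>2 / (2 * ?n) * (integral {0..pi / k} \<psi> + \<eta> * \<theta> 1 + 2 * \<delta> * (B\<^sup>2 + l))"
      unfolding Hh_def k\<theta> \<theta>k[symmetric] by simp
    also have "\<dots> \<le> \<theta> 1 + s\<^sup>2 / (2 * ?n) *
     ((?n - 1) * k * pi / 2 - l * pi / (2 * k) + 4 * k * Fm + \<eta> * \<theta> 1 + 2 * \<delta> * (B\<^sup>2 + l))"
      using integral_\<psi> by (intro add_left_mono mult_left_mono) auto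
    finally show ?thesis .
  qed
  ultimately show ?thesis by simp
qed

end

section \<open>Choice of the constants and the contradiction\<close>

lemma finite_common_scale:
  fixes Q :: "'i \<Rightarrow> real \<Rightarrow> bool"
  assumes "finite I" "\<And>i. i \<in> I \<Longrightarrow> \<exists>s0>0. \<forall>s. 0 < s \<longrightarrow> s \<le> s0 \<longrightarrow> Q i s"
  shows "\<exists>s0>0. \<forall>s. 0 < s \<longrightarrow> s \<le> s0 \<longrightarrow> (\<forall>i\<in>I. Q i s)"
  using assms
proof (induction I)
  case empty
  then show ?case by (intro exI[of _ 1]) auto
next
  case (insert i I)
  obtain s1 where s1: "s1 > 0" "\<forall>s. 0 < s \<longrightarrow> s \<le> s1 \<longrightarrow> Q i s" using insert.prems by blast
  obtain s2 where s2: "s2 > 0" "\<forall>s. 0 < s \<longrightarrow> s \<le> s2 \<longrightarrow> (\<forall>i\<in>I. Q i s)" using insert.IH insert.prems by blast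
  show ?case using s1 s2 by (intro exI[of _ "min s1 s2"]) auto
qed

context soliton_manifold begin

lemma curve_length_ge_dist:
  "piecewise_C1_curve M A \<gamma> \<Longrightarrow> riemannian_dist M A g (\<gamma> 0) (\<gamma> 1) \<le> ereal (curve_length A g \<gamma>)"
  unfolding riemannian_dist_def by (intro INF_lower) auto

text \<open>One s for the finitely many balls and pairs of balls, obtained without reference to any
  curve.\<close>

lemma common_scale:
  assumes "finite I" "\<And>i. i \<in> I \<Longrightarrow> good_ball i" "\<eta> > 0" "B \<ge> 0"
  obtains s where "s > 0"
    "\<And>c y \<rho> x. (c, y, \<rho>) \<in> I \<Longrightarrow> x \<in> cball y \<rho> \<Longrightarrow> soliton_chart.mean_speed_bound (chart_image c) (g c) (F c) l B \<eta> s x"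
    "\<And>c y \<rho> d z \<rho>' \<sigma> p. (c, y, \<rho>) \<in> I \<Longrightarrow> (d, z, \<rho>') \<in> I \<Longrightarrow> \<bar>\<sigma>\<bar> = s \<Longrightarrow> p \<in> fst c \<Longrightarrow> snd c p \<in> cball y \<rho> \<Longrightarrow>
      p \<in> fst d \<Longrightarrow> snd d p \<in> cball z \<rho>' \<Longrightarrow> switch_cost_le (\<eta> * s\<^sup>2) \<sigma> c d p"
proof -
  define Q1 where "Q1 = (\<lambda>(c, y, \<rho>::real) s. \<forall>x\<in>cball y \<rho>. soliton_chart.mean_speed_bound (chart_image c) (g c) (F c) l B \<eta> s x)"
  define Q2 where "Q2 = (\<lambda>((c, y, \<rho>::real), (d, z, \<rho>'::real)) s. \<forall>\<sigma> p. \<bar>\<sigma>\<bar> = s \<longrightarrow> p \<in> fst c \<longrightarrow> snd c p \<in> cball y \<rho> \<longrightarrow>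
      p \<in> fst d \<longrightarrow> snd d p \<in> cball z \<rho>' \<longrightarrow> switch_cost_le (\<eta> * s\<^sup>2) \<sigma> c d p)"
  have "\<exists>s0>0. \<forall>s. 0 < s \<longrightarrow> s \<le> s0 \<longrightarrow> (\<forall>i\<in>I. Q1 i s)"
  proof (rule finite_common_scale[OF assms(1)])
    fix i assume "i \<in> I"
    then have gb: "good_ball i" by (rule assms(2))
    obtain c y \<rho> where i: "i = (c, y, \<rho>)" by (cases i)
    have c: "c \<in> A" "cball y \<rho> \<subseteq> chart_image c" using gb by (auto simp: i good_ball_def subset_iff)
    interpret c: soliton_chart "chart_image c" "g c" "F c" l by (rule soliton_chart[OF c(1)])
    show "\<exists>s0>0. \<forall>s. 0 < s \<longrightarrow> s \<le> s0 \<longrightarrow> Q1 i s"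
      using c.mean_speed_bound_uniform[OF compact_cball c(2) assms(3,4)] unfolding Q1_def i case_prod_conv by blast
  qed
  then obtain s1 where s1: "s1 > 0" "\<And>s i. 0 < s \<Longrightarrow> s \<le> s1 \<Longrightarrow> i \<in> I \<Longrightarrow> Q1 i s" by blast
  have "\<exists>s0>0. \<forall>s. 0 < s \<longrightarrow> s \<le> s0 \<longrightarrow> (\<forall>ij\<in>I \<times> I. Q2 ij s)"
  proof (rule finite_common_scale[OF finite_cartesian_product[OF assms(1,1)]])
    fix ij assume ij: "ij \<in> I \<times> I"
    obtain c y \<rho> d z \<rho>' where e: "ij = ((c, y, \<rho>), (d, z, \<rho>'))" by (cases ij) auto
    have gb: "good_ball (c, y, \<rho>)" "good_ball (d, z, \<rho>')" using ij assms(2) by (auto simp: e)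
    obtain s0 where s0: "s0 > 0" and s0': "\<And>\<sigma> p. \<bar>\<sigma>\<bar> \<le> s0 \<Longrightarrow> p \<in> fst c \<Longrightarrow> snd c p \<in> cball y \<rho> \<Longrightarrow> p \<in> fst d \<Longrightarrow> snd d p \<in> cball z \<rho>' \<Longrightarrow>
     switch_cost_le (\<eta> * \<sigma>\<^sup>2) \<sigma> c d p"
      using switch_chart[OF gb assms(3)] by blast
    have "Q2 ij s" if "0 < s" "s \<le> s0" for s
      unfolding Q2_def e case_prod_conv
    proof (intro allI impI)
      fix \<sigma> p
      assume h: "\<bar>\<sigma>\<bar> = s" "p \<in> fst c" "snd c p \<in> cball y \<rho>" "p \<in> fst d" "snd d p \<in> cball z \<rho>'"
      have "\<sigma>\<^sup>2 = s\<^sup>2" using h(1) by (metis power2_abs)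
      then show "switch_cost_le (\<eta> * s\<^sup>2) \<sigma> c d p" using s0'[of \<sigma> p] h that by simp
    qed
    then show "\<exists>s0>0. \<forall>s. 0 < s \<longrightarrow> s \<le> s0 \<longrightarrow> Q2 ij s" using s0 by blast
  qed
  then obtain s2 where s2: "s2 > 0" "\<And>s ij. 0 < s \<Longrightarrow> s \<le> s2 \<Longrightarrow> ij \<in> I \<times> I \<Longrightarrow> Q2 ij s" by blast
  define s where "s = min s1 s2"
  have s: "s > 0" using s1(1) s2(1) by (simp add: s_def)
  have q1: "Q1 i s" if "i \<in> I" for i using s1(2)[OF s _ that] by (simp add: s_def)
  have q2: "Q2 (i, j) s" if "i \<in> I" "j \<in> I" for i j using s2(2)[OF s, of "(i, j)"] that by (simp add: s_def)
  show ?thesis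
  proof (rule that[OF s], goal_cases)
    case (1 c y \<rho> x)
    from q1[OF 1(1), unfolded Q1_def case_prod_conv, rule_format, OF 1(2)] show ?case .
  next
    case (2 c y \<rho> d z \<rho>' \<sigma> p)
    from q2[OF 2(1,2), unfolded Q2_def case_prod_conv, rule_format, OF 2(3-7)] show ?case .
  qed
qed

text \<open>By contradiction. The order of choices matters: cover, J, \<eta> and s come first, and
  the curve last, with an excess length below the gain of order s^2 that the variation
  yields.\<close>

lemma dist_le:
  assumes "connected_space M" "p \<in> topspace M" "q \<in> topspace M"
  shows "riemannian_dist M A g p q \<le> ereal (pi / sqrt l * sqrt (real CARD('n) - 1 + 4 * Rmax / (pi * l)))"
proof (rule ccontr)
  let ?n = "real CARD('n)"
  let ?D = "pi / sqrt l * sqrt (?n - 1 + 4 * Rmax / (pi * l))"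
  assume "\<not> riemannian_dist M A g p q \<le> ereal ?D"
  then have gt: "ereal ?D < riemannian_dist M A g p q" by simp
  obtain r where "riemannian_dist M A g p q \<le> ereal r" using dist_finite[OF assms] by blast
  then obtain d0 where d0: "riemannian_dist M A g p q = ereal d0"
    using gt by (cases "riemannian_dist M A g p q") auto
  have n1: "?n \<ge> 1" by (simp add: Suc_leI)
  have Dr: "?n - 1 + 4 * Rmax / (pi * l) \<ge> 0" using n1 Rmax_nonneg l_pos by (intro add_nonneg_nonneg) auto
  then have D0: "?D \<ge> 0" using l_pos by simp
  have dD: "?D < d0" using gt d0 by simp
  then have dpos: "d0 > 0" using D0 by linarith
  define Fb where "Fb = Rmax / (2 * l)"
  \<comment> \<open>Up to the factor -2 d0 this is the bound for the second variation at length d0;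
    it is positive because d0 exceeds the claimed bound.\<close>
  define G where "G = l * d0\<^sup>2 - (?n - 1) * pi\<^sup>2 - 8 * pi * Fb"
  have G: "G > 0"
  proof -
    have "?D\<^sup>2 < d0\<^sup>2" using dD D0 by (intro power_strict_mono) auto
    moreover have "?D\<^sup>2 = pi\<^sup>2 / l * (?n - 1 + 4 * Rmax / (pi * l))"
      using Dr l_pos by (simp add: power_mult_distrib power_divide)
    ultimately have "pi\<^sup>2 / l * (?n - 1 + 4 * Rmax / (pi * l)) < d0\<^sup>2" by metis
    then have "l * (pi\<^sup>2 / l * (?n - 1 + 4 * Rmax / (pi * l))) < l * d0\<^sup>2" using l_pos by (rule mult_strict_left_mono)
    moreover have "l * (pi\<^sup>2 / l * (?n - 1 + 4 * Rmax / (pi * l))) = (?n - 1) * pi\<^sup>2 + 8 * pi * Fb"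
      using l_pos by (simp add: Fb_def power2_eq_square field_simps)
    ultimately show ?thesis by (simp add: G_def)
  qed
  \<comment> \<open>A gain guaranteed for every length \<Theta> between d0 and d0 + 1.\<close>
  define \<kappa> where "\<kappa> = G / (2 * (d0 + 1))"
  have \<kappa>: "\<kappa> > 0" using G dpos by (simp add: \<kappa>_def)
  \<comment> \<open>Bounds the frequency k = pi / \<Theta>, for \<Theta> >= d0, before the curve is
    known.\<close>
  define B where "B = pi / d0"
  have B: "B > 0" using dpos by (simp add: B_def)
  obtain I where I: "finite I" "\<And>i. i \<in> I \<Longrightarrow> good_ball i"
    "\<And>p. p \<in> topspace M \<Longrightarrow> \<exists>(c, y, \<rho>)\<in>I. p \<in> fst c \<and> snd c p \<in> ball y (\<rho> / 2)" using finite_cover by blast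
  obtain r0 where r0: "r0 > 0" "\<And>i. i \<in> I \<Longrightarrow> stay_radius i r0"
    using finite_common_scale[OF I(1), of stay_radius] stay_radius_exists[OF I(2)] by (metis order_refl)
  \<comment> \<open>The number of steps depends on d0 and the cover only; it precedes \<eta> because
    every step may cost \<eta> s^2.\<close>
  obtain J0 :: nat where J0: "(d0 + 1) / r0 \<le> real J0" using real_arch_simple by blast
  define J where "J = Suc J0"
  have J: "J > 0" "d0 + 1 \<le> real J * r0" using J0 r0(1) by (auto simp: J_def field_simps)
  \<comment> \<open>Collects the coefficients of \<eta>: at most d0 + 1 from \<eta> \<Theta>, and 2
    n J from the chart changes once s^2 / (2 n) is factored out.\<close>
  define W where "W = d0 + 1 + 2 * ?n * real J"
  have dn: "W > 0" using dpos by (simp add: W_def add_pos_nonneg)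
  define \<eta> where "\<eta> = \<kappa> / (4 * W)"
  have \<eta>: "\<eta> > 0" using \<kappa> dn by (simp add: \<eta>_def)
  obtain s where s: "s > 0" and av: "\<And>c y \<rho> x. (c, y, \<rho>) \<in> I \<Longrightarrow> x \<in> cball y \<rho> \<Longrightarrow>
      soliton_chart.mean_speed_bound (chart_image c) (g c) (F c) l B \<eta> s x"
    and sw: "\<And>c y \<rho> d z \<rho>' \<sigma> p. (c, y, \<rho>) \<in> I \<Longrightarrow> (d, z, \<rho>') \<in> I \<Longrightarrow> \<bar>\<sigma>\<bar> = s \<Longrightarrow> p \<in> fst c \<Longrightarrow> snd c p \<in> cball y \<rho> \<Longrightarrow>
      p \<in> fst d \<Longrightarrow> snd d p \<in> cball z \<rho>' \<Longrightarrow> switch_cost_le (\<eta> * s\<^sup>2) \<sigma> c d p"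
    by (rule common_scale[OF I(1,2) \<eta>, of B]) (use B in auto)
  \<comment> \<open>At most half of the gain s^2 \<kappa> / (4 n) obtained in the end.\<close>
  define \<epsilon> where "\<epsilon> = min 1 (s\<^sup>2 * \<kappa> / (8 * ?n))"
  have \<epsilon>: "\<epsilon> > 0" "\<epsilon> \<le> 1" "\<epsilon> \<le> s\<^sup>2 * \<kappa> / (8 * ?n)" using s \<kappa> by (auto simp: \<epsilon>_def)
  \<comment> \<open>The first bound keeps \<Theta> below d0 + \<epsilon>, the second limits the loss
    from regularizing the arc length to \<kappa> / 4.\<close>
  define \<delta> where "\<delta> = min (\<epsilon> / 2) (\<kappa> / 8 / (B\<^sup>2 + l))"
  have Bl: "B\<^sup>2 + l > 0" using l_pos by (simp add: add_nonneg_pos)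
  have "\<epsilon> / 2 > 0" "\<kappa> / 8 / (B\<^sup>2 + l) > 0" using \<epsilon>(1) \<kappa> Bl by simp_all
  then have "\<delta> > 0" unfolding \<delta>_def by (simp only: min_less_iff_conj)
  moreover have "\<delta> \<le> \<epsilon> / 2" unfolding \<delta>_def by (rule min.cobounded1)
  ultimately have \<delta>: "\<delta> > 0" "\<delta> \<le> \<epsilon> / 2" .
  have \<delta>B: "2 * \<delta> * (B\<^sup>2 + l) \<le> \<kappa> / 4"
  proof -
    have "\<delta> \<le> \<kappa> / 8 / (B\<^sup>2 + l)" unfolding \<delta>_def by (rule min.cobounded2)
    then have "\<delta> * (B\<^sup>2 + l) \<le> \<kappa> / 8" by (simp only: pos_le_divide_eq[OF Bl])
    then show ?thesis by (simp only: mult.assoc)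
  qed
  have "riemannian_dist M A g p q < ereal (d0 + \<epsilon> / 2)" using d0 \<epsilon> by simp
  then obtain \<gamma> where \<gamma>: "piecewise_C1_curve M A \<gamma>" "\<gamma> 0 = p" "\<gamma> 1 = q" "curve_length A g \<gamma> < d0 + \<epsilon> / 2"
    unfolding riemannian_dist_def INF_less_iff by auto
  obtain N :: nat and b where b: "b 0 = 0" "b N = 1" "\<And>i. i < N \<Longrightarrow> b i < b (Suc i)" "\<And>i. i < N \<Longrightarrow> C1_curve M A (b i) (b (Suc i)) \<gamma>"
    using \<gamma>(1) unfolding piecewise_C1_curve_def by blast
  define \<Theta> where "\<Theta> = \<delta> + curve_length A g \<gamma>"
  have "d0 \<le> curve_length A g \<gamma>" using curve_length_ge_dist[OF \<gamma>(1)] \<gamma>(2,3) d0 by simp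
  then have \<Theta>: "d0 \<le> \<Theta>" "\<Theta> < d0 + \<epsilon>" using \<gamma>(4) \<delta> by (auto simp: \<Theta>_def)
  have \<Theta>1: "\<Theta> \<le> d0 + 1" using \<Theta> \<epsilon> by simp
  have \<Theta>p: "\<Theta> > 0" using \<Theta> dpos by simp
  define k where "k = pi / \<Theta>"
  have k: "k > 0" "k \<le> B" using \<Theta> \<Theta>p dpos by (auto simp: k_def B_def intro!: divide_left_mono)
  interpret tc: test_curve M A g f l \<gamma> N b \<delta> s \<eta> k B I
    by unfold_locales (fact b(1) b(2) \<delta>(1) s \<eta> k l_pos | rule b I(2) av sw; assumption)+
  have \<theta>1: "tc.\<theta> 1 = \<Theta>" by (simp add: tc.\<theta>_def \<Theta>_def curve_length_def)
  have "d0 \<le> \<Theta> + s\<^sup>2 / (2 * ?n) *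
     ((?n - 1) * k * pi / 2 - l * pi / (2 * k) + 4 * k * Fb + \<eta> * \<Theta> + 2 * \<delta> * (B\<^sup>2 + l)) + real J * (\<eta> * s\<^sup>2)"
    unfolding \<theta>1[symmetric] Fb_def tc.Fm_def[symmetric]
    by (rule tc.distance_bound[OF I(3) r0(2) J(1)]) (use \<theta>1 J(2) \<Theta>1 \<Theta>p \<gamma> d0 in \<open>auto simp: k_def\<close>)
  moreover have "(?n - 1) * k * pi / 2 - l * pi / (2 * k) + 4 * k * Fb \<le> - \<kappa>"
  proof -
    have eq: "(?n - 1) * k * pi / 2 - l * pi / (2 * k) + 4 * k * Fb = - (l * \<Theta>\<^sup>2 - (?n - 1) * pi\<^sup>2 - 8 * pi * Fb) / (2 * \<Theta>)"
      using \<Theta>p by (simp add: k_def field_simps power2_eq_square)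
    have "l * d0\<^sup>2 \<le> l * \<Theta>\<^sup>2" using \<Theta> dpos l_pos by (intro mult_left_mono power_mono) auto
    then have "G \<le> l * \<Theta>\<^sup>2 - (?n - 1) * pi\<^sup>2 - 8 * pi * Fb" by (simp add: G_def)
    then have "G / (2 * (d0 + 1)) \<le> (l * \<Theta>\<^sup>2 - (?n - 1) * pi\<^sup>2 - 8 * pi * Fb) / (2 * \<Theta>)"
      using G \<Theta>1 \<Theta>p by (intro frac_le) auto
    then show ?thesis unfolding eq \<kappa>_def minus_divide_left[symmetric] by (rule le_imp_neg_le)
  qed
  moreover have "\<eta> * \<Theta> + 2 * ?n * (real J * \<eta>) \<le> \<kappa> / 4"
  proof -
    have "\<eta> * \<Theta> + 2 * ?n * (real J * \<eta>) \<le> \<eta> * (d0 + 1) + 2 * ?n * (real J * \<eta>)"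
      using \<eta> \<Theta>1 by (intro add_right_mono mult_left_mono) auto
    also have "\<dots> = \<eta> * W" by (simp add: W_def algebra_simps)
    also have "\<dots> = \<kappa> / 4" using dn by (simp add: \<eta>_def)
    finally show ?thesis .
  qed
  moreover have "real J * (\<eta> * s\<^sup>2) = s\<^sup>2 / (2 * ?n) * (2 * ?n * (real J * \<eta>))" by simp
  ultimately have "d0 \<le> \<Theta> + s\<^sup>2 / (2 * ?n) * (- \<kappa> + \<kappa> / 4 + \<kappa> / 4)"
  proof -
    define E0 where "E0 = (?n - 1) * k * pi / 2 - l * pi / (2 * k) + 4 * k * Fb"
    assume 1: "d0 \<le> \<Theta> + s\<^sup>2 / (2 * ?n) *
     ((?n - 1) * k * pi / 2 - l * pi / (2 * k) + 4 * k * Fb + \<eta> * \<Theta> + 2 * \<delta> * (B\<^sup>2 + l)) + real J * (\<eta> * s\<^sup>2)"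
      and 2: "(?n - 1) * k * pi / 2 - l * pi / (2 * k) + 4 * k * Fb \<le> - \<kappa>"
      and 3: "\<eta> * \<Theta> + 2 * ?n * (real J * \<eta>) \<le> \<kappa> / 4"
      and 4: "real J * (\<eta> * s\<^sup>2) = s\<^sup>2 / (2 * ?n) * (2 * ?n * (real J * \<eta>))"
    have "s\<^sup>2 / (2 * ?n) * (E0 + \<eta> * \<Theta> + 2 * \<delta> * (B\<^sup>2 + l)) + s\<^sup>2 / (2 * ?n) * (2 * ?n * (real J * \<eta>))
       = s\<^sup>2 / (2 * ?n) * (E0 + (\<eta> * \<Theta> + 2 * ?n * (real J * \<eta>)) + 2 * \<delta> * (B\<^sup>2 + l))"
      unfolding distrib_left[symmetric] by (simp add: algebra_simps)
    also have "\<dots> \<le> s\<^sup>2 / (2 * ?n) * (- \<kappa> + \<kappa> / 4 + \<kappa> / 4)"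
      using 2 3 \<delta>B by (intro mult_left_mono) (auto simp: E0_def)
    finally show ?thesis using 1 unfolding 4 E0_def[symmetric] by linarith
  qed
  \<comment> \<open>The bracket is - \<kappa> / 2, which the factor s^2 / (2 n) turns into the
    gain.\<close>
  then have "s\<^sup>2 * \<kappa> / (4 * ?n) \<le> \<Theta> - d0" by (simp add: field_simps)
  also have "\<dots> < \<epsilon>" using \<Theta> by simp
  also have "\<dots> \<le> s\<^sup>2 * \<kappa> / (8 * ?n)" by (rule \<epsilon>(3))
  finally have "s\<^sup>2 * \<kappa> / (4 * ?n) < s\<^sup>2 * \<kappa> / (8 * ?n)" .
  then show False using s \<kappa> by (simp add: field_simps)
qed

end

theorem corollary1p12:
  fixes X :: "'a topology"
    and A :: "('a, 'n::finite) chart set"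
    and g :: "('a, 'n) metric_tensor"
    and f :: "'a \<Rightarrow> real"
    and l :: real
  assumes "riemannian_manifold X A g"
    and "compact_space X"
    and "connected_space X"
    and "topspace X \<noteq> {}"
    and "l > 0"
    and "smooth_function A f"
    and "gradient_soliton_equation A g f l"
    and "\<forall>p\<in>topspace X. scalar_curvature A g p + grad_norm_sq A g f p = 2 * l * f p"
  shows "riemannian_diameter X A g \<le>
           ereal (pi / sqrt l *
             sqrt (real CARD('n) - 1
                   + 4 * (GREATEST r. r \<in> scalar_curvature A g ` topspace X) / (pi * l)))"
proof -
  interpret soliton_manifold X A g f l
    by unfold_locales (use assms in auto)
  show ?thesis
    unfolding riemannian_diameter_def Rmax_def[symmetric]
    by (rule SUP_least) (use dist_le[OF assms(3)] in auto)
qed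

end
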